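(* Assume that, for almost every realization of $\mathcal N$, the clan of ancestors $\mathcal A^\varphi$ is finite for every $\varphi\in\Gamma\times\mathbb{R}\times\mathbb{R}^+$. Then for every fixed $t\in\mathbb{R}$ and $\gamma\in\Gamma$, $\lim_{\Lambda\nearrow\mathbb{Z}^d}\eta^\Lambda_t(\gamma)=\eta_t(\gamma)$ almost surely. In particular, as $\Lambda\nearrow\mathbb{Z}^d$, $G_\Lambda$ converges weakly to $\mu$, the (time-independent) law of $\eta_t$.
   Context: Fix $\alpha>0$ and a strictly convex potential $V:\mathbb{Z}^d\to\mathbb{R}^+\cup\{+\infty\}$ with $V(\vec0)=0$. $\Gamma$ is the set of finite cycles of $\mathbb{Z}^d$ (a cycle of length $n\ge2$ on distinct sites $x_1,\dots,x_n$ maps $x_i\mapsto x_{i+1}$ mod $n$ and fixes other sites; support $\{\gamma\}$), $w(\gamma)=\exp\{-\alpha\sum_{x\in\{\gamma\}}V(\gamma(x)-x)\}$; $\gamma\not\sim\gamma'$ if $\{\gamma\}\cap\{\gamma'\}\neq\emptyset$. $\mathcal N$ is a Poisson point process on $\Gamma\times\mathbb{R}\times\mathbb{R}^+$ with intensity $w(\gamma)\,dt\,e^{-s}ds$. For any point set $\mathcal M\subseteq\Gamma\times\mathbb{R}\times\mathbb{R}^+$ and $\varphi=(\gamma,t,s)$: $\mathcal A_1^\varphi(\mathcal M)=\{(\gamma',t',s')\in\mathcal M:\gamma'\not\sim\gamma,\ t'<t<t'+s'\}$, $\mathcal A_{n+1}^\varphi=\bigcup_{\varphi'\in\mathcal A_n^\varphi}\mathcal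 A_1^{\varphi'}$, clan $\mathcal A^\varphi=\bigcup_{n\ge1}\mathcal A^\varphi_n$; $\mathcal D_0=\emptyset$, $\mathcal K_n=\{\varphi\in\mathcal M:\mathcal A_1^\varphi\setminus\mathcal D_{n-1}=\emptyset\}$, $\mathcal D_n=\{\varphi\in\mathcal M:\mathcal A_1^\varphi\cap\mathcal K_n\ne\emptyset\}$, $\mathcal K(\mathcal M)=\bigcup_n\mathcal K_n$; and $\eta_t(\mathcal M)(\gamma)=\#\{(\gamma,t',s')\in\mathcal K(\mathcal M):t'\le t<t'+s'\}$. Set $\eta_t=\eta_t(\mathcal N)$, and for $\Lambda\subseteq\mathbb{Z}^d$, $\mathcal N^\Lambda=\{(\gamma,t,s)\in\mathcal N:\{\gamma\}\subset\Lambda\}$ and $\eta^\Lambda_t=\eta_t(\mathcal N^\Lambda)$. For finite $\Lambda$, $G_\Lambda$ is the probability on configurations $\eta\in\{0,1\}^\Gamma$ supported on those with $\eta(\gamma)=0$ unless $\{\gamma\}\subset\Lambda$ and with no two present cycles having intersecting supports, given by $G_\Lambda(\eta)\propto\prod_\gamma w(\gamma)^{\eta(\gamma)}$ (equivalently, the law on permutations fixing $\Lambda^c$ proportional to $\exp\{-\alpha\sum_{x\in\Lambda}V(\sigma(x)-x)\}$). *)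

theory Defs
  imports "HOL-Analysis.Analysis" "HOL-Probability.Probability"
begin

text \<open>Sites of Z^d are elements of int^'d ('d a finite index type, d = CARD('d)).
  A permutation of Z^d is a map on sites; its support is the set of moved points.\<close>

definition supp :: "('a \<Rightarrow> 'a) \<Rightarrow> 'a set" where
  "supp g = {x. g x \<noteq> x}"

definition is_cycle :: "('a \<Rightarrow> 'a) \<Rightarrow> bool" where
  "is_cycle g \<longleftrightarrow> bij g \<and> finite (supp g) \<and> supp g \<noteq> {} \<and>
     (\<forall>x\<in>supp g. \<forall>y\<in>supp g. \<exists>n. (g ^^ n) x = y)"

definition cycles :: "(int^'d \<Rightarrow> int^'d) set" where
  "cycles = {g. is_cycle g}"

definition cweight :: "real \<Rightarrow> (int^'d \<Rightarrow> ereal) \<Rightarrow> (int^'d \<Rightarrow> int^'d) \<Rightarrow> real" where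
  "cweight \<alpha> V g =
     (let S = (\<Sum>x\<in>supp g. V (g x - x)) in if S = \<infinity> then 0 else exp (- \<alpha> * real_of_ereal S))"

definition strictly_convex_pot :: "(int^'d \<Rightarrow> ereal) \<Rightarrow> bool" where
  "strictly_convex_pot V \<longleftrightarrow> (\<exists>U :: real^'d \<Rightarrow> ereal.
      (\<forall>x. V x = U (\<chi> i. real_of_int (x $ i))) \<and>
      (\<forall>x y u. x \<noteq> y \<and> U x < \<infinity> \<and> U y < \<infinity> \<and> 0 < u \<and> u < 1 \<longrightarrow>
          U (u *\<^sub>R x + (1 - u) *\<^sub>R y) < ereal u * U x + ereal (1 - u) * U y))"

definition incompat :: "('a \<Rightarrow> 'a) \<Rightarrow> ('a \<Rightarrow> 'a) \<Rightarrow> bool" where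
  "incompat g h \<longleftrightarrow> supp g \<inter> supp h \<noteq> {}"

definition anc1 :: "(('a \<Rightarrow> 'a) \<times> real \<times> real) set \<Rightarrow> ('a \<Rightarrow> 'a) \<times> real \<times> real
                     \<Rightarrow> (('a \<Rightarrow> 'a) \<times> real \<times> real) set" where
  "anc1 M \<phi> = {\<phi>' \<in> M. incompat (fst \<phi>') (fst \<phi>) \<and>
                  fst (snd \<phi>') < fst (snd \<phi>) \<and> fst (snd \<phi>) < fst (snd \<phi>') + snd (snd \<phi>')}"

text \<open>ancn M phi n is A_{n+1} of phi.\<close>
fun ancn :: "(('a \<Rightarrow> 'a) \<times> real \<times> real) set \<Rightarrow> ('a \<Rightarrow> 'a) \<times> real \<times> real \<Rightarrow> nat
              \<Rightarrow> (('a \<Rightarrow> 'a) \<times> real \<times> real) set" where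
  "ancn M \<phi> 0 = anc1 M \<phi>"
| "ancn M \<phi> (Suc n) = (\<Union>\<phi>'\<in>ancn M \<phi> n. anc1 M \<phi>')"

definition clan :: "(('a \<Rightarrow> 'a) \<times> real \<times> real) set \<Rightarrow> ('a \<Rightarrow> 'a) \<times> real \<times> real
                     \<Rightarrow> (('a \<Rightarrow> 'a) \<times> real \<times> real) set" where
  "clan M \<phi> = (\<Union>n. ancn M \<phi> n)"

text \<open>KD M n = (K_n, D_n) for n >= 1, and D_0 = {} (K_0 = {} is a dummy).\<close>
fun KD :: "(('a \<Rightarrow> 'a) \<times> real \<times> real) set \<Rightarrow> nat
           \<Rightarrow> (('a \<Rightarrow> 'a) \<times> real \<times> real) set \<times> (('a \<Rightarrow> 'a) \<times> real \<times> real) set" where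
  "KD M 0 = ({}, {})"
| "KD M (Suc n) =
     (let K = {\<phi> \<in> M. anc1 M \<phi> - snd (KD M n) = {}}
      in (K, {\<phi> \<in> M. anc1 M \<phi> \<inter> K \<noteq> {}}))"

definition kept :: "(('a \<Rightarrow> 'a) \<times> real \<times> real) set \<Rightarrow> (('a \<Rightarrow> 'a) \<times> real \<times> real) set" where
  "kept M = (\<Union>n. fst (KD M (Suc n)))"

definition eta :: "(('a \<Rightarrow> 'a) \<times> real \<times> real) set \<Rightarrow> real \<Rightarrow> ('a \<Rightarrow> 'a) \<Rightarrow> nat" where
  "eta M t g = card {\<phi> \<in> kept M. fst \<phi> = g \<and> fst (snd \<phi>) \<le> t \<and> t < fst (snd \<phi>) + snd (snd \<phi>)}"

definition restr :: "(('a \<Rightarrow> 'a) \<times> real \<times> real) set \<Rightarrow> 'a set \<Rightarrow> (('a \<Rightarrow> 'a) \<times> real \<times> real) set" where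
  "restr M \<Lambda> = {\<phi> \<in> M. supp (fst \<phi>) \<subseteq> \<Lambda>}"

definition intensity :: "real \<Rightarrow> (int^'d \<Rightarrow> ereal) \<Rightarrow> ((int^'d \<Rightarrow> int^'d) \<times> real \<times> real) measure" where
  "intensity \<alpha> V = density (count_space cycles \<Otimes>\<^sub>M (lborel \<Otimes>\<^sub>M lborel))
      (\<lambda>(g, t, s). ennreal (cweight \<alpha> V g * exp (- s)) * indicator {0<..} s)"

definition is_PPP :: "'w measure \<Rightarrow> ('w \<Rightarrow> 'p set) \<Rightarrow> 'p measure \<Rightarrow> bool" where
  "is_PPP M N \<nu> \<longleftrightarrow> prob_space M \<and> (\<forall>\<omega>\<in>space M. N \<omega> \<subseteq> space \<nu>) \<and>
     (\<forall>B\<in>sets \<nu>. emeasure \<nu> B < \<infinity> \<longrightarrow>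
        (\<lambda>\<omega>. card (N \<omega> \<inter> B)) \<in> measurable M (count_space UNIV) \<and>
        (AE \<omega> in M. finite (N \<omega> \<inter> B)) \<and>
        (\<forall>k. measure M {\<omega> \<in> space M. card (N \<omega> \<inter> B) = k} =
               (enn2real (emeasure \<nu> B)) ^ k / fact k * exp (- enn2real (emeasure \<nu> B)))) \<and>
     (\<forall>I (B :: nat \<Rightarrow> 'p set). finite I \<and> disjoint_family_on B I \<and>
         (\<forall>i\<in>I. B i \<in> sets \<nu> \<and> emeasure \<nu> (B i) < \<infinity>) \<longrightarrow>
        prob_space.indep_vars M (\<lambda>_. count_space UNIV) (\<lambda>i \<omega>. card (N \<omega> \<inter> B i)) I)"

definition configs :: "(int^'d) set \<Rightarrow> ((int^'d \<Rightarrow> int^'d) \<Rightarrow> nat) set" where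
  "configs \<Lambda> = {\<eta> \<in> PiE cycles (\<lambda>_. {0, 1}).
      (\<forall>g\<in>cycles. \<eta> g = 1 \<longrightarrow> supp g \<subseteq> \<Lambda>) \<and>
      (\<forall>g\<in>cycles. \<forall>h\<in>cycles. g \<noteq> h \<and> \<eta> g = 1 \<and> \<eta> h = 1 \<longrightarrow> supp g \<inter> supp h = {})}"

definition cfg_weight :: "real \<Rightarrow> (int^'d \<Rightarrow> ereal) \<Rightarrow> ((int^'d \<Rightarrow> int^'d) \<Rightarrow> nat) \<Rightarrow> real" where
  "cfg_weight \<alpha> V \<eta> = (\<Prod>g\<in>{g \<in> cycles. \<eta> g = 1}. cweight \<alpha> V g)"

definition gibbs :: "real \<Rightarrow> (int^'d \<Rightarrow> ereal) \<Rightarrow> (int^'d) set \<Rightarrow> ((int^'d \<Rightarrow> int^'d) \<Rightarrow> nat) measure" where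
  "gibbs \<alpha> V \<Lambda> = density (count_space UNIV)
      (\<lambda>\<eta>. ennreal (indicator (configs \<Lambda>) \<eta> * cfg_weight \<alpha> V \<eta> /
                     (\<Sum>\<eta>'\<in>configs \<Lambda>. cfg_weight \<alpha> V \<eta>')))"

definition weak_conv_net :: "('i \<Rightarrow> 'x measure) \<Rightarrow> 'x measure \<Rightarrow> 'x topology \<Rightarrow> 'i filter \<Rightarrow> bool" where
  "weak_conv_net Ms \<mu> T F \<longleftrightarrow>
     (\<forall>f. continuous_map T euclideanreal f \<and> (\<exists>C. \<forall>x\<in>topspace T. \<bar>f x\<bar> \<le> C) \<longrightarrow>
          ((\<lambda>i. \<integral>x. f x \<partial>Ms i) \<longlongrightarrow> (\<integral>x. f x \<partial>\<mu>)) F)"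

end

theory Submission
  imports Defs
begin

text \<open>
  Whether a point is kept is decided by its clan alone. A finite clan lies in a finite volume and in
  a finite time window, so \<open>eta\<close> does not change when the points outside a large volume, or those
  born before a remote time, are removed. This gives the almost sure convergence.

  For a finite volume it remains to identify the law of \<open>eta\<close> as the Gibbs measure. Started from the
  empty configuration at time \<open>t - n\<close>, the kept points form a birth-and-death chain on the sets of
  pairwise disjoint cycles, with birth rates \<open>w\<close> and death rate 1, which is reversible for the Gibbs
  measure. On a time grid of mesh \<open>h\<close> the process is, outside an event of probability \<open>O(h)\<close>, a
  function of the independent Poisson counts of the cells (cycle, birth interval); conditioned on the
  past, a cell that is alive survives the next step with probability \<open>1 - h + O(h^2)\<close>, so that each
  step agrees with the kernel \<open>1 + h Q\<close> up to \<open>O(h^2)\<close>. A Poincare inequality makes this kernel a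
  contraction of rate \<open>1 - l h\<close> in \<open>L^2\<close>, hence the law at time \<open>t\<close> is within
  \<open>C exp (- l n) + C h\<close> of the Gibbs measure. Let \<open>h\<close> tend to 0, then \<open>n\<close> to infinity.
\<close>

section \<open>Clans and kept points\<close>

text \<open>The hypothesis \<open>is_PPP\<close> speaks only about counts of sets: neither a Markov
  property nor the measurability of \<open>eta\<close> is given. Hence time is cut into cells whose
  counts are independent, and laws are taken under \<open>completion M\<close>, where a set agreeing
  almost surely with an eventually constant sequence of events is itself an event. The mesh
  \<open>1 / 2 ^ m\<close> makes the exceptional probabilities summable, so Borel-Cantelli turns
  "close with high probability" into exact agreement with the grid chain for all large
  \<open>m\<close>. The error of a step is bounded only from below; the upper bound comes for free
  from equality of total masses. The limits may be taken one after the other because the constants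
  of the contraction depend on the volume alone, neither on the length \<open>n\<close> of the
  window nor on the mesh. Cycles of weight zero almost surely do not occur and are discarded, so
  that every state has positive Gibbs weight. All volumes are built from the same points on one
  probability space, so weak convergence reduces to almost sure convergence and domination.\<close>

abbreviation birth :: "'b \<times> real \<times> real \<Rightarrow> real" where
  "birth \<phi> \<equiv> fst (snd \<phi>)"

abbreviation death :: "'b \<times> real \<times> real \<Rightarrow> real" where
  "death \<phi> \<equiv> fst (snd \<phi>) + snd (snd \<phi>)"

lemma anc1_iff:
  "\<psi> \<in> anc1 M \<phi> \<longleftrightarrow> \<psi> \<in> M \<and> incompat (fst \<psi>) (fst \<phi>) \<and> birth \<psi> < birth \<phi> \<and> birth \<phi> < death \<psi>"
  by (auto simp: anc1_def)

lemma anc1_subset: "anc1 M \<phi> \<subseteq> M"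
  by (auto simp: anc1_def)

lemma ancn_anc1_subset: "\<psi> \<in> anc1 M \<phi> \<Longrightarrow> ancn M \<psi> n \<subseteq> ancn M \<phi> (Suc n)"
proof (induction n)
  case 0
  then show ?case by auto
next
  case (Suc n)
  then have "ancn M \<psi> n \<subseteq> ancn M \<phi> (Suc n)" by blast
  from UN_mono[OF this, of "anc1 M" "anc1 M"] show ?case by simp
qed

lemma clan_anc1_subset: "\<psi> \<in> anc1 M \<phi> \<Longrightarrow> clan M \<psi> \<subseteq> clan M \<phi>"
  unfolding clan_def using ancn_anc1_subset[of \<psi> M \<phi>] by (intro UN_least) (meson UNIV_I UN_upper order_trans)

lemma anc1_subset_clan: "anc1 M \<phi> \<subseteq> clan M \<phi>"
  unfolding clan_def using ancn.simps(1)[of M \<phi>] by blast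

lemma anc1_mono: "F \<subseteq> M \<Longrightarrow> anc1 F \<phi> \<subseteq> anc1 M \<phi>"
  by (auto simp: anc1_def)

lemma clan_mono:
  assumes "F \<subseteq> M" shows "clan F \<phi> \<subseteq> clan M \<phi>"
proof -
  have "ancn F \<phi> n \<subseteq> ancn M \<phi> n" for n
  proof (induction n)
    case (Suc n)
    then show ?case using anc1_mono[OF assms] by (simp, blast)
  qed (use anc1_mono[OF assms] in simp)
  then show ?thesis unfolding clan_def by blast
qed

lemma KD_Suc_fst: "\<phi> \<in> fst (KD M (Suc n)) \<longleftrightarrow> \<phi> \<in> M \<and> anc1 M \<phi> \<subseteq> snd (KD M n)"
  by (auto simp: Let_def)

lemma KD_snd: "\<phi> \<in> snd (KD M n) \<longleftrightarrow> \<phi> \<in> M \<and> anc1 M \<phi> \<inter> fst (KD M n) \<noteq> {}"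
  by (cases n) (auto simp: Let_def)

text \<open>The recursion consults a point only through its first-order ancestors, and the clan of
  an ancestor lies inside the clan of the point, so the hypothesis on clans is inherited along the
  induction. At each level \<open>K\<close> is settled before \<open>D\<close>, because D_(n+1)
  refers to K_(n+1).\<close>

lemma KD_cong:
  assumes "F \<subseteq> M" "\<phi> \<in> F" "clan M \<phi> \<subseteq> F"
  shows "(\<phi> \<in> fst (KD M n) \<longleftrightarrow> \<phi> \<in> fst (KD F n)) \<and> (\<phi> \<in> snd (KD M n) \<longleftrightarrow> \<phi> \<in> snd (KD F n))"
  using assms(2,3)
proof (induction n arbitrary: \<phi>)
  case 0
  then show ?case by simp
next
  case (Suc n)
  have eq: "anc1 F \<psi> = anc1 M \<psi>" if "clan M \<psi> \<subseteq> F" for \<psi>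
    using that anc1_subset_clan[of M \<psi>] assms(1) by (auto simp: anc1_def)
  have anc: "\<psi> \<in> F \<and> clan M \<psi> \<subseteq> F" if "\<psi> \<in> anc1 M \<theta>" "clan M \<theta> \<subseteq> F" for \<psi> \<theta>
    using that anc1_subset_clan[of M \<theta>] clan_anc1_subset[OF that(1)] by blast
  have K: "\<theta> \<in> fst (KD M (Suc n)) \<longleftrightarrow> \<theta> \<in> fst (KD F (Suc n))" if "\<theta> \<in> F" "clan M \<theta> \<subseteq> F" for \<theta>
  proof -
    have "\<psi> \<in> snd (KD M n) \<longleftrightarrow> \<psi> \<in> snd (KD F n)" if "\<psi> \<in> anc1 M \<theta>" for \<psi>
      using Suc.IH anc[OF that \<open>clan M \<theta> \<subseteq> F\<close>] by blast
    then show ?thesis using that(1) assms(1) unfolding KD_Suc_fst eq[OF that(2)] by blast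
  qed
  have "\<phi> \<in> snd (KD M (Suc n)) \<longleftrightarrow> (\<exists>\<psi>\<in>anc1 M \<phi>. \<psi> \<in> fst (KD M (Suc n)))"
    using Suc.prems assms(1) unfolding KD_snd by blast
  also have "\<dots> \<longleftrightarrow> (\<exists>\<psi>\<in>anc1 F \<phi>. \<psi> \<in> fst (KD F (Suc n)))"
    using eq[OF Suc.prems(2)] K anc Suc.prems by blast
  also have "\<dots> \<longleftrightarrow> \<phi> \<in> snd (KD F (Suc n))"
    using Suc.prems unfolding KD_snd by blast
  finally show ?case using K Suc.prems by blast
qed

lemma kept_cong:
  assumes "F \<subseteq> M" "\<phi> \<in> F" "clan M \<phi> \<subseteq> F"
  shows "\<phi> \<in> kept M \<longleftrightarrow> \<phi> \<in> kept F"
  unfolding kept_def using KD_cong[OF assms] by blast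

lemma kept_subset: "kept M \<subseteq> M"
  by (auto simp: kept_def Let_def)

text \<open>Common source of both approximations: \<open>F\<close> will be the restriction of
  \<open>M\<close> to a volume, or further to a time window. Only the points of type
  \<open>g\<close> alive at \<open>t\<close> have to bring their clans along.\<close>

lemma eta_cong:
  assumes "F \<subseteq> M"
    and "\<And>\<phi>. \<phi> \<in> M \<Longrightarrow> fst \<phi> = g \<Longrightarrow> birth \<phi> \<le> t \<Longrightarrow> t < death \<phi> \<Longrightarrow> \<phi> \<in> F \<and> clan M \<phi> \<subseteq> F"
  shows "eta F t g = eta M t g"
proof -
  have "{\<phi> \<in> kept F. fst \<phi> = g \<and> birth \<phi> \<le> t \<and> t < death \<phi>} =
        {\<phi> \<in> kept M. fst \<phi> = g \<and> birth \<phi> \<le> t \<and> t < death \<phi>}"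
    using assms kept_cong[OF assms(1)] kept_subset[of M] kept_subset[of F] by blast
  then show ?thesis by (simp add: eta_def)
qed

text \<open>\<open>K\<close> grows when the preceding \<open>D\<close> grows, and \<open>D\<close>
  grows with the \<open>K\<close> of its own level; the induction starts from empty sets.\<close>

lemma KD_Suc_mono: "fst (KD M n) \<subseteq> fst (KD M (Suc n)) \<and> snd (KD M n) \<subseteq> snd (KD M (Suc n))"
proof (induction n)
  case (Suc n)
  then have 1: "fst (KD M (Suc n)) \<subseteq> fst (KD M (Suc (Suc n)))"
    by (auto simp: Let_def)
  then have "snd (KD M (Suc n)) \<subseteq> snd (KD M (Suc (Suc n)))"
    unfolding KD.simps(2)[of M "Suc n"] KD.simps(2)[of M n] Let_def by auto
  with 1 show ?case by blast
qed simp

lemma KD_mono: "m \<le> n \<Longrightarrow> fst (KD M m) \<subseteq> fst (KD M n) \<and> snd (KD M m) \<subseteq> snd (KD M n)"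
  by (rule lift_Suc_mono_le[of "\<lambda>n. fst (KD M n)", THEN conjI, OF _ _ lift_Suc_mono_le[of "\<lambda>n. snd (KD M n)"]])
     (use KD_Suc_mono in blast)+

text \<open>Two steps down the ancestry: a point in both sets has an ancestor
  \<open>\<theta>\<close> in K_(n+1), which must lie in D_n and so has an ancestor
  \<open>\<rho>\<close> in K_n; since \<open>\<theta>\<close> is in K_(n+1), \<open>\<rho>\<close>
  is also in D_n, against the induction hypothesis.\<close>

lemma KD_disjoint: "fst (KD M n) \<inter> snd (KD M n) = {}"
proof (induction n)
  case (Suc n)
  show ?case
  proof (rule ccontr)
    assume "fst (KD M (Suc n)) \<inter> snd (KD M (Suc n)) \<noteq> {}"
    then obtain \<psi> where \<psi>: "\<psi> \<in> fst (KD M (Suc n))" "\<psi> \<in> snd (KD M (Suc n))" by blast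
    then obtain \<theta> where \<theta>: "\<theta> \<in> anc1 M \<psi>" "\<theta> \<in> fst (KD M (Suc n))" by (auto simp: KD_snd simp del: KD.simps)
    with \<psi> have "\<theta> \<in> snd (KD M n)" by (auto simp: KD_Suc_fst simp del: KD.simps)
    then obtain \<rho> where \<rho>: "\<rho> \<in> anc1 M \<theta>" "\<rho> \<in> fst (KD M n)" by (auto simp: KD_snd simp del: KD.simps)
    with \<theta> have "\<rho> \<in> snd (KD M n)" by (auto simp: KD_Suc_fst simp del: KD.simps)
    with \<rho> Suc show False by blast
  qed
qed simp

text \<open>Turns the construction by generations into the greedy rule that a birth is accepted
  exactly when no accepted ancestor is alive; this is the form that the grid chain imitates.
  Finiteness guarantees that every point is classified in \<open>K\<close> or \<open>D\<close> at
  some level.\<close>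

lemma kept_iff:
  assumes "finite F"
  shows "\<phi> \<in> kept F \<longleftrightarrow> \<phi> \<in> F \<and> anc1 F \<phi> \<inter> kept F = {}"
proof
  assume "\<phi> \<in> kept F"
  then obtain n where n: "\<phi> \<in> fst (KD F (Suc n))" unfolding kept_def by blast
  have "\<psi> \<notin> kept F" if "\<psi> \<in> anc1 F \<phi>" for \<psi>
  proof
    assume "\<psi> \<in> kept F"
    then obtain m where m: "\<psi> \<in> fst (KD F (Suc m))" unfolding kept_def by blast
    have "\<psi> \<in> snd (KD F n)" using n that by (auto simp: KD_Suc_fst simp del: KD.simps)
    then have "\<psi> \<in> snd (KD F (max n (Suc m)))" using KD_mono[of n "max n (Suc m)" F] by auto
    moreover have "\<psi> \<in> fst (KD F (max n (Suc m)))" using KD_mono[of "Suc m" "max n (Suc m)" F] m by auto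
    ultimately show False using KD_disjoint by blast
  qed
  then show "\<phi> \<in> F \<and> anc1 F \<phi> \<inter> kept F = {}" using n by (auto simp: KD_Suc_fst simp del: KD.simps)
next
  \<comment> \<open>Induction on the number of points born strictly earlier. The levels at which the
    finitely many ancestors are classified have a maximum \<open>m\<close>, and by monotonicity all
    of them are classified at \<open>m\<close>.\<close>
  have cls: "\<exists>n. \<phi> \<in> fst (KD F n) \<union> snd (KD F n)" if "\<phi> \<in> F" for \<phi>
    using that
  proof (induction "card {\<psi> \<in> F. birth \<psi> < birth \<phi>}" arbitrary: \<phi> rule: less_induct)
    case less
    have "\<exists>n. \<psi> \<in> fst (KD F n) \<union> snd (KD F n)" if "\<psi> \<in> anc1 F \<phi>" for \<psi>
    proof (rule less.hyps)
      have "{\<psi>' \<in> F. birth \<psi>' < birth \<psi>} \<subset> {\<psi> \<in> F. birth \<psi> < birth \<phi>}"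
        using that by (auto simp: anc1_iff)
      then show "card {\<psi>' \<in> F. birth \<psi>' < birth \<psi>} < card {\<psi> \<in> F. birth \<psi> < birth \<phi>}"
        using assms by (intro psubset_card_mono) auto
      show "\<psi> \<in> F" using that by (auto simp: anc1_iff)
    qed
    then obtain f where f: "\<And>\<psi>. \<psi> \<in> anc1 F \<phi> \<Longrightarrow> \<psi> \<in> fst (KD F (f \<psi>)) \<union> snd (KD F (f \<psi>))" by metis
    have fin: "finite (anc1 F \<phi>)" using assms anc1_subset finite_subset by blast
    define m where "m = Max (insert 0 (f ` anc1 F \<phi>))"
    have *: "\<psi> \<in> fst (KD F m) \<union> snd (KD F m)" if "\<psi> \<in> anc1 F \<phi>" for \<psi>
    proof -
      have "f \<psi> \<le> m" unfolding m_def using that fin by (intro Max_ge) auto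
      then show ?thesis using KD_mono f[OF that] by blast
    qed
    show ?case
    proof (cases "anc1 F \<phi> \<inter> fst (KD F m) = {}")
      case True
      then have "\<phi> \<in> fst (KD F (Suc m))" using * less.prems unfolding KD_Suc_fst by blast
      then show ?thesis by blast
    next
      case False
      then have "\<phi> \<in> snd (KD F m)" using less.prems unfolding KD_snd by blast
      then show ?thesis by blast
    qed
  qed
  have sub: "fst (KD F n) \<subseteq> kept F" for n
    by (cases n) (auto simp: kept_def simp del: KD.simps(2))
  assume *: "\<phi> \<in> F \<and> anc1 F \<phi> \<inter> kept F = {}"
  then obtain n where "\<phi> \<in> fst (KD F n) \<union> snd (KD F n)" using cls by blast
  moreover have "\<phi> \<notin> snd (KD F n)" using * sub[of n] unfolding KD_snd by blast
  ultimately show "\<phi> \<in> kept F" using sub[of n] by blast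
qed

section \<open>The hard-core birth-and-death chain\<close>

text \<open>A finite loss system, abstracted from cycles. Strict positivity of the weights makes
  every state charged by the Gibbs law, so that dividing by \<open>gibbs_pi\<close> and by its
  minimum is legitimate.\<close>

locale hardcore =
  fixes G :: "'g set" and w :: "'g \<Rightarrow> real" and inc :: "'g \<Rightarrow> 'g \<Rightarrow> bool"
  assumes finite_G: "finite G"
    and w_pos: "g \<in> G \<Longrightarrow> 0 < w g"
    and inc_refl: "g \<in> G \<Longrightarrow> inc g g"
    and inc_sym: "inc g h \<Longrightarrow> inc h g"
begin

definition St :: "'g set set" where
  "St = {\<xi>. \<xi> \<subseteq> G \<and> (\<forall>g\<in>\<xi>. \<forall>h\<in>\<xi>. g \<noteq> h \<longrightarrow> \<not> inc g h)}"

definition wt :: "'g set \<Rightarrow> real" where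
  "wt \<xi> = prod w \<xi>"

definition gibbs_pi :: "'g set \<Rightarrow> real" where
  "gibbs_pi \<xi> = wt \<xi> / sum wt St"

definition adm :: "'g set \<Rightarrow> 'g set" where
  "adm \<xi> = {g \<in> G - \<xi>. insert g \<xi> \<in> St}"

text \<open>The forward generator acting on laws, with gain and loss paired edge by edge. The first
  sum runs over the edges to smaller states (birth into \<open>\<xi>\<close> at rate
  \<open>w g\<close>, death out of it at rate 1), the second over the edges to larger
  states.\<close>

definition gen :: "('g set \<Rightarrow> real) \<Rightarrow> 'g set \<Rightarrow> real" where
  "gen v \<xi> = (\<Sum>g\<in>\<xi>. w g * v (\<xi> - {g}) - v \<xi>) + (\<Sum>g\<in>adm \<xi>. v (insert g \<xi>) - w g * v \<xi>)"

lemma finite_St: "finite St"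
  by (rule finite_subset[of _ "Pow G"]) (auto simp: St_def finite_G)

lemma St_finite: "\<xi> \<in> St \<Longrightarrow> finite \<xi>"
  using finite_G by (auto simp: St_def intro: finite_subset)

lemma empty_St: "{} \<in> St"
  by (simp add: St_def)

lemma St_subset: "\<xi> \<in> St \<Longrightarrow> \<zeta> \<subseteq> \<xi> \<Longrightarrow> \<zeta> \<in> St"
  by (auto simp: St_def)

lemma finite_adm: "finite (adm \<xi>)"
  using finite_G by (auto simp: adm_def)

lemma wt_pos: "\<xi> \<in> St \<Longrightarrow> 0 < wt \<xi>"
  unfolding wt_def by (rule prod_pos) (auto simp: St_def intro: w_pos)

lemma sum_wt_pos: "0 < sum wt St"
  using finite_St empty_St wt_pos by (intro sum_pos) auto

lemma gibbs_pi_pos: "\<xi> \<in> St \<Longrightarrow> 0 < gibbs_pi \<xi>"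
  by (simp add: gibbs_pi_def wt_pos sum_wt_pos)

lemma sum_gibbs_pi: "sum gibbs_pi St = 1"
  unfolding gibbs_pi_def using sum_wt_pos by (simp flip: sum_divide_distrib)

lemma gibbs_pi_le_1: "\<xi> \<in> St \<Longrightarrow> gibbs_pi \<xi> \<le> 1"
  using member_le_sum[of \<xi> St gibbs_pi] gibbs_pi_pos finite_St sum_gibbs_pi by (auto simp: less_imp_le)

lemma gibbs_pi_insert: "g \<notin> \<xi> \<Longrightarrow> finite \<xi> \<Longrightarrow> gibbs_pi (insert g \<xi>) = w g * gibbs_pi \<xi>"
  by (simp add: gibbs_pi_def wt_def)

lemma gibbs_pi_remove: "g \<in> \<xi> \<Longrightarrow> finite \<xi> \<Longrightarrow> gibbs_pi \<xi> = w g * gibbs_pi (\<xi> - {g})"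
  using gibbs_pi_insert[of g "\<xi> - {g}"] by (simp add: insert_absorb)

text \<open>Both sides run over the edges of the state graph, indexed by the lower endpoint on the
  left and by the upper endpoint on the right.\<close>

lemma sum_adm_swap:
  "(\<Sum>\<xi>\<in>St. \<Sum>g\<in>adm \<xi>. f \<xi> g) = (\<Sum>\<xi>\<in>St. \<Sum>g\<in>\<xi>. f (\<xi> - {g}) g)" for f :: "'g set \<Rightarrow> 'g \<Rightarrow> real"
proof -
  have "(\<Sum>\<xi>\<in>St. \<Sum>g\<in>adm \<xi>. f \<xi> g) = (\<Sum>(\<xi>, g)\<in>Sigma St adm. f \<xi> g)"
    by (rule sum.Sigma) (auto simp: finite_St finite_adm)
  also have "\<dots> = (\<Sum>(\<xi>, g)\<in>Sigma St (\<lambda>\<xi>. \<xi>). f (\<xi> - {g}) g)"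
    by (rule sum.reindex_bij_witness[of _ "\<lambda>(\<xi>, g). (\<xi> - {g}, g)" "\<lambda>(\<xi>, g). (insert g \<xi>, g)"])
       (auto simp: adm_def St_def)
  also have "\<dots> = (\<Sum>\<xi>\<in>St. \<Sum>g\<in>\<xi>. f (\<xi> - {g}) g)"
    by (rule sum.Sigma[symmetric]) (auto simp: finite_St St_finite)
  finally show ?thesis .
qed

text \<open>Conservation of mass: the flow along an edge enters with opposite signs at its two
  ends.\<close>

lemma sum_gen: "(\<Sum>\<xi>\<in>St. gen v \<xi>) = 0"
proof -
  have "(\<Sum>\<xi>\<in>St. gen v \<xi>) = (\<Sum>\<xi>\<in>St. \<Sum>g\<in>\<xi>. w g * v (\<xi> - {g}) - v \<xi>) +
      (\<Sum>\<xi>\<in>St. \<Sum>g\<in>\<xi>. v (insert g (\<xi> - {g})) - w g * v (\<xi> - {g}))"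
    unfolding gen_def sum.distrib sum_adm_swap ..
  also have "\<dots> = 0"
    unfolding sum.distrib[symmetric] by (intro sum.neutral ballI) (simp add: insert_absorb)
  finally show ?thesis .
qed

section \<open>Dirichlet form and Poincare inequality\<close>

definition energy :: "('g set \<Rightarrow> real) \<Rightarrow> real" where
  "energy u = (\<Sum>\<xi>\<in>St. \<Sum>g\<in>\<xi>. gibbs_pi \<xi> * (u \<xi> - u (\<xi> - {g}))\<^sup>2)"

text \<open>Detailed balance, \<open>gibbs_pi (insert g \<xi>) = w g * gibbs_pi \<xi>\<close>, turns
  the flow along an edge into \<open>gibbs_pi\<close> of the upper endpoint times the difference of
  the density \<open>u\<close>. Testing against \<open>u\<close> and collecting both endpoints
  leaves minus a square per edge.\<close>

lemma energy_identity:
  "(\<Sum>\<xi>\<in>St. u \<xi> * gen (\<lambda>\<xi>. gibbs_pi \<xi> * u \<xi>) \<xi>) = - energy u"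
proof -
  define d where "d \<xi> = gibbs_pi \<xi> * u \<xi>" for \<xi>
  have 1: "(\<Sum>g\<in>\<xi>. w g * d (\<xi> - {g}) - d \<xi>) = (\<Sum>g\<in>\<xi>. gibbs_pi \<xi> * (u (\<xi> - {g}) - u \<xi>))"
    if "\<xi> \<in> St" for \<xi>
  proof (rule sum.cong)
    fix g assume "g \<in> \<xi>"
    then show "w g * d (\<xi> - {g}) - d \<xi> = gibbs_pi \<xi> * (u (\<xi> - {g}) - u \<xi>)"
      using gibbs_pi_remove[of g \<xi>] St_finite[OF that] by (simp add: d_def algebra_simps)
  qed simp
  have 2: "(\<Sum>g\<in>adm \<xi>. d (insert g \<xi>) - w g * d \<xi>) =
      (\<Sum>g\<in>adm \<xi>. gibbs_pi (insert g \<xi>) * (u (insert g \<xi>) - u \<xi>))"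
    if "\<xi> \<in> St" for \<xi>
    by (rule sum.cong) (use St_finite[OF that] in \<open>auto simp: adm_def gibbs_pi_insert d_def algebra_simps\<close>)
  have "(\<Sum>\<xi>\<in>St. u \<xi> * gen d \<xi>) =
      (\<Sum>\<xi>\<in>St. (\<Sum>g\<in>\<xi>. u \<xi> * (gibbs_pi \<xi> * (u (\<xi> - {g}) - u \<xi>)))
          + (\<Sum>g\<in>adm \<xi>. u \<xi> * (gibbs_pi (insert g \<xi>) * (u (insert g \<xi>) - u \<xi>))))"
    unfolding gen_def by (rule sum.cong) (simp_all add: 1 2 distrib_left sum_distrib_left)
  also have "\<dots> = (\<Sum>\<xi>\<in>St. \<Sum>g\<in>\<xi>. u \<xi> * (gibbs_pi \<xi> * (u (\<xi> - {g}) - u \<xi>)))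
      + (\<Sum>\<xi>\<in>St. \<Sum>g\<in>\<xi>. u (\<xi> - {g}) * (gibbs_pi (insert g (\<xi> - {g})) * (u (insert g (\<xi> - {g})) - u (\<xi> - {g}))))"
    by (simp only: sum.distrib sum_adm_swap)
  also have "\<dots> = (\<Sum>\<xi>\<in>St. \<Sum>g\<in>\<xi>. - (gibbs_pi \<xi> * (u \<xi> - u (\<xi> - {g}))\<^sup>2))"
    unfolding sum.distrib[symmetric]
    by (intro sum.cong refl) (simp add: insert_absorb power2_eq_square algebra_simps)
  also have "\<dots> = - energy u"
    by (simp add: energy_def sum_negf)
  finally show ?thesis unfolding d_def .
qed

lemma energy_nonneg: "0 \<le> energy u"
  unfolding energy_def by (intro sum_nonneg mult_nonneg_nonneg) (auto simp: gibbs_pi_pos less_imp_le)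

definition pi_min :: real where
  "pi_min = Min (gibbs_pi ` St)"

lemma pi_min_pos: "0 < pi_min"
  unfolding pi_min_def using finite_St empty_St gibbs_pi_pos by (subst Min_gr_iff) auto

lemma pi_min_le: "\<xi> \<in> St \<Longrightarrow> pi_min \<le> gibbs_pi \<xi>"
  unfolding pi_min_def using finite_St by (intro Min_le) auto

text \<open>Every state is joined to the empty one by at most \<open>card G\<close> edges of weight at least \<^term>\<open>pi_min\<close>.\<close>
lemma poincare:
  assumes "(\<Sum>\<xi>\<in>St. gibbs_pi \<xi> * u \<xi>) = 0"
  shows "(\<Sum>\<xi>\<in>St. gibbs_pi \<xi> * (u \<xi>)\<^sup>2) \<le> (real (card G))\<^sup>2 / pi_min * energy u"
proof -
  \<comment> \<open>\<open>q\<close> bounds the increment of \<open>u\<close> along any single edge,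
    since one edge alone contributes at most the whole energy.\<close>
  define q where "q = sqrt (energy u / pi_min)"
  have q: "0 \<le> q" "q\<^sup>2 = energy u / pi_min"
    using energy_nonneg[of u] pi_min_pos by (auto simp: q_def)
  have edge: "\<bar>u \<xi> - u (\<xi> - {g})\<bar> \<le> q" if "\<xi> \<in> St" "g \<in> \<xi>" for \<xi> g
  proof -
    have "pi_min * (u \<xi> - u (\<xi> - {g}))\<^sup>2 \<le> gibbs_pi \<xi> * (u \<xi> - u (\<xi> - {g}))\<^sup>2"
      using pi_min_le[OF that(1)] by (intro mult_right_mono) auto
    also have "\<dots> \<le> (\<Sum>g\<in>\<xi>. gibbs_pi \<xi> * (u \<xi> - u (\<xi> - {g}))\<^sup>2)"
      using that St_finite gibbs_pi_pos by (intro member_le_sum) (auto simp: less_imp_le)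
    also have "\<dots> \<le> energy u"
      unfolding energy_def using that finite_St gibbs_pi_pos
      by (intro member_le_sum[where f = "\<lambda>\<xi>. \<Sum>g\<in>\<xi>. gibbs_pi \<xi> * (u \<xi> - u (\<xi> - {g}))\<^sup>2"])
         (auto intro!: sum_nonneg mult_nonneg_nonneg simp: less_imp_le)
    finally have "(u \<xi> - u (\<xi> - {g}))\<^sup>2 \<le> q\<^sup>2"
      using pi_min_pos unfolding q(2) by (simp add: field_simps)
    then show ?thesis using q(1) by (simp add: abs_le_square_iff[symmetric])
  qed
  have path: "\<bar>u \<xi> - u {}\<bar> \<le> real (card \<xi>) * q" if "finite \<xi>" "\<xi> \<in> St" for \<xi>
    using that
  proof (induction \<xi> rule: finite_induct)
    case (insert g \<xi>)
    then have "\<bar>u \<xi> - u {}\<bar> \<le> real (card \<xi>) * q" using St_subset by blast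
    moreover have "\<bar>u (insert g \<xi>) - u \<xi>\<bar> \<le> q" using edge[of "insert g \<xi>" g] insert by auto
    ultimately show ?case using insert by (simp add: algebra_simps)
  qed simp
  have sq: "(u \<xi> - u {})\<^sup>2 \<le> (real (card G))\<^sup>2 * q\<^sup>2" if "\<xi> \<in> St" for \<xi>
  proof -
    have "card \<xi> \<le> card G" using that finite_G by (intro card_mono) (auto simp: St_def)
    then have "\<bar>u \<xi> - u {}\<bar> \<le> real (card G) * q"
      using path[OF St_finite[OF that] that] q(1)
      by (meson mult_right_mono of_nat_le_iff order_trans)
    then show ?thesis
      by (metis abs_ge_zero power2_abs power_mono power_mult_distrib)
  qed
  \<comment> \<open>For a function of mean zero the second moment is at most the second moment about
    any constant. The constant is \<open>u {}\<close> because all the paths end at the empty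
    state.\<close>
  have "(\<Sum>\<xi>\<in>St. gibbs_pi \<xi> * (u \<xi> - u {})\<^sup>2) =
      (\<Sum>\<xi>\<in>St. gibbs_pi \<xi> * (u \<xi>)\<^sup>2) - 2 * u {} * (\<Sum>\<xi>\<in>St. gibbs_pi \<xi> * u \<xi>) + (u {})\<^sup>2 * sum gibbs_pi St"
    by (simp add: sum_distrib_left sum.distrib[symmetric] sum_subtractf[symmetric] power2_eq_square algebra_simps)
  then have "(\<Sum>\<xi>\<in>St. gibbs_pi \<xi> * (u \<xi>)\<^sup>2) \<le> (\<Sum>\<xi>\<in>St. gibbs_pi \<xi> * (u \<xi> - u {})\<^sup>2)"
    by (simp add: assms sum_gibbs_pi)
  also have "\<dots> \<le> (\<Sum>\<xi>\<in>St. gibbs_pi \<xi> * ((real (card G))\<^sup>2 * q\<^sup>2))"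
    using sq gibbs_pi_pos by (intro sum_mono mult_left_mono) (auto simp: less_imp_le)
  also have "\<dots> = (real (card G))\<^sup>2 / pi_min * energy u"
    unfolding sum_distrib_right[symmetric] sum_gibbs_pi q(2) by simp
  finally show ?thesis .
qed

section \<open>Weighted norm and contraction of one Euler step\<close>

definition nrm :: "('g set \<Rightarrow> real) \<Rightarrow> real" where
  "nrm d = L2_set (\<lambda>\<xi>. d \<xi> / sqrt (gibbs_pi \<xi>)) St"

lemma nrm_nonneg: "0 \<le> nrm d"
  by (simp add: nrm_def)

text \<open>Identifies \<open>nrm d\<close> as the norm of the density \<open>d / gibbs_pi\<close>
  in L^2 of \<open>gibbs_pi\<close>, the space in which the generator is symmetric. The definition
  through \<open>L2_set\<close> was chosen for its triangle inequality.\<close>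

lemma nrm_sq: "(nrm d)\<^sup>2 = (\<Sum>\<xi>\<in>St. (d \<xi>)\<^sup>2 / gibbs_pi \<xi>)"
proof -
  have "(nrm d)\<^sup>2 = (\<Sum>\<xi>\<in>St. (d \<xi> / sqrt (gibbs_pi \<xi>))\<^sup>2)"
    unfolding nrm_def L2_set_def by (simp add: sum_nonneg)
  also have "\<dots> = (\<Sum>\<xi>\<in>St. (d \<xi>)\<^sup>2 / gibbs_pi \<xi>)"
    using gibbs_pi_pos by (intro sum.cong) (auto simp: power_divide less_imp_le)
  finally show ?thesis .
qed

lemma nrm_triangle: "nrm (\<lambda>\<xi>. d \<xi> + e \<xi>) \<le> nrm d + nrm e"
  unfolding nrm_def add_divide_distrib by (rule L2_set_triangle_ineq)

lemma abs_le_nrm: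
  assumes "\<xi> \<in> St" shows "\<bar>d \<xi>\<bar> \<le> nrm d"
proof -
  have "(d \<xi>)\<^sup>2 \<le> (d \<xi>)\<^sup>2 / gibbs_pi \<xi>"
    using gibbs_pi_pos[OF assms] gibbs_pi_le_1[OF assms]
    by (simp add: pos_le_divide_eq mult_left_le)
  also have "\<dots> \<le> (nrm d)\<^sup>2"
    unfolding nrm_sq using assms finite_St gibbs_pi_pos
    by (intro member_le_sum[where f = "\<lambda>\<xi>. (d \<xi>)\<^sup>2 / gibbs_pi \<xi>"]) (auto simp: less_imp_le)
  finally show ?thesis using nrm_nonneg[of d] by (simp add: abs_le_square_iff[symmetric])
qed

lemma l1_le_nrm: "(\<Sum>\<xi>\<in>St. \<bar>d \<xi>\<bar>) \<le> real (card St) * nrm d"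
  using sum_bounded_above[of St "\<lambda>\<xi>. \<bar>d \<xi>\<bar>" "nrm d"] abs_le_nrm by simp

lemma nrm_le_l1: "nrm d \<le> (\<Sum>\<xi>\<in>St. \<bar>d \<xi>\<bar>) / sqrt pi_min"
proof -
  have "nrm d \<le> (\<Sum>\<xi>\<in>St. \<bar>d \<xi> / sqrt (gibbs_pi \<xi>)\<bar>)"
    unfolding nrm_def by (rule L2_set_le_sum_abs)
  also have "\<dots> \<le> (\<Sum>\<xi>\<in>St. \<bar>d \<xi>\<bar> / sqrt pi_min)"
  proof (rule sum_mono)
    fix \<xi> assume "\<xi> \<in> St"
    then have "sqrt pi_min \<le> sqrt (gibbs_pi \<xi>)" "0 < sqrt (gibbs_pi \<xi>)" "0 < sqrt pi_min"
      using pi_min_le pi_min_pos gibbs_pi_pos by auto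
    then show "\<bar>d \<xi> / sqrt (gibbs_pi \<xi>)\<bar> \<le> \<bar>d \<xi>\<bar> / sqrt pi_min"
      by (simp add: abs_divide divide_left_mono)
  qed
  finally show ?thesis by (simp add: sum_divide_distrib)
qed

lemma gen_diff: "gen (\<lambda>\<xi>. v \<xi> - v' \<xi>) \<xi> = gen v \<xi> - gen v' \<xi>"
  unfolding gen_def by (simp add: sum_subtractf right_diff_distrib)

lemma gen_gibbs_pi: "\<xi> \<in> St \<Longrightarrow> gen gibbs_pi \<xi> = 0"
  unfolding gen_def using St_finite[of \<xi>] gibbs_pi_remove[of _ \<xi>]
  by (auto simp: adm_def gibbs_pi_insert)

lemma gen_abs_le:
  assumes "\<xi> \<in> St"
  shows "\<bar>gen d \<xi>\<bar> \<le> 2 * (\<Sum>g\<in>G. w g + 1) * nrm d"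
proof -
  have b: "\<bar>w g * d \<zeta> - d \<xi>\<bar> \<le> (w g + 1) * nrm d" "\<bar>d \<zeta> - w g * d \<xi>\<bar> \<le> (w g + 1) * nrm d"
    if "g \<in> G" "\<zeta> \<in> St" for g \<zeta>
  proof -
    have "\<bar>w g * d \<zeta>\<bar> \<le> w g * nrm d" "\<bar>w g * d \<xi>\<bar> \<le> w g * nrm d"
      using abs_le_nrm[OF assms, of d] abs_le_nrm[OF that(2), of d] w_pos[OF that(1)]
      by (auto simp: abs_mult intro!: mult_left_mono)
    then show "\<bar>w g * d \<zeta> - d \<xi>\<bar> \<le> (w g + 1) * nrm d" "\<bar>d \<zeta> - w g * d \<xi>\<bar> \<le> (w g + 1) * nrm d"
      using abs_le_nrm[OF assms, of d] abs_le_nrm[OF that(2), of d] by (auto simp: algebra_simps)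
  qed
  have wn: "0 \<le> (w g + 1) * nrm d" if "g \<in> G" for g
    using w_pos[OF that] nrm_nonneg[of d] by simp
  have "\<bar>\<Sum>g\<in>\<xi>. w g * d (\<xi> - {g}) - d \<xi>\<bar> \<le> (\<Sum>g\<in>\<xi>. (w g + 1) * nrm d)"
    by (intro order_trans[OF sum_abs] sum_mono b(1) St_subset[OF assms]) (use assms in \<open>auto simp: St_def\<close>)
  also have "\<dots> \<le> (\<Sum>g\<in>G. (w g + 1) * nrm d)"
    using assms wn by (intro sum_mono2 finite_G) (auto simp: St_def)
  finally have 1: "\<bar>\<Sum>g\<in>\<xi>. w g * d (\<xi> - {g}) - d \<xi>\<bar> \<le> (\<Sum>g\<in>G. (w g + 1) * nrm d)" .
  have "\<bar>\<Sum>g\<in>adm \<xi>. d (insert g \<xi>) - w g * d \<xi>\<bar> \<le> (\<Sum>g\<in>adm \<xi>. (w g + 1) * nrm d)"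
    by (intro order_trans[OF sum_abs] sum_mono b(2)) (auto simp: adm_def)
  also have "\<dots> \<le> (\<Sum>g\<in>G. (w g + 1) * nrm d)"
    using wn by (intro sum_mono2 finite_G) (auto simp: adm_def)
  finally have "\<bar>gen d \<xi>\<bar> \<le> 2 * (\<Sum>g\<in>G. (w g + 1) * nrm d)" using 1 unfolding gen_def by linarith
  then show ?thesis by (simp only: sum_distrib_right[symmetric] mult.assoc)
qed

text \<open>Expand the square of the norm of \<open>d + h * gen d\<close>. The cross term is -2 h
  times the energy, hence at most -2 l h |d|^2 by the Poincare inequality; the quadratic term is at
  most h^2 C |d|^2. For h at most l / C the latter gives back at most half of the gain, and 1 - l h
  is at most (1 - l h / 2)^2. The rate delivered is therefore l / 2.\<close>

lemma step_contraction:
  "\<exists>l>0. \<exists>h0>0. \<forall>h d. 0 < h \<and> h \<le> h0 \<and> sum d St = 0 \<longrightarrow>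
     0 \<le> 1 - l * h \<and> nrm (\<lambda>\<xi>. d \<xi> + h * gen d \<xi>) \<le> (1 - l * h) * nrm d"
proof -
  \<comment> \<open>The added 1 in the denominator, like the one in \<open>C\<close> below, keeps
    the constants positive when \<open>G\<close> is empty. In \<open>h0\<close>, the bound
    \<open>l / C\<close> tames the quadratic term and \<open>1 / l\<close> keeps the contraction
    factor nonnegative.\<close>
  define l where "l = pi_min / ((real (card G))\<^sup>2 + 1)"
  define A where "A = 2 * (\<Sum>g\<in>G. w g + 1)"
  define C where "C = real (card St) * A\<^sup>2 / pi_min + 1"
  define h0 where "h0 = min (l / C) (1 / l)"
  have l: "0 < l" using pi_min_pos by (auto simp: l_def intro!: divide_pos_pos add_nonneg_pos)
  have C: "0 < C" unfolding C_def using pi_min_pos by (intro add_nonneg_pos) auto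
  have contr: "0 \<le> 1 - l / 2 * h \<and> nrm (\<lambda>\<xi>. d \<xi> + h * gen d \<xi>) \<le> (1 - l / 2 * h) * nrm d"
    if h: "0 < h" "h \<le> h0" and d: "sum d St = 0" for h d
  proof -
    define u where "u \<xi> = d \<xi> / gibbs_pi \<xi>" for \<xi>
    have du: "d \<xi> = gibbs_pi \<xi> * u \<xi>" if "\<xi> \<in> St" for \<xi>
      using gibbs_pi_pos[OF that] by (simp add: u_def)
    have gen_du: "gen (\<lambda>\<xi>. gibbs_pi \<xi> * u \<xi>) \<xi> = gen d \<xi>" if "\<xi> \<in> St" for \<xi>
      unfolding gen_def using that du St_subset[OF that]
      by (intro arg_cong2[where f = "(+)"] sum.cong) (auto simp: adm_def)
    have n2: "(nrm d)\<^sup>2 = (\<Sum>\<xi>\<in>St. gibbs_pi \<xi> * (u \<xi>)\<^sup>2)"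
      unfolding nrm_sq using gibbs_pi_pos
      by (intro sum.cong) (auto simp: u_def power2_eq_square field_simps dest: less_imp_neq)
    have "(\<Sum>\<xi>\<in>St. gibbs_pi \<xi> * u \<xi>) = 0"
      using d du by simp
    from poincare[OF this] have "(nrm d)\<^sup>2 \<le> (real (card G))\<^sup>2 / pi_min * energy u"
      by (simp add: n2)
    also have "\<dots> \<le> energy u / l"
      using energy_nonneg[of u] pi_min_pos by (simp add: l_def field_simps)
    finally have gap: "l * (nrm d)\<^sup>2 \<le> energy u"
      using l by (simp add: field_simps)
    have genb: "(\<Sum>\<xi>\<in>St. (gen d \<xi>)\<^sup>2 / gibbs_pi \<xi>) \<le> C * (nrm d)\<^sup>2"
    proof -
      have "(gen d \<xi>)\<^sup>2 / gibbs_pi \<xi> \<le> A\<^sup>2 * (nrm d)\<^sup>2 / pi_min" if "\<xi> \<in> St" for \<xi>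
      proof -
        have "(gen d \<xi>)\<^sup>2 \<le> (A * nrm d)\<^sup>2"
          using gen_abs_le[OF that, of d] unfolding A_def
          by (metis abs_ge_zero power2_abs power_mono)
        then show ?thesis
          using pi_min_le[OF that] pi_min_pos by (auto simp: power_mult_distrib intro!: frac_le)
      qed
      then have "(\<Sum>\<xi>\<in>St. (gen d \<xi>)\<^sup>2 / gibbs_pi \<xi>) \<le> real (card St) * (A\<^sup>2 * (nrm d)\<^sup>2 / pi_min)"
        by (rule sum_bounded_above)
      also have "\<dots> \<le> C * (nrm d)\<^sup>2"
        by (simp add: C_def algebra_simps)
      finally show ?thesis .
    qed
    have "(nrm (\<lambda>\<xi>. d \<xi> + h * gen d \<xi>))\<^sup>2 =
        (\<Sum>\<xi>\<in>St. (d \<xi>)\<^sup>2 / gibbs_pi \<xi> + 2 * h * (u \<xi> * gen d \<xi>) + h\<^sup>2 * ((gen d \<xi>)\<^sup>2 / gibbs_pi \<xi>))"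
      unfolding nrm_sq by (intro sum.cong) (auto simp: u_def power2_eq_square add_divide_distrib algebra_simps)
    also have "\<dots> = (nrm d)\<^sup>2 + 2 * h * (\<Sum>\<xi>\<in>St. u \<xi> * gen d \<xi>) + h\<^sup>2 * (\<Sum>\<xi>\<in>St. (gen d \<xi>)\<^sup>2 / gibbs_pi \<xi>)"
      by (simp add: sum.distrib sum_distrib_left nrm_sq)
    also have "(\<Sum>\<xi>\<in>St. u \<xi> * gen d \<xi>) = - energy u"
      using energy_identity[of u] gen_du by simp
    also have "(nrm d)\<^sup>2 + 2 * h * (- energy u) + h\<^sup>2 * (\<Sum>\<xi>\<in>St. (gen d \<xi>)\<^sup>2 / gibbs_pi \<xi>) \<le>
        (nrm d)\<^sup>2 + 2 * h * (- (l * (nrm d)\<^sup>2)) + h\<^sup>2 * (C * (nrm d)\<^sup>2)"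
      using gap genb h by (intro add_mono mult_left_mono) auto
    also have "\<dots> = (1 - 2 * h * l + h * (h * C)) * (nrm d)\<^sup>2"
      by (simp add: algebra_simps power2_eq_square)
    also have "\<dots> \<le> (1 - l / 2 * h)\<^sup>2 * (nrm d)\<^sup>2"
    proof (rule mult_right_mono)
      have "h * C \<le> l" using h C by (simp add: h0_def field_simps)
      then have "h * (h * C) \<le> h * l" using h by (intro mult_left_mono) auto
      moreover have "(1 - l / 2 * h)\<^sup>2 = 1 - h * l + (l / 2 * h)\<^sup>2"
        by (simp add: power2_eq_square algebra_simps)
      ultimately show "1 - 2 * h * l + h * (h * C) \<le> (1 - l / 2 * h)\<^sup>2"
        using zero_le_power2[of "l / 2 * h"] by linarith
    qed simp
    also have "\<dots> = ((1 - l / 2 * h) * nrm d)\<^sup>2"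
      by (simp add: power_mult_distrib)
    finally have sq: "(nrm (\<lambda>\<xi>. d \<xi> + h * gen d \<xi>))\<^sup>2 \<le> ((1 - l / 2 * h) * nrm d)\<^sup>2" .
    have "l * h \<le> 1" using h l by (simp add: h0_def field_simps)
    then have p: "0 \<le> 1 - l / 2 * h" using l h by simp
    have "nrm (\<lambda>\<xi>. d \<xi> + h * gen d \<xi>) \<le> (1 - l / 2 * h) * nrm d"
      using sq by (rule power2_le_imp_le) (intro mult_nonneg_nonneg p nrm_nonneg)
    with p show ?thesis by blast
  qed
  have "0 < h0" using l C by (simp add: h0_def)
  then show ?thesis using contr l by (intro exI[of _ "l / 2"] conjI exI[of _ h0]) auto
qed

text \<open>Discrete Gronwall argument for \<open>p k - gibbs_pi\<close>. A local error B h^2 per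
  step, damped by the factor 1 - l h, accumulates to at most B h^2 / (l h) = B h / l up to the
  change of norm. That change costs \<open>1 / sqrt pi_min\<close>, and the two initial masses give
  the factor 2. The quantifiers matter: \<open>l\<close>, \<open>C\<close> and \<open>h0\<close> are
  fixed before the mesh, the number of steps and the laws.\<close>

lemma approx_chain_near_gibbs:
  "\<exists>l>0. \<exists>C\<ge>0. \<exists>h0>0. \<forall>h B p K. 0 < h \<and> h \<le> h0 \<and> 0 \<le> B \<and>
     (\<forall>k\<le>K. sum (p k) St = 1 \<and> (\<forall>\<xi>\<in>St. 0 \<le> p k \<xi>)) \<and>
     (\<forall>k<K. (\<Sum>\<xi>\<in>St. \<bar>p (Suc k) \<xi> - (p k \<xi> + h * gen (p k) \<xi>)\<bar>) \<le> B * h\<^sup>2) \<longrightarrow>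
     (\<Sum>\<xi>\<in>St. \<bar>p K \<xi> - gibbs_pi \<xi>\<bar>) \<le> C * exp (- l * (real K * h)) + C * B * h"
proof -
  obtain l h0 where l: "0 < l" and h0: "0 < h0" and
    contr: "\<And>h d. 0 < h \<Longrightarrow> h \<le> h0 \<Longrightarrow> sum d St = 0 \<Longrightarrow>
      0 \<le> 1 - l * h \<and> nrm (\<lambda>\<xi>. d \<xi> + h * gen d \<xi>) \<le> (1 - l * h) * nrm d"
    using step_contraction by blast
  define s where "s = sqrt pi_min"
  have s: "0 < s" using pi_min_pos by (simp add: s_def)
  define C where "C = real (card St) * (2 / s + 1 / (s * l))"
  have C: "0 \<le> C" using s l by (simp add: C_def)
  have main: "(\<Sum>\<xi>\<in>St. \<bar>p K \<xi> - gibbs_pi \<xi>\<bar>) \<le> C * exp (- l * (real K * h)) + C * B * h"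
    if h: "0 < h" "h \<le> h0" and B: "0 \<le> B"
      and p: "\<And>k. k \<le> K \<Longrightarrow> sum (p k) St = 1 \<and> (\<forall>\<xi>\<in>St. 0 \<le> p k \<xi>)"
      and err: "\<And>k. k < K \<Longrightarrow> (\<Sum>\<xi>\<in>St. \<bar>p (Suc k) \<xi> - (p k \<xi> + h * gen (p k) \<xi>)\<bar>) \<le> B * h\<^sup>2"
    for h B p K
  proof -
    define d where "d k \<xi> = p k \<xi> - gibbs_pi \<xi>" for k \<xi>
    have d0: "sum (d k) St = 0" if "k \<le> K" for k
      using p[OF that] sum_gibbs_pi by (simp add: d_def[abs_def] sum_subtractf)
    have rho: "0 \<le> 1 - l * h" using contr[OF h, of "\<lambda>_. 0"] by simp
    have rec: "nrm (d (Suc k)) \<le> (1 - l * h) * nrm (d k) + B * h\<^sup>2 / s" if "k < K" for k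
    proof -
      define e where "e \<xi> = p (Suc k) \<xi> - (p k \<xi> + h * gen (p k) \<xi>)" for \<xi>
      have "nrm (d (Suc k)) = nrm (\<lambda>\<xi>. (d k \<xi> + h * gen (d k) \<xi>) + e \<xi>)"
        unfolding nrm_def
        by (intro L2_set_cong refl) (simp add: d_def[abs_def] e_def gen_diff gen_gibbs_pi)
      also have "\<dots> \<le> nrm (\<lambda>\<xi>. d k \<xi> + h * gen (d k) \<xi>) + nrm e"
        by (rule nrm_triangle)
      also have "\<dots> \<le> (1 - l * h) * nrm (d k) + B * h\<^sup>2 / s"
      proof (rule add_mono)
        show "nrm (\<lambda>\<xi>. d k \<xi> + h * gen (d k) \<xi>) \<le> (1 - l * h) * nrm (d k)"
          using contr[OF h d0] that by simp
        have "nrm e \<le> (\<Sum>\<xi>\<in>St. \<bar>e \<xi>\<bar>) / s" unfolding s_def by (rule nrm_le_l1)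
        also have "\<dots> \<le> B * h\<^sup>2 / s" using err[OF that] s by (simp add: e_def divide_right_mono)
        finally show "nrm e \<le> B * h\<^sup>2 / s" .
      qed
      finally show ?thesis .
    qed
    have ind: "nrm (d k) \<le> (1 - l * h) ^ k * nrm (d 0) + B * h / (s * l)" if "k \<le> K" for k
      using that
    proof (induction k)
      case 0
      then show ?case using B h s l by simp
    next
      case (Suc k)
      have "nrm (d (Suc k)) \<le> (1 - l * h) * nrm (d k) + B * h\<^sup>2 / s" using rec Suc by simp
      also have "\<dots> \<le> (1 - l * h) * ((1 - l * h) ^ k * nrm (d 0) + B * h / (s * l)) + B * h\<^sup>2 / s"
        using Suc rho by (intro add_right_mono mult_left_mono) auto
      also have "\<dots> = (1 - l * h) ^ Suc k * nrm (d 0) + B * h / (s * l)"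
        using s l by (simp add: field_simps power2_eq_square)
      finally show ?case .
    qed
    have "nrm (d 0) \<le> (\<Sum>\<xi>\<in>St. \<bar>d 0 \<xi>\<bar>) / s" unfolding s_def by (rule nrm_le_l1)
    also have "(\<Sum>\<xi>\<in>St. \<bar>d 0 \<xi>\<bar>) \<le> (\<Sum>\<xi>\<in>St. p 0 \<xi> + gibbs_pi \<xi>)"
      using p[of 0] gibbs_pi_pos by (intro sum_mono) (auto simp: d_def abs_le_iff less_imp_le add_increasing)
    also have "\<dots> = 2" using p[of 0] sum_gibbs_pi by (simp add: sum.distrib)
    finally have d0b: "nrm (d 0) \<le> 2 / s" using s by (simp add: divide_right_mono)
    have "(1 - l * h) ^ K \<le> exp (- (l * h)) ^ K"
      using rho exp_ge_add_one_self[of "- (l * h)"] by (intro power_mono) auto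
    also have "\<dots> = exp (- l * (real K * h))"
      by (simp add: exp_of_nat_mult[symmetric] mult_ac)
    finally have pw: "(1 - l * h) ^ K \<le> exp (- l * (real K * h))" .
    have "(\<Sum>\<xi>\<in>St. \<bar>d K \<xi>\<bar>) \<le> real (card St) * nrm (d K)" by (rule l1_le_nrm)
    also have "\<dots> \<le> real (card St) * (exp (- l * (real K * h)) * (2 / s) + B * h / (s * l))"
    proof -
      have "(1 - l * h) ^ K * nrm (d 0) \<le> exp (- l * (real K * h)) * (2 / s)"
        using pw d0b nrm_nonneg by (intro mult_mono) auto
      then show ?thesis using ind[of K] by (intro mult_left_mono) auto
    qed
    also have "\<dots> \<le> real (card St) * (exp (- l * (real K * h)) * (2 / s + 1 / (s * l)) + (2 / s + 1 / (s * l)) * (B * h))"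
    proof -
      have "exp (- l * (real K * h)) * (2 / s) \<le> exp (- l * (real K * h)) * (2 / s + 1 / (s * l))"
        using s l by (intro mult_left_mono) auto
      moreover have "1 / (s * l) * (B * h) \<le> (2 / s + 1 / (s * l)) * (B * h)"
        using s l B h by (intro mult_right_mono) auto
      ultimately show ?thesis by (intro mult_left_mono) auto
    qed
    also have "\<dots> = C * exp (- l * (real K * h)) + C * B * h"
      by (simp add: C_def algebra_simps)
    finally show ?thesis by (simp add: d_def)
  qed
  show ?thesis
    by (rule exI[of _ l], rule conjI[OF l], rule exI[of _ C], rule conjI[OF C], rule exI[of _ h0],
        rule conjI[OF h0], intro allI impI, elim conjE, rule main) simp_all
qed

end

section \<open>The chain on a time grid\<close>

lemma exp_minus_le_quadratic: "0 \<le> x \<Longrightarrow> exp (- x) \<le> 1 - x + x\<^sup>2" for x :: real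
proof -
  assume x: "0 \<le> x"
  have "exp (- x) \<le> 1 / (1 + x)"
    using x exp_ge_add_one_self[of x] by (simp add: exp_minus inverse_eq_divide frac_le)
  also have "\<dots> \<le> 1 - x + x\<^sup>2"
  proof -
    have "1 \<le> (1 - x + x\<^sup>2) * (1 + x)" using x by (simp add: power2_eq_square algebra_simps)
    then show ?thesis using x by (simp add: pos_divide_le_eq)
  qed
  finally show ?thesis .
qed

text \<open>Here \<open>b\<close> is the Poisson mean of the points of a cell alive at one grid time
  and \<open>b * exp (- h)\<close> the mean one step later, so \<open>\<delta>\<close> is the
  conditional probability that a nonempty cell becomes empty. It is not exactly 1 - exp (- h),
  because a cell may hold several points. Convexity of the exponential between - b and 0 gives the
  upper bound; the lower bound loses a factor 1 - b, and b is at most w h.\<close>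

lemma death_probability_bounds:
  fixes h w x :: real
  assumes h: "0 < h" "h \<le> 1" and w: "0 < w" and x: "0 < x" "x \<le> 1"
  defines "b \<equiv> w * (1 - exp (- h)) * x"
  defines "\<delta> \<equiv> 1 - (1 - exp (- (b * exp (- h)))) / (1 - exp (- b))"
  shows "h - (1 + w) * h\<^sup>2 \<le> \<delta>" "\<delta> \<le> h"
proof -
  define r where "r = 1 - exp (- h)"
  have r: "0 < r" "r \<le> h" "r \<le> 1"
    using h exp_ge_add_one_self[of "- h"] by (auto simp: r_def)
  have r_ge: "h - h\<^sup>2 \<le> r" using exp_minus_le_quadratic[of h] h by (simp add: r_def)
  have b: "0 < b" "b \<le> w * h"
  proof -
    show "0 < b" using w r x by (simp add: b_def r_def[symmetric])
    have "w * r * x \<le> w * h * 1" using w r x by (intro mult_mono) auto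
    then show "b \<le> w * h" by (simp add: b_def r_def[symmetric])
  qed
  have den: "0 < 1 - exp (- b)" using b by simp
  have eh: "exp (- h) = 1 - r" by (simp add: r_def)
  have \<delta>: "\<delta> * (1 - exp (- b)) = exp (- (b * (1 - r))) - exp (- b)"
    unfolding \<delta>_def eh using den by (simp add: field_simps)
  have "exp (- (b * (1 - r))) \<le> (1 - r) * exp (- b) + r * exp 0"
    using convex_onD[OF exp_convex, of r "- b" 0] r by (simp add: algebra_simps)
  then have "\<delta> * (1 - exp (- b)) \<le> r * (1 - exp (- b))"
    unfolding \<delta> by (simp add: algebra_simps)
  then have "\<delta> \<le> r" using den by simp
  then show "\<delta> \<le> h" using r by simp
  show "h - (1 + w) * h\<^sup>2 \<le> \<delta>"
  proof -
    have "\<delta> * (1 - exp (- b)) = exp (- b) * (exp (b * r) - 1)"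
      unfolding \<delta> by (simp add: algebra_simps flip: exp_add)
    also have "\<dots> \<ge> exp (- b) * (b * r)"
    proof (rule mult_left_mono)
      show "b * r \<le> exp (b * r) - 1" using exp_ge_add_one_self[of "b * r"] by linarith
    qed simp
    finally have 1: "exp (- b) * (b * r) \<le> \<delta> * (1 - exp (- b))" .
    have \<delta>0: "0 \<le> \<delta>"
    proof -
      have "0 \<le> exp (- b) * (b * r)" using b r by simp
      with 1 have "0 \<le> \<delta> * (1 - exp (- b))" by linarith
      then show ?thesis using den by (simp add: zero_le_mult_iff)
    qed
    have "(1 - b) * (b * r) \<le> exp (- b) * (b * r)"
      using exp_ge_add_one_self[of "- b"] b r by (intro mult_right_mono) auto
    also have "\<dots> \<le> \<delta> * b"
      using 1 \<delta>0 mult_left_mono[of "1 - exp (- b)" b \<delta>] exp_ge_add_one_self[of "- b"] by linarith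
    finally have "b * ((1 - b) * r) \<le> b * \<delta>" by (simp add: mult_ac)
    then have "(1 - b) * r \<le> \<delta>" using b by simp
    moreover have "b * r \<le> (w * h) * h" using b r w h by (intro mult_mono) auto
    ultimately show ?thesis using r_ge by (simp add: algebra_simps power2_eq_square)
  qed
qed

text \<open>\<open>\<beta>\<close> is the probability that some point of a given type is born in one
  interval and survives to its end; the Poisson mean of such points is
  \<open>w * (1 - exp (- h))\<close>.\<close>

lemma birth_probability_bounds:
  fixes h w :: real
  assumes h: "0 < h" "h \<le> 1" and w: "0 < w"
  defines "\<beta> \<equiv> 1 - exp (- (w * (1 - exp (- h))))"
  shows "w * h - (w + w\<^sup>2) * h\<^sup>2 \<le> \<beta>" "\<beta> \<le> w * h"
proof -
  define r where "r = 1 - exp (- h)"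
  have r: "0 < r" "r \<le> h"
    using h exp_ge_add_one_self[of "- h"] by (auto simp: r_def)
  have q: "x - x\<^sup>2 \<le> 1 - exp (- x)" if "0 \<le> x" for x :: real
  proof -
    show ?thesis using exp_minus_le_quadratic[OF that] by simp
  qed
  have "h - h\<^sup>2 \<le> r" using q[of h] h by (simp add: r_def)
  then have "w * (h - h\<^sup>2) \<le> w * r" using w by simp
  moreover have "(w * r)\<^sup>2 \<le> (w * h)\<^sup>2" using r w by (intro power_mono mult_left_mono) auto
  moreover have "w * r - (w * r)\<^sup>2 \<le> \<beta>" unfolding \<beta>_def r_def[symmetric] using q[of "w * r"] w r by simp
  ultimately show "w * h - (w + w\<^sup>2) * h\<^sup>2 \<le> \<beta>" by (simp add: algebra_simps power_mult_distrib)
  have "\<beta> \<le> w * r" unfolding \<beta>_def r_def[symmetric] using exp_ge_add_one_self[of "- (w * r)"] by simp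
  also have "\<dots> \<le> w * h" using w r by simp
  finally show "\<beta> \<le> w * h" .
qed

text \<open>Given \<open>Z\<close>, coordinate \<open>c\<close> has the law of \<open>L c\<close>
  conditioned on \<open>Q\<close>. By \<open>Q\<close> and \<open>Zupd\<close>, membership in
  \<open>Z\<close> splits into \<open>l c \<in> Q\<close> and a condition on the other coordinates,
  and independence factorises. The identity is cross-multiplied to avoid dividing by a possibly
  vanishing probability.\<close>

lemma (in prob_space) prob_resample_coordinate:
  fixes L :: "'c \<Rightarrow> 'a \<Rightarrow> nat"
  assumes ind: "indep_vars (\<lambda>_. count_space UNIV) L I" and fin: "finite I" and c: "c \<in> I"
    and dep: "\<And>l l'. (\<And>i. i \<in> I \<Longrightarrow> l i = l' i) \<Longrightarrow> l \<in> Z \<longleftrightarrow> l' \<in> Z"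
    and Q: "\<And>l. l \<in> Z \<Longrightarrow> l c \<in> Q" and Zupd: "\<And>l v. l \<in> Z \<Longrightarrow> v \<in> Q \<Longrightarrow> l(c := v) \<in> Z"
    and R: "R \<subseteq> Q"
  shows "prob {\<omega> \<in> space M. (\<lambda>i. L i \<omega>) \<in> Z \<and> L c \<omega> \<in> R} * prob {\<omega> \<in> space M. L c \<omega> \<in> Q} =
         prob {\<omega> \<in> space M. (\<lambda>i. L i \<omega>) \<in> Z} * prob {\<omega> \<in> space M. L c \<omega> \<in> R}"
proof -
  \<comment> \<open>\<open>Z'\<close> is \<open>Z\<close> with coordinate \<open>c\<close>
    forgotten, hence an event of the remaining coordinates.\<close>
  define Z' where "Z' = {l. \<exists>v. l(c := v) \<in> Z}"
  have Z_iff: "l \<in> Z \<longleftrightarrow> l c \<in> Q \<and> l \<in> Z'" for l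
  proof
    assume "l \<in> Z"
    then show "l c \<in> Q \<and> l \<in> Z'" using Q by (auto simp: Z'_def intro!: exI[of _ "l c"])
  next
    assume "l c \<in> Q \<and> l \<in> Z'"
    then obtain v where "l(c := v) \<in> Z" "l c \<in> Q" by (auto simp: Z'_def)
    from Zupd[OF this] show "l \<in> Z" by simp
  qed
  have dep': "l \<in> Z' \<longleftrightarrow> l' \<in> Z'" if "\<And>i. i \<in> I - {c} \<Longrightarrow> l i = l' i" for l l'
  proof -
    have "l(c := v) \<in> Z \<longleftrightarrow> l'(c := v) \<in> Z" for v by (rule dep) (use that in auto)
    then show ?thesis by (simp add: Z'_def)
  qed
  let ?A = "I - {c}"
  have iv: "indep_var (PiM ?A (\<lambda>_. count_space UNIV)) (\<lambda>\<omega>. restrict (\<lambda>i. L i \<omega>) ?A)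
      (PiM {c} (\<lambda>_. count_space UNIV)) (\<lambda>\<omega>. restrict (\<lambda>i. L i \<omega>) {c})"
    by (rule indep_var_restrict[OF ind]) (use c in auto)
  have cs: "PiM A (\<lambda>_. count_space (UNIV :: nat set)) = count_space (PiE A (\<lambda>_. UNIV))" if "A \<subseteq> I" for A :: "'c set"
    by (rule count_space_PiM_finite) (use that fin in \<open>auto intro: finite_subset\<close>)
  have prod: "prob {\<omega> \<in> space M. (\<lambda>i. L i \<omega>) \<in> Z' \<and> L c \<omega> \<in> S} =
      prob {\<omega> \<in> space M. (\<lambda>i. L i \<omega>) \<in> Z'} * prob {\<omega> \<in> space M. L c \<omega> \<in> S}" for S
  proof -
    have e1: "(\<lambda>\<omega>. restrict (\<lambda>i. L i \<omega>) ?A) -` (Z' \<inter> PiE ?A (\<lambda>_. UNIV)) \<inter> space M = {\<omega> \<in> space M. (\<lambda>i. L i \<omega>) \<in> Z'}"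
    proof -
      have "restrict (\<lambda>i. L i \<omega>) ?A \<in> Z' \<longleftrightarrow> (\<lambda>i. L i \<omega>) \<in> Z'" for \<omega> by (rule dep') auto
      then show ?thesis by auto
    qed
    have e2: "(\<lambda>\<omega>. restrict (\<lambda>i. L i \<omega>) {c}) -` ({l. l c \<in> S} \<inter> PiE {c} (\<lambda>_. UNIV)) \<inter> space M = {\<omega> \<in> space M. L c \<omega> \<in> S}"
      by auto
    have "prob ((\<lambda>\<omega>. (restrict (\<lambda>i. L i \<omega>) ?A, restrict (\<lambda>i. L i \<omega>) {c})) -` ((Z' \<inter> PiE ?A (\<lambda>_. UNIV)) \<times> ({l. l c \<in> S} \<inter> PiE {c} (\<lambda>_. UNIV))) \<inter> space M) =
      prob ((\<lambda>\<omega>. restrict (\<lambda>i. L i \<omega>) ?A) -` (Z' \<inter> PiE ?A (\<lambda>_. UNIV)) \<inter> space M) *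
      prob ((\<lambda>\<omega>. restrict (\<lambda>i. L i \<omega>) {c}) -` ({l. l c \<in> S} \<inter> PiE {c} (\<lambda>_. UNIV)) \<inter> space M)"
      by (rule indep_varD[OF iv]) (use cs[of ?A] cs[of "{c}"] c in auto)
    also have "(\<lambda>\<omega>. (restrict (\<lambda>i. L i \<omega>) ?A, restrict (\<lambda>i. L i \<omega>) {c})) -` ((Z' \<inter> PiE ?A (\<lambda>_. UNIV)) \<times> ({l. l c \<in> S} \<inter> PiE {c} (\<lambda>_. UNIV))) \<inter> space M
       = {\<omega> \<in> space M. (\<lambda>i. L i \<omega>) \<in> Z'} \<inter> {\<omega> \<in> space M. L c \<omega> \<in> S}"
      unfolding e1[symmetric] e2[symmetric] by auto
    also have "\<dots> = {\<omega> \<in> space M. (\<lambda>i. L i \<omega>) \<in> Z' \<and> L c \<omega> \<in> S}" by auto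
    finally show ?thesis unfolding e1 e2 .
  qed
  have "{\<omega> \<in> space M. (\<lambda>i. L i \<omega>) \<in> Z \<and> L c \<omega> \<in> R} = {\<omega> \<in> space M. (\<lambda>i. L i \<omega>) \<in> Z' \<and> L c \<omega> \<in> R}"
    "{\<omega> \<in> space M. (\<lambda>i. L i \<omega>) \<in> Z} = {\<omega> \<in> space M. (\<lambda>i. L i \<omega>) \<in> Z' \<and> L c \<omega> \<in> Q}"
    using R by (auto simp: Z_iff)
  then show ?thesis by (simp add: prod)
qed

section \<open>Deterministic dynamics of cells\<close>

context hardcore
begin

text \<open>A cell \<open>(g, i)\<close> stands for the points of type \<open>g\<close> born in the \<open>i\<close>-th interval of a time grid;
  \<open>l (g, i)\<close> is the number of grid times, starting with the \<open>i\<close>-th one, at which such a point is alive.\<close>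
fun Y :: "('g \<times> nat \<Rightarrow> nat) \<Rightarrow> nat \<Rightarrow> ('g \<times> nat) set" where
  "Y l 0 = {}"
| "Y l (Suc k) = {c \<in> Y l k. Suc k < snd c + l c} \<union>
     {(g, Suc k) | g. {g' \<in> G. 0 < l (g', Suc k)} = {g} \<and> (\<forall>c\<in>Y l k. \<not> inc g (fst c))}"

lemma Y_subset: "Y l k \<subseteq> G \<times> {1..k}"
proof (induction k)
  case (Suc k)
  have "g \<in> G" if "{g' \<in> G. 0 < l (g', Suc k)} = {g}" for g using that by blast
  with Suc show ?case by fastforce
qed simp

lemma Y_alive: "c \<in> Y l k \<Longrightarrow> k < snd c + l c"
  by (cases k) auto

text \<open>Valid for every \<open>l\<close>, also off the good event: the recursion accepts a birth
  only if exactly one type is born in the interval, so two new cells never appear together and a new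
  one is checked against all the old ones.\<close>

lemma Y_compat: "c \<in> Y l k \<Longrightarrow> c' \<in> Y l k \<Longrightarrow> c \<noteq> c' \<Longrightarrow> \<not> inc (fst c) (fst c')"
proof (induction k arbitrary: c c')
  case (Suc k)
  have new: "d \<in> Y l k \<or> (fst d, Suc k) = d \<and> {g' \<in> G. 0 < l (g', Suc k)} = {fst d} \<and> (\<forall>c\<in>Y l k. \<not> inc (fst d) (fst c))"
    if "d \<in> Y l (Suc k)" for d
    using that by auto
  from new[OF Suc.prems(1)] new[OF Suc.prems(2)] show ?case
    using Suc.IH[of c c'] Suc.prems(3) inc_sym by (metis singleton_inject)
qed simp

text \<open>Reflexivity of \<open>inc\<close> on \<open>G\<close> forbids two cells of the same
  type, so passing from cells to states loses only the birth interval.\<close>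

lemma Y_inj: "inj_on fst (Y l k)"
  using Y_compat[of _ l k] Y_subset[of l k] inc_refl unfolding inj_on_def by (metis mem_Sigma_iff prod.collapse subsetD)

lemma Y_state: "fst ` Y l k \<in> St"
  using Y_compat[of _ l k] Y_subset[of l k] unfolding St_def by fastforce

lemma Y_finite: "finite (Y l k)"
  using Y_subset finite_G by (meson finite_SigmaI finite_atLeastAtMost finite_subset)

text \<open>The past up to step \<open>k\<close> sees a lifetime only through which grid times up to
  \<open>k\<close> it covers. This is what makes resampling the remaining lifetime harmless.\<close>

lemma Y_cong:
  assumes "\<And>c j. c \<in> G \<times> {1..k} \<Longrightarrow> snd c \<le> j \<Longrightarrow> j \<le> k \<Longrightarrow> j < snd c + l c \<longleftrightarrow> j < snd c + l' c"
  shows "Y l k = Y l' k"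
  using assms
proof (induction k)
  case (Suc k)
  then have "Y l k = Y l' k" by (intro Suc.IH) auto
  moreover have "{g' \<in> G. 0 < l (g', Suc k)} = {g' \<in> G. 0 < l' (g', Suc k)}"
    using Suc.prems[of "(_, Suc k)" "Suc k"] by auto
  moreover have "Suc k < snd c + l c \<longleftrightarrow> Suc k < snd c + l' c" if "c \<in> Y l k" for c
    using Suc.prems[of c "Suc k"] Y_subset[of l k] that by fastforce
  ultimately show ?case by auto
qed simp

text \<open>The event that cell \<open>c\<close> changes its status at the \<open>(k + 1)\<close>-st step: a birth or a death.\<close>
definition ev :: "nat \<Rightarrow> ('g \<times> nat \<Rightarrow> nat) \<Rightarrow> 'g \<times> nat \<Rightarrow> bool" where
  "ev k l c \<longleftrightarrow> (if snd c = Suc k then 0 < l c else \<not> Suc k < snd c + l c)"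

text \<open>Births of inadmissible types may be ignored: such a type conflicts with a cell already
  present. Restricting to \<open>adm\<close> yields the exact first-order holding probability
  later.\<close>

lemma Y_step_stay:
  assumes "\<And>c. c \<in> Y l k \<Longrightarrow> \<not> ev k l c" "\<And>g. g \<in> adm (fst ` Y l k) \<Longrightarrow> \<not> ev k l (g, Suc k)"
  shows "Y l (Suc k) = Y l k"
proof -
  have 1: "Suc k < snd c + l c" if "c \<in> Y l k" for c
    using assms(1)[OF that] Y_subset[of l k] that by (auto simp: ev_def split: if_splits)
  have "\<exists>c\<in>Y l k. inc g (fst c)" if g: "{g' \<in> G. 0 < l (g', Suc k)} = {g}" for g
  proof -
    have gG: "g \<in> G" "0 < l (g, Suc k)" using g by auto
    then have "g \<notin> adm (fst ` Y l k)" using assms(2)[of g] by (auto simp: ev_def)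
    then have "g \<in> fst ` Y l k \<or> insert g (fst ` Y l k) \<notin> St" using gG by (auto simp: adm_def)
    then show ?thesis
    proof
      assume "g \<in> fst ` Y l k" then show ?thesis using inc_refl[OF gG(1)] by auto
    next
      assume "insert g (fst ` Y l k) \<notin> St"
      then show ?thesis using Y_state[of l k] gG inc_sym by (auto simp: St_def)
    qed
  qed
  with 1 show ?thesis by auto
qed

lemma Y_step_birth:
  assumes g: "g \<in> adm (fst ` Y l k)" "ev k l (g, Suc k)"
    and other: "\<And>c. c \<in> (Y l k \<union> G \<times> {Suc k}) - {(g, Suc k)} \<Longrightarrow> \<not> ev k l c"
  shows "Y l (Suc k) = insert (g, Suc k) (Y l k)"
proof -
  have 1: "Suc k < snd c + l c" if "c \<in> Y l k" for c
    using other[of c] Y_subset[of l k] that by (auto simp: ev_def split: if_splits)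
  have 2: "{g' \<in> G. 0 < l (g', Suc k)} = {g}"
    using g other[of "(_, Suc k)"] by (auto simp: ev_def adm_def)
  have 3: "\<not> inc g (fst c)" if "c \<in> Y l k" for c
    using g(1) that by (auto simp: adm_def St_def)
  show ?thesis using 1 2 3 by auto
qed

lemma Y_step_death:
  assumes c: "c \<in> Y l k" "ev k l c"
    and other: "\<And>c'. c' \<in> (Y l k \<union> G \<times> {Suc k}) - {c} \<Longrightarrow> \<not> ev k l c'"
  shows "Y l (Suc k) = Y l k - {c}"
proof -
  have 1: "Suc k < snd c' + l c'" if "c' \<in> Y l k - {c}" for c'
    using other[of c'] Y_subset[of l k] that by (auto simp: ev_def split: if_splits)
  have 2: "\<not> Suc k < snd c + l c"
    using c Y_subset[of l k] by (auto simp: ev_def split: if_splits)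
  have "c \<noteq> (g, Suc k)" for g using c(1) Y_subset[of l k] by auto
  then have 3: "{g' \<in> G. 0 < l (g', Suc k)} = {}"
    using other[of "(_, Suc k)"] by (auto simp: ev_def)
  show ?thesis using 1 2 unfolding Y.simps 3 by auto
qed

end

section \<open>Random lifetimes and one-step transition bounds\<close>

lemma (in prob_space) prob_none_ge:
  assumes "finite J" "{\<omega> \<in> space M. A \<omega>} \<in> events" "\<And>j. j \<in> J \<Longrightarrow> {\<omega> \<in> space M. E j \<omega>} \<in> events"
  shows "prob {\<omega> \<in> space M. A \<omega>} - (\<Sum>j\<in>J. prob {\<omega> \<in> space M. A \<omega> \<and> E j \<omega>})
       \<le> prob {\<omega> \<in> space M. A \<omega> \<and> (\<forall>j\<in>J. \<not> E j \<omega>)}"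
proof -
  have AE': "{\<omega> \<in> space M. A \<omega> \<and> E j \<omega>} \<in> events" if "j \<in> J" for j
    using sets.Int[OF assms(2) assms(3)[OF that]] by (simp add: Collect_conj_eq Int_ac)
  have U: "(\<Union>j\<in>J. {\<omega> \<in> space M. A \<omega> \<and> E j \<omega>}) \<in> events"
    using assms(1) AE' by auto
  have eq: "{\<omega> \<in> space M. A \<omega> \<and> (\<forall>j\<in>J. \<not> E j \<omega>)} = {\<omega> \<in> space M. A \<omega>} - (\<Union>j\<in>J. {\<omega> \<in> space M. A \<omega> \<and> E j \<omega>})"
    by auto
  have "prob {\<omega> \<in> space M. A \<omega> \<and> (\<forall>j\<in>J. \<not> E j \<omega>)} =
      prob {\<omega> \<in> space M. A \<omega>} - prob (\<Union>j\<in>J. {\<omega> \<in> space M. A \<omega> \<and> E j \<omega>})"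
    unfolding eq using assms(2) U by (intro finite_measure_Diff) auto
  moreover have "prob (\<Union>j\<in>J. {\<omega> \<in> space M. A \<omega> \<and> E j \<omega>}) \<le> (\<Sum>j\<in>J. prob {\<omega> \<in> space M. A \<omega> \<and> E j \<omega>})"
    using assms(1) AE' by (intro finite_measure_subadditive_finite) auto
  ultimately show ?thesis by simp
qed

lemma (in prob_space) prob_sum_fibres:
  assumes "finite S" "\<And>y. y \<in> S \<Longrightarrow> {\<omega> \<in> space M. f \<omega> = y \<and> P \<omega>} \<in> events"
  shows "prob {\<omega> \<in> space M. f \<omega> \<in> S \<and> P \<omega>} = (\<Sum>y\<in>S. prob {\<omega> \<in> space M. f \<omega> = y \<and> P \<omega>})"
proof -
  have "{\<omega> \<in> space M. f \<omega> \<in> S \<and> P \<omega>} = (\<Union>y\<in>S. {\<omega> \<in> space M. f \<omega> = y \<and> P \<omega>})" by auto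
  then show ?thesis
    using assms by (simp only:) (intro finite_measure_finite_Union, auto simp: disjoint_family_on_def)
qed

text \<open>The formula in \<open>tail\<close> is the probability that a Poisson count is nonzero:
  points of type \<open>g\<close> born in an interval and alive at its end have mean
  \<open>w g * (1 - exp (- h))\<close>, and each further step thins them by
  \<open>exp (- h)\<close>.\<close>

locale grid_lifetimes = hardcore G w inc + prob_space M
  for G :: "'g set" and w inc and M :: "'a measure" +
  fixes L :: "'g \<times> nat \<Rightarrow> 'a \<Rightarrow> nat" and h :: real and K :: nat
  assumes h: "0 < h" "h \<le> 1"
    and indep: "indep_vars (\<lambda>_. count_space UNIV) L (G \<times> {1..K})"
    and tail: "g \<in> G \<Longrightarrow> 1 \<le> i \<Longrightarrow> i \<le> j \<Longrightarrow> j \<le> K \<Longrightarrow>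
      prob {\<omega> \<in> space M. j < i + L (g, i) \<omega>} = 1 - exp (- (w g * (1 - exp (- h)) * exp (- (real (j - i) * h))))"
begin

abbreviation Ls :: "'a \<Rightarrow> 'g \<times> nat \<Rightarrow> nat" where "Ls \<omega> \<equiv> (\<lambda>c. L c \<omega>)"

definition dep :: "('g \<times> nat \<Rightarrow> nat) set \<Rightarrow> bool" where
  "dep Z \<longleftrightarrow> (\<forall>l l'. (\<forall>c\<in>G \<times> {1..K}. l c = l' c) \<longrightarrow> (l \<in> Z \<longleftrightarrow> l' \<in> Z))"

text \<open>Only finitely many integer-valued coordinates matter, and a finite product of countable
  discrete spaces is discrete, so every such set is an event.\<close>

lemma dep_event:
  assumes "dep Z" shows "{\<omega> \<in> space M. Ls \<omega> \<in> Z} \<in> events"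
proof -
  let ?I = "G \<times> {1..K}"
  have cs: "PiM ?I (\<lambda>_. count_space (UNIV :: nat set)) = count_space (PiE ?I (\<lambda>_. UNIV))"
    by (rule count_space_PiM_finite) (use finite_G in auto)
  have "(\<lambda>\<omega>. restrict (Ls \<omega>) ?I) \<in> M \<rightarrow>\<^sub>M PiM ?I (\<lambda>_. count_space UNIV)"
    using indep by (intro measurable_restrict) (auto simp: indep_vars_def)
  then have "(\<lambda>\<omega>. restrict (Ls \<omega>) ?I) -` (Z \<inter> PiE ?I (\<lambda>_. UNIV)) \<inter> space M \<in> events"
    unfolding cs by (rule measurable_sets) simp
  moreover have "restrict (Ls \<omega>) ?I \<in> Z \<longleftrightarrow> Ls \<omega> \<in> Z" for \<omega>
    using assms unfolding dep_def by (metis restrict_apply')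
  then have "(\<lambda>\<omega>. restrict (Ls \<omega>) ?I) -` (Z \<inter> PiE ?I (\<lambda>_. UNIV)) \<inter> space M = {\<omega> \<in> space M. Ls \<omega> \<in> Z}"
    by auto
  ultimately show ?thesis by simp
qed

lemma dep_Y: "k \<le> K \<Longrightarrow> dep {l. P (Y l k)}"
  unfolding dep_def
proof (intro allI impI)
  fix l l' :: "'g \<times> nat \<Rightarrow> nat"
  assume "k \<le> K" "\<forall>c\<in>G \<times> {1..K}. l c = l' c"
  then have "Y l k = Y l' k" by (intro Y_cong) auto
  then show "(l \<in> {l. P (Y l k)}) = (l' \<in> {l. P (Y l k)})" by simp
qed

lemma dep_ev: "c \<in> G \<times> {1..K} \<Longrightarrow> dep {l. ev k l c}"
  unfolding dep_def ev_def by auto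

lemma dep_conj: "dep {l. P l} \<Longrightarrow> dep {l. Q l} \<Longrightarrow> dep {l. P l \<and> Q l}"
  unfolding dep_def by blast

text \<open>Conditional probability that the cell changes status at step \<open>k + 1\<close>: a
  birth if its interval is the next one, otherwise a death given that it is alive at
  \<open>k\<close>.\<close>

definition pe :: "nat \<Rightarrow> 'g \<times> nat \<Rightarrow> real" where
  "pe k c = (if snd c = Suc k then 1 - exp (- (w (fst c) * (1 - exp (- h))))
     else let b = w (fst c) * (1 - exp (- h)) * exp (- (real (k - snd c) * h))
          in 1 - (1 - exp (- (b * exp (- h)))) / (1 - exp (- b)))"

text \<open>\<open>al\<close> and \<open>upd\<close> say that \<open>Z\<close> constrains coordinate
  \<open>c\<close> by being alive at \<open>k\<close> and by nothing else. Resampling that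
  coordinate then produces the conditional probability \<open>pe\<close>, whatever else
  \<open>Z\<close> records about the past.\<close>

lemma ev_factor:
  assumes k: "k < K" and Z: "dep Z" and c: "c \<in> G \<times> {1..Suc k}"
    and al: "\<And>l. l \<in> Z \<Longrightarrow> snd c \<le> k \<Longrightarrow> k < snd c + l c"
    and upd: "\<And>l v. l \<in> Z \<Longrightarrow> (snd c \<le> k \<Longrightarrow> k < snd c + v) \<Longrightarrow> l(c := v) \<in> Z"
  shows "prob {\<omega> \<in> space M. Ls \<omega> \<in> Z \<and> ev k (Ls \<omega>) c} = pe k c * prob {\<omega> \<in> space M. Ls \<omega> \<in> Z}"
proof -
  obtain g i where gi: "c = (g, i)" "g \<in> G" "1 \<le> i" "i \<le> Suc k" using c by auto
  \<comment> \<open>For a cell of the next interval, \<open>i = Suc k\<close>, nothing is known yet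
    and \<open>Q\<close> is everything; for an older one \<open>Q\<close> is being alive at
    \<open>k\<close>.\<close>
  define Q where "Q = {v. i \<le> k \<longrightarrow> k < i + v}"
  define R where "R = {v \<in> Q. if i = Suc k then 0 < v else \<not> Suc k < i + v}"
  have res: "prob {\<omega> \<in> space M. Ls \<omega> \<in> Z \<and> L c \<omega> \<in> R} * prob {\<omega> \<in> space M. L c \<omega> \<in> Q} =
         prob {\<omega> \<in> space M. Ls \<omega> \<in> Z} * prob {\<omega> \<in> space M. L c \<omega> \<in> R}"
  proof (rule prob_resample_coordinate[OF indep])
    show "finite (G \<times> {1..K})" using finite_G by simp
    show "c \<in> G \<times> {1..K}" using gi k by auto
    show "l \<in> Z \<longleftrightarrow> l' \<in> Z" if "\<And>i. i \<in> G \<times> {1..K} \<Longrightarrow> l i = l' i" for l l'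
      using Z that unfolding dep_def by blast
    show "l c \<in> Q" if "l \<in> Z" for l using al[OF that] gi by (auto simp: Q_def)
    show "l(c := v) \<in> Z" if "l \<in> Z" "v \<in> Q" for l v using upd[OF that(1)] that(2) gi by (auto simp: Q_def)
    show "R \<subseteq> Q" by (auto simp: R_def)
  qed
  have "{\<omega> \<in> space M. Ls \<omega> \<in> Z \<and> ev k (Ls \<omega>) c} = {\<omega> \<in> space M. Ls \<omega> \<in> Z \<and> L c \<omega> \<in> R}"
    using al gi by (auto simp: R_def Q_def ev_def)
  moreover have "prob {\<omega> \<in> space M. L c \<omega> \<in> R} = pe k c * prob {\<omega> \<in> space M. L c \<omega> \<in> Q}
      \<and> prob {\<omega> \<in> space M. L c \<omega> \<in> Q} \<noteq> 0"
  proof (cases "i = Suc k")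
    case True
    have "{\<omega> \<in> space M. L c \<omega> \<in> Q} = space M" using True by (auto simp: Q_def)
    moreover have "{\<omega> \<in> space M. L c \<omega> \<in> R} = {\<omega> \<in> space M. Suc k < i + L (g, i) \<omega>}"
      using True by (auto simp: R_def Q_def gi)
    ultimately show ?thesis
      using tail[OF gi(2,3), of "Suc k"] True k by (simp add: prob_space pe_def gi)
  next
    case False
    define b where "b = w g * (1 - exp (- h)) * exp (- (real (k - i) * h))"
    have b: "0 < b" unfolding b_def using w_pos[OF gi(2)] h by simp
    have ik: "i \<le> k" using False gi by simp
    have Q: "{\<omega> \<in> space M. L c \<omega> \<in> Q} = {\<omega> \<in> space M. k < i + L (g, i) \<omega>}"
      using ik by (auto simp: Q_def gi)
    have R: "{\<omega> \<in> space M. L c \<omega> \<in> R} = {\<omega> \<in> space M. k < i + L (g, i) \<omega>} - {\<omega> \<in> space M. Suc k < i + L (g, i) \<omega>}"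
      using ik by (auto simp: R_def Q_def gi)
    have mq: "{\<omega> \<in> space M. j < i + L (g, i) \<omega>} \<in> events" for j
      using dep_event[of "{l. j < i + l (g, i)}"] gi k ik by (auto simp: dep_def)
    have q: "prob {\<omega> \<in> space M. k < i + L (g, i) \<omega>} = 1 - exp (- b)"
      using tail[OF gi(2,3), of k] ik k by (simp add: b_def)
    have "exp (- (real (Suc k - i) * h)) = exp (- (real (k - i) * h)) * exp (- h)"
      using ik by (simp add: Suc_diff_le algebra_simps flip: exp_add)
    then have q': "prob {\<omega> \<in> space M. Suc k < i + L (g, i) \<omega>} = 1 - exp (- (b * exp (- h)))"
      using tail[OF gi(2,3), of "Suc k"] ik k by (simp add: b_def mult_ac)
    have "prob {\<omega> \<in> space M. L c \<omega> \<in> R} = (1 - exp (- b)) - (1 - exp (- (b * exp (- h))))"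
      unfolding R q[symmetric] q'[symmetric] using mq by (intro finite_measure_Diff) auto
    moreover have "1 - exp (- b) \<noteq> 0" using b by simp
    moreover have "pe k c = 1 - (1 - exp (- (b * exp (- h)))) / (1 - exp (- b))"
      using False by (simp add: pe_def gi b_def Let_def)
    moreover have "(1 - y / x) * x = x - y" if "x \<noteq> 0" for x y :: real
      using that by (simp add: left_diff_distrib)
    ultimately show ?thesis
      unfolding Q q by metis
  qed
  ultimately show ?thesis using res by simp
qed

text \<open>One constant for all types: \<open>D * h\<close> dominates every one-step probability,
  and \<open>D\<close> squared dominates the second-order coefficients \<open>w + w\<^sup>2\<close>
  of births and \<open>1 + w\<close> of deaths.\<close>

definition D :: real where "D = 1 + sum w G"

lemma D_ge: "g \<in> G \<Longrightarrow> 1 + w g \<le> D" "1 \<le> D"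
  unfolding D_def using member_le_sum[of g G w] finite_G w_pos sum_nonneg[of G w] by (auto simp: less_imp_le)

lemma pe_bounds:
  assumes "c \<in> G \<times> {1..Suc k}"
  shows "snd c = Suc k \<Longrightarrow> pe k c \<le> w (fst c) * h"
    and "snd c = Suc k \<Longrightarrow> w (fst c) * h - D\<^sup>2 * h\<^sup>2 \<le> pe k c"
    and "snd c \<noteq> Suc k \<Longrightarrow> pe k c \<le> h"
    and "snd c \<noteq> Suc k \<Longrightarrow> h - D\<^sup>2 * h\<^sup>2 \<le> pe k c"
    and "0 \<le> pe k c" "pe k c \<le> D * h"
proof -
  have g: "fst c \<in> G" using assms by auto
  note wp = w_pos[OF g]
  have D1: "1 + w (fst c) \<le> D" by (rule D_ge(1)[OF g])
  have DD: "w (fst c) + (w (fst c))\<^sup>2 \<le> D\<^sup>2" "1 + w (fst c) \<le> D\<^sup>2"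
  proof -
    have "(1 + w (fst c))\<^sup>2 \<le> D\<^sup>2" using D1 wp by (intro power_mono) auto
    then show "w (fst c) + (w (fst c))\<^sup>2 \<le> D\<^sup>2" "1 + w (fst c) \<le> D\<^sup>2"
      unfolding power2_sum one_power2 mult_1_right using wp zero_le_power2[of "w (fst c)"] by - linarith+
  qed
  note bb = birth_probability_bounds[OF h wp]
  show b1: "pe k c \<le> w (fst c) * h" if "snd c = Suc k" using bb that by (simp add: pe_def)
  show b2: "w (fst c) * h - D\<^sup>2 * h\<^sup>2 \<le> pe k c" if "snd c = Suc k"
    using bb(1) that mult_right_mono[OF DD(1), of "h\<^sup>2"] by (simp add: pe_def)
  have x: "0 < exp (- (real (k - snd c) * h))" "exp (- (real (k - snd c) * h)) \<le> 1" using h by auto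
  note db = death_probability_bounds[OF h wp x]
  show d1: "pe k c \<le> h" if "snd c \<noteq> Suc k" using db(2) that by (simp add: pe_def Let_def)
  show d2: "h - D\<^sup>2 * h\<^sup>2 \<le> pe k c" if "snd c \<noteq> Suc k"
    using db(1) that mult_right_mono[OF DD(2), of "h\<^sup>2"] by (simp add: pe_def Let_def)
  show "0 \<le> pe k c"
  proof -
    define b where "b = w (fst c) * (1 - exp (- h)) * exp (- (real (k - snd c) * h))"
    have "0 < b" unfolding b_def using wp h by simp
    moreover have "b * exp (- h) \<le> b" using h \<open>0 < b\<close> by simp
    ultimately have "(1 - exp (- (b * exp (- h)))) / (1 - exp (- b)) \<le> 1"
      by (subst pos_divide_le_eq) auto
    then show ?thesis using wp h by (auto simp: pe_def b_def[symmetric] Let_def)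
  qed
  show "pe k c \<le> D * h"
  proof (cases "snd c = Suc k")
    case True
    have "w (fst c) * h \<le> D * h" using D1 h by (intro mult_right_mono) auto
    then show ?thesis using b1[OF True] by simp
  next
    case False
    have "1 * h \<le> D * h" using D_ge(2) h by (intro mult_right_mono) auto
    then show ?thesis using d1[OF False] by simp
  qed
qed

definition Ys :: "nat \<Rightarrow> ('g \<times> nat) set set" where "Ys k = range (\<lambda>l. Y l k)"

lemma finite_Ys: "finite (Ys k)"
proof (rule finite_subset)
  show "Ys k \<subseteq> Pow (G \<times> {1..k})" unfolding Ys_def using Y_subset by blast
qed (use finite_G in simp)

lemma Y_upd:
  assumes "Y l k = y" "c \<in> y \<union> G \<times> {Suc k}" "snd c \<le> k \<Longrightarrow> k < snd c + v"
  shows "Y (l(c := v)) k = y"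
proof -
  have "Y l k = Y (l(c := v)) k"
  proof (rule Y_cong)
    fix c' j assume *: "c' \<in> G \<times> {1..k}" "snd c' \<le> j" "j \<le> k"
    show "j < snd c' + l c' \<longleftrightarrow> j < snd c' + (l(c := v)) c'"
    proof (cases "c' = c")
      case True
      then have "c \<in> Y l k" using assms * by auto
      then show ?thesis using Y_alive[of c l k] assms(3) * True by auto
    qed simp
  qed
  with assms(1) show ?thesis by simp
qed

text \<open>The second claim is conditional independence of two cells given the past. It applies the
  factorisation again with the first event included in \<open>Z\<close>, which is allowed because
  \<open>ev k l c\<close> reads coordinate \<open>c\<close> only.\<close>

lemma ev_factor_Y:
  assumes k: "k < K" and y: "y \<in> Ys k" and c: "c \<in> y \<union> G \<times> {Suc k}"
  shows "prob {\<omega> \<in> space M. Y (Ls \<omega>) k = y \<and> ev k (Ls \<omega>) c} = pe k c * prob {\<omega> \<in> space M. Y (Ls \<omega>) k = y}"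
    and "c' \<in> y \<union> G \<times> {Suc k} \<Longrightarrow> c' \<noteq> c \<Longrightarrow>
      prob {\<omega> \<in> space M. (Y (Ls \<omega>) k = y \<and> ev k (Ls \<omega>) c) \<and> ev k (Ls \<omega>) c'} =
        pe k c' * (pe k c * prob {\<omega> \<in> space M. Y (Ls \<omega>) k = y})"
proof -
  have yG: "y \<subseteq> G \<times> {1..k}" using y Y_subset by (auto simp: Ys_def)
  have inI: "d \<in> G \<times> {1..Suc k}" "d \<in> G \<times> {1..K}" if "d \<in> y \<union> G \<times> {Suc k}" for d
    using that yG k by auto
  have old: "d \<in> y" if "d \<in> y \<union> G \<times> {Suc k}" "snd d \<le> k" for d using that by auto
  have dZ: "dep {l. Y l k = y}" using dep_Y[of k "\<lambda>x. x = y"] k by simp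
  have "prob {\<omega> \<in> space M. Ls \<omega> \<in> {l. Y l k = y} \<and> ev k (Ls \<omega>) c} = pe k c * prob {\<omega> \<in> space M. Ls \<omega> \<in> {l. Y l k = y}}"
    by (rule ev_factor[OF k dZ inI(1)[OF c]]) (use old[OF c] Y_alive Y_upd[OF _ c] in auto)
  then show 1: "prob {\<omega> \<in> space M. Y (Ls \<omega>) k = y \<and> ev k (Ls \<omega>) c} = pe k c * prob {\<omega> \<in> space M. Y (Ls \<omega>) k = y}"
    by simp
  assume c': "c' \<in> y \<union> G \<times> {Suc k}" "c' \<noteq> c"
  have dZ2: "dep {l. Y l k = y \<and> ev k l c}"
    by (rule dep_conj[OF dZ dep_ev[OF inI(2)[OF c]]])
  have "prob {\<omega> \<in> space M. Ls \<omega> \<in> {l. Y l k = y \<and> ev k l c} \<and> ev k (Ls \<omega>) c'} =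
      pe k c' * prob {\<omega> \<in> space M. Ls \<omega> \<in> {l. Y l k = y \<and> ev k l c}}"
  proof (rule ev_factor[OF k dZ2 inI(1)[OF c'(1)]])
    show "l(c' := v) \<in> {l. Y l k = y \<and> ev k l c}"
      if "l \<in> {l. Y l k = y \<and> ev k l c}" "snd c' \<le> k \<Longrightarrow> k < snd c' + v" for l v
      using Y_upd[OF _ c'(1), of l v] that c'(2) by (auto simp: ev_def)
  qed (use old[OF c'(1)] Y_alive in auto)
  then show "prob {\<omega> \<in> space M. (Y (Ls \<omega>) k = y \<and> ev k (Ls \<omega>) c) \<and> ev k (Ls \<omega>) c'} =
        pe k c' * (pe k c * prob {\<omega> \<in> space M. Y (Ls \<omega>) k = y})"
    using 1 by simp
qed

lemma event_Y: "k \<le> K \<Longrightarrow> {\<omega> \<in> space M. P (Y (Ls \<omega>) k)} \<in> events"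
  using dep_event[OF dep_Y[of k P]] by simp

lemma event_ev: "c \<in> G \<times> {1..K} \<Longrightarrow> {\<omega> \<in> space M. ev k (Ls \<omega>) c} \<in> events"
  using dep_event[OF dep_ev[of c k]] by simp

text \<open>At most \<open>2 * card G\<close> competing cells each cost
  \<open>D\<^sup>2 * h\<^sup>2\<close>; one further \<open>D\<^sup>2\<close> absorbs the
  second-order error in \<open>pe_bounds\<close>.\<close>

definition C :: real where "C = (2 * real (card G) + 1) * D\<^sup>2"

lemma C_nonneg: "0 \<le> C" by (simp add: C_def)

text \<open>Union bound over a second simultaneous event: each pair has conditional probability at
  most (D h)^2. Alive cells have distinct types, so together with the possible births there are at
  most \<open>2 * card G\<close> competitors.\<close>

lemma only_one_event:
  assumes k: "k < K" and y: "y \<in> Ys k" and c: "c \<in> y \<union> G \<times> {Suc k}"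
  shows "prob {\<omega> \<in> space M. Y (Ls \<omega>) k = y} * (pe k c - (2 * real (card G)) * D\<^sup>2 * h\<^sup>2) \<le>
    prob {\<omega> \<in> space M. (Y (Ls \<omega>) k = y \<and> ev k (Ls \<omega>) c) \<and> (\<forall>c'\<in>(y \<union> G \<times> {Suc k}) - {c}. \<not> ev k (Ls \<omega>) c')}"
proof -
  let ?J = "(y \<union> G \<times> {Suc k}) - {c}" and ?q = "prob {\<omega> \<in> space M. Y (Ls \<omega>) k = y}"
  obtain l where l: "y = Y l k" using y by (auto simp: Ys_def)
  have yG: "y \<subseteq> G \<times> {1..k}" using Y_subset l by simp
  have inI: "d \<in> G \<times> {1..Suc k}" "d \<in> G \<times> {1..K}" if "d \<in> y \<union> G \<times> {Suc k}" for d
    using that yG k by auto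
  have fin: "finite y" using l Y_finite by simp
  have "card y = card (fst ` y)" using Y_inj[of l k] l by (simp add: card_image)
  also have "\<dots> \<le> card G" using yG finite_G by (intro card_mono) auto
  finally have "card y \<le> card G" .
  then have "card (y \<union> G \<times> {Suc k}) \<le> 2 * card G"
    using card_Un_le[of y "G \<times> {Suc k}"] by (simp add: card_cartesian_product)
  moreover have "card ?J \<le> card (y \<union> G \<times> {Suc k})" using fin finite_G by (intro card_mono) auto
  ultimately have J: "card ?J \<le> 2 * card G" by linarith
  have "(\<Sum>c'\<in>?J. prob {\<omega> \<in> space M. (Y (Ls \<omega>) k = y \<and> ev k (Ls \<omega>) c) \<and> ev k (Ls \<omega>) c'})
      = (\<Sum>c'\<in>?J. pe k c' * (pe k c * ?q))"
    using ev_factor_Y(2)[OF k y c] by (intro sum.cong) auto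
  also have "\<dots> \<le> real (card ?J) * (D * h * (D * h * ?q))"
  proof (rule sum_bounded_above)
    fix c' assume "c' \<in> ?J"
    then show "pe k c' * (pe k c * ?q) \<le> D * h * (D * h * ?q)"
      using pe_bounds(5,6)[OF inI(1), of c'] pe_bounds(5,6)[OF inI(1)[OF c]]
      by (intro mult_mono) (auto intro: order_trans)
  qed
  also have "\<dots> \<le> (2 * real (card G)) * (D * h * (D * h * ?q))"
    using J D_ge(2) h by (intro mult_right_mono) auto
  finally have "(\<Sum>c'\<in>?J. prob {\<omega> \<in> space M. (Y (Ls \<omega>) k = y \<and> ev k (Ls \<omega>) c) \<and> ev k (Ls \<omega>) c'}) \<le>
      (2 * real (card G)) * D\<^sup>2 * h\<^sup>2 * ?q" by (simp add: power2_eq_square mult_ac)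
  moreover have "prob {\<omega> \<in> space M. Y (Ls \<omega>) k = y \<and> ev k (Ls \<omega>) c} = pe k c * ?q"
    by (rule ev_factor_Y(1)[OF k y c])
  moreover have "{\<omega> \<in> space M. Y (Ls \<omega>) k = y \<and> ev k (Ls \<omega>) c} \<in> events"
    using dep_event[OF dep_conj[OF dep_Y[of k "\<lambda>x. x = y"] dep_ev[OF inI(2)[OF c], of k]]] k by simp
  then have "prob {\<omega> \<in> space M. Y (Ls \<omega>) k = y \<and> ev k (Ls \<omega>) c} -
      (\<Sum>c'\<in>?J. prob {\<omega> \<in> space M. (Y (Ls \<omega>) k = y \<and> ev k (Ls \<omega>) c) \<and> ev k (Ls \<omega>) c'}) \<le>
      prob {\<omega> \<in> space M. (Y (Ls \<omega>) k = y \<and> ev k (Ls \<omega>) c) \<and> (\<forall>c'\<in>?J. \<not> ev k (Ls \<omega>) c')}"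
    using fin finite_G event_ev inI(2) by (intro prob_none_ge) auto
  ultimately show ?thesis by (simp add: algebra_simps)
qed

lemma trans_birth_y:
  assumes k: "k < K" and y: "y \<in> Ys k" and g: "g \<in> adm (fst ` y)"
  shows "prob {\<omega> \<in> space M. Y (Ls \<omega>) k = y} * (w g * h - C * h\<^sup>2) \<le>
    prob {\<omega> \<in> space M. Y (Ls \<omega>) k = y \<and> fst ` Y (Ls \<omega>) (Suc k) = insert g (fst ` y)}"
proof -
  have gG: "g \<in> G" using g by (simp add: adm_def)
  have c: "(g, Suc k) \<in> y \<union> G \<times> {Suc k}" using gG by simp
  have "prob {\<omega> \<in> space M. Y (Ls \<omega>) k = y} * (w g * h - C * h\<^sup>2) \<le>
     prob {\<omega> \<in> space M. Y (Ls \<omega>) k = y} * (pe k (g, Suc k) - (2 * real (card G)) * D\<^sup>2 * h\<^sup>2)"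
    using pe_bounds(2)[of "(g, Suc k)" k] gG by (intro mult_left_mono) (auto simp: C_def algebra_simps)
  also note only_one_event[OF k y c]
  also have "prob {\<omega> \<in> space M. (Y (Ls \<omega>) k = y \<and> ev k (Ls \<omega>) (g, Suc k)) \<and>
        (\<forall>c'\<in>(y \<union> G \<times> {Suc k}) - {(g, Suc k)}. \<not> ev k (Ls \<omega>) c')} \<le>
      prob {\<omega> \<in> space M. Y (Ls \<omega>) k = y \<and> fst ` Y (Ls \<omega>) (Suc k) = insert g (fst ` y)}"
  proof (rule finite_measure_mono)
    show "{\<omega> \<in> space M. (Y (Ls \<omega>) k = y \<and> ev k (Ls \<omega>) (g, Suc k)) \<and>
        (\<forall>c'\<in>(y \<union> G \<times> {Suc k}) - {(g, Suc k)}. \<not> ev k (Ls \<omega>) c')} \<subseteq>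
      {\<omega> \<in> space M. Y (Ls \<omega>) k = y \<and> fst ` Y (Ls \<omega>) (Suc k) = insert g (fst ` y)}"
    proof (intro subsetI CollectI, elim CollectE conjE, intro conjI)
      fix \<omega> assume *: "Y (Ls \<omega>) k = y" "ev k (Ls \<omega>) (g, Suc k)"
        "\<forall>c'\<in>(y \<union> G \<times> {Suc k}) - {(g, Suc k)}. \<not> ev k (Ls \<omega>) c'"
      then have "Y (Ls \<omega>) (Suc k) = insert (g, Suc k) y"
        using Y_step_birth[of g "Ls \<omega>" k] g by blast
      then show "fst ` Y (Ls \<omega>) (Suc k) = insert g (fst ` y)" by (metis fst_conv image_insert)
    qed
    show "{\<omega> \<in> space M. Y (Ls \<omega>) k = y \<and> fst ` Y (Ls \<omega>) (Suc k) = insert g (fst ` y)} \<in> events"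
      using dep_event[OF dep_conj[OF dep_Y[of k "\<lambda>x. x = y"] dep_Y[of "Suc k" "\<lambda>x. fst ` x = insert g (fst ` y)"]]] k
      by (simp del: Y.simps)
  qed
  finally show ?thesis .
qed

lemma trans_death_y:
  assumes k: "k < K" and y: "y \<in> Ys k" and g: "g \<in> fst ` y"
  shows "prob {\<omega> \<in> space M. Y (Ls \<omega>) k = y} * (h - C * h\<^sup>2) \<le>
    prob {\<omega> \<in> space M. Y (Ls \<omega>) k = y \<and> fst ` Y (Ls \<omega>) (Suc k) = fst ` y - {g}}"
proof -
  obtain l where l: "y = Y l k" using y by (auto simp: Ys_def)
  have yG: "y \<subseteq> G \<times> {1..k}" using Y_subset l by simp
  obtain c where cy: "c \<in> y" "fst c = g" using g by auto
  then have c: "c \<in> y \<union> G \<times> {Suc k}" by simp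
  have img: "fst ` (y - {c}) = fst ` y - {g}"
    using inj_on_image_set_diff[OF Y_inj[of l k], of y "{c}"] cy l by simp
  have "prob {\<omega> \<in> space M. Y (Ls \<omega>) k = y} * (h - C * h\<^sup>2) \<le>
     prob {\<omega> \<in> space M. Y (Ls \<omega>) k = y} * (pe k c - (2 * real (card G)) * D\<^sup>2 * h\<^sup>2)"
  proof -
    have "c \<in> G \<times> {1..Suc k}" "snd c \<noteq> Suc k" using cy yG by auto
    then show ?thesis
      using pe_bounds(4)[of c k] by (intro mult_left_mono) (auto simp: C_def algebra_simps)
  qed
  also note only_one_event[OF k y c]
  also have "prob {\<omega> \<in> space M. (Y (Ls \<omega>) k = y \<and> ev k (Ls \<omega>) c) \<and>
        (\<forall>c'\<in>(y \<union> G \<times> {Suc k}) - {c}. \<not> ev k (Ls \<omega>) c')} \<le>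
      prob {\<omega> \<in> space M. Y (Ls \<omega>) k = y \<and> fst ` Y (Ls \<omega>) (Suc k) = fst ` y - {g}}"
  proof (rule finite_measure_mono)
    show "{\<omega> \<in> space M. (Y (Ls \<omega>) k = y \<and> ev k (Ls \<omega>) c) \<and>
        (\<forall>c'\<in>(y \<union> G \<times> {Suc k}) - {c}. \<not> ev k (Ls \<omega>) c')} \<subseteq>
      {\<omega> \<in> space M. Y (Ls \<omega>) k = y \<and> fst ` Y (Ls \<omega>) (Suc k) = fst ` y - {g}}"
    proof (intro subsetI CollectI, elim CollectE conjE, intro conjI)
      fix \<omega> assume *: "Y (Ls \<omega>) k = y" "ev k (Ls \<omega>) c"
        "\<forall>c'\<in>(y \<union> G \<times> {Suc k}) - {c}. \<not> ev k (Ls \<omega>) c'"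
      then have "Y (Ls \<omega>) (Suc k) = y - {c}"
        using Y_step_death[of c "Ls \<omega>" k] cy by blast
      then show "fst ` Y (Ls \<omega>) (Suc k) = fst ` y - {g}" using img by metis
    qed
    show "{\<omega> \<in> space M. Y (Ls \<omega>) k = y \<and> fst ` Y (Ls \<omega>) (Suc k) = fst ` y - {g}} \<in> events"
      using dep_event[OF dep_conj[OF dep_Y[of k "\<lambda>x. x = y"] dep_Y[of "Suc k" "\<lambda>x. fst ` x = fst ` y - {g}"]]] k
      by (simp del: Y.simps)
  qed
  finally show ?thesis .
qed

text \<open>Here a plain union bound over the present cells and the admissible births suffices, and
  the upper bounds on \<open>pe\<close> are exactly linear in \<open>h\<close>, so no second-order
  term appears.\<close>

lemma trans_stay_y:
  assumes k: "k < K" and y: "y \<in> Ys k"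
  shows "prob {\<omega> \<in> space M. Y (Ls \<omega>) k = y} * (1 - h * real (card (fst ` y)) - h * sum w (adm (fst ` y))) \<le>
    prob {\<omega> \<in> space M. Y (Ls \<omega>) k = y \<and> fst ` Y (Ls \<omega>) (Suc k) = fst ` y}"
proof -
  let ?J = "y \<union> adm (fst ` y) \<times> {Suc k}" and ?q = "prob {\<omega> \<in> space M. Y (Ls \<omega>) k = y}"
  obtain l where l: "y = Y l k" using y by (auto simp: Ys_def)
  have yG: "y \<subseteq> G \<times> {1..k}" using Y_subset l by simp
  have fin: "finite y" using l Y_finite by simp
  have adG: "adm (fst ` y) \<subseteq> G" by (auto simp: adm_def)
  have sub: "?J \<subseteq> y \<union> G \<times> {Suc k}" using adG by auto
  have inI: "d \<in> G \<times> {1..Suc k}" "d \<in> G \<times> {1..K}" if "d \<in> y \<union> G \<times> {Suc k}" for d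
    using that yG k by auto
  have "(\<Sum>c\<in>?J. prob {\<omega> \<in> space M. Y (Ls \<omega>) k = y \<and> ev k (Ls \<omega>) c}) = (\<Sum>c\<in>?J. pe k c * ?q)"
    using ev_factor_Y(1)[OF k y] sub by (intro sum.cong) auto
  also have "\<dots> = ((\<Sum>c\<in>y. pe k c) + (\<Sum>c\<in>adm (fst ` y) \<times> {Suc k}. pe k c)) * ?q"
    unfolding sum_distrib_right[symmetric]
    by (subst sum.union_disjoint) (use yG fin finite_adm in auto)
  also have "\<dots> \<le> (h * real (card (fst ` y)) + h * sum w (adm (fst ` y))) * ?q"
  proof (intro mult_right_mono add_mono)
    have "(\<Sum>c\<in>y. pe k c) \<le> real (card y) * h"
    proof (rule sum_bounded_above)
      fix c assume "c \<in> y"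
      then have "c \<in> G \<times> {1..Suc k}" "snd c \<noteq> Suc k" using yG by auto
      then show "pe k c \<le> h" by (rule pe_bounds(3))
    qed
    also have "card y = card (fst ` y)" using Y_inj[of l k] l by (simp add: card_image)
    finally show "(\<Sum>c\<in>y. pe k c) \<le> h * real (card (fst ` y))" by (simp add: mult.commute)
    have "(\<Sum>c\<in>adm (fst ` y) \<times> {Suc k}. pe k c) \<le> (\<Sum>c\<in>adm (fst ` y) \<times> {Suc k}. w (fst c) * h)"
      using pe_bounds(1) adG by (intro sum_mono) auto
    also have "\<dots> = (\<Sum>g\<in>adm (fst ` y). w g * h)"
      by (rule sum.reindex_bij_witness[of _ "\<lambda>g. (g, Suc k)" fst]) auto
    also have "\<dots> = h * sum w (adm (fst ` y))" by (simp add: sum_distrib_left mult.commute)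
    finally show "(\<Sum>c\<in>adm (fst ` y) \<times> {Suc k}. pe k c) \<le> h * sum w (adm (fst ` y))" .
  qed simp
  finally have s: "(\<Sum>c\<in>?J. prob {\<omega> \<in> space M. Y (Ls \<omega>) k = y \<and> ev k (Ls \<omega>) c}) \<le>
      (h * real (card (fst ` y)) + h * sum w (adm (fst ` y))) * ?q" .
  have "?q * (1 - h * real (card (fst ` y)) - h * sum w (adm (fst ` y))) \<le>
      ?q - (\<Sum>c\<in>?J. prob {\<omega> \<in> space M. Y (Ls \<omega>) k = y \<and> ev k (Ls \<omega>) c})"
    using s by (simp add: algebra_simps)
  also have "\<dots> \<le> prob {\<omega> \<in> space M. Y (Ls \<omega>) k = y \<and> (\<forall>c\<in>?J. \<not> ev k (Ls \<omega>) c)}"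
  proof (rule prob_none_ge)
    show "{\<omega> \<in> space M. Y (Ls \<omega>) k = y} \<in> events" using event_Y[of k "\<lambda>x. x = y"] k by simp
    show "{\<omega> \<in> space M. ev k (Ls \<omega>) j} \<in> events" if "j \<in> ?J" for j
      using that sub by (intro event_ev inI(2)) auto
  qed (use fin finite_adm in auto)
  also have "\<dots> \<le> prob {\<omega> \<in> space M. Y (Ls \<omega>) k = y \<and> fst ` Y (Ls \<omega>) (Suc k) = fst ` y}"
  proof (rule finite_measure_mono)
    show "{\<omega> \<in> space M. Y (Ls \<omega>) k = y \<and> (\<forall>c\<in>?J. \<not> ev k (Ls \<omega>) c)} \<subseteq>
      {\<omega> \<in> space M. Y (Ls \<omega>) k = y \<and> fst ` Y (Ls \<omega>) (Suc k) = fst ` y}"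
    proof (intro subsetI CollectI, elim CollectE conjE, intro conjI)
      fix \<omega> assume *: "Y (Ls \<omega>) k = y" "\<forall>c\<in>?J. \<not> ev k (Ls \<omega>) c"
      then have "Y (Ls \<omega>) (Suc k) = Y (Ls \<omega>) k" by (intro Y_step_stay) auto
      then show "fst ` Y (Ls \<omega>) (Suc k) = fst ` y" using * by metis
    qed
    show "{\<omega> \<in> space M. Y (Ls \<omega>) k = y \<and> fst ` Y (Ls \<omega>) (Suc k) = fst ` y} \<in> events"
      using dep_event[OF dep_conj[OF dep_Y[of k "\<lambda>x. x = y"] dep_Y[of "Suc k" "\<lambda>x. fst ` x = fst ` y"]]] k
      by (simp del: Y.simps)
  qed
  finally show ?thesis .
qed

section \<open>Law of the state and its one-step error\<close>

definition pr :: "nat \<Rightarrow> 'g set \<Rightarrow> real" where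
  "pr k \<xi> = prob {\<omega> \<in> space M. fst ` Y (Ls \<omega>) k = \<xi>}"

definition tr :: "nat \<Rightarrow> 'g set \<Rightarrow> 'g set \<Rightarrow> real" where
  "tr k \<zeta> \<xi> = prob {\<omega> \<in> space M. fst ` Y (Ls \<omega>) k = \<zeta> \<and> fst ` Y (Ls \<omega>) (Suc k) = \<xi>}"

text \<open>The death probability depends on the age of a cell, so the state alone is not a Markov
  chain and the bounds are proved given the full set of cells. They are uniform in the ages, hence
  summing over all cell sets above one state yields a bound in terms of the state.\<close>

lemma tr_ge:
  assumes k: "k < K"
    and "\<And>y. y \<in> Ys k \<Longrightarrow> fst ` y = \<zeta> \<Longrightarrow> prob {\<omega> \<in> space M. Y (Ls \<omega>) k = y} * a \<le>
      prob {\<omega> \<in> space M. Y (Ls \<omega>) k = y \<and> fst ` Y (Ls \<omega>) (Suc k) = \<xi>}"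
  shows "pr k \<zeta> * a \<le> tr k \<zeta> \<xi>"
proof -
  let ?S = "{y \<in> Ys k. fst ` y = \<zeta>}"
  have fin: "finite ?S" using finite_Ys by simp
  have eq: "fst ` Y (Ls \<omega>) k = \<zeta> \<longleftrightarrow> Y (Ls \<omega>) k \<in> ?S" for \<omega> by (auto simp: Ys_def)
  have "pr k \<zeta> = prob {\<omega> \<in> space M. Y (Ls \<omega>) k \<in> ?S \<and> True}" unfolding pr_def eq by simp
  also have "\<dots> = (\<Sum>y\<in>?S. prob {\<omega> \<in> space M. Y (Ls \<omega>) k = y \<and> True})"
    by (rule prob_sum_fibres[OF fin]) (use event_Y[of k "\<lambda>x. x = _"] k in simp)
  finally have "pr k \<zeta> * a = (\<Sum>y\<in>?S. prob {\<omega> \<in> space M. Y (Ls \<omega>) k = y} * a)"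
    by (simp add: sum_distrib_right)
  also have "\<dots> \<le> (\<Sum>y\<in>?S. prob {\<omega> \<in> space M. Y (Ls \<omega>) k = y \<and> fst ` Y (Ls \<omega>) (Suc k) = \<xi>})"
    using assms(2) by (intro sum_mono) blast
  also have "\<dots> = prob {\<omega> \<in> space M. Y (Ls \<omega>) k \<in> ?S \<and> fst ` Y (Ls \<omega>) (Suc k) = \<xi>}"
  proof (rule prob_sum_fibres[OF fin, symmetric])
    fix y show "{\<omega> \<in> space M. Y (Ls \<omega>) k = y \<and> fst ` Y (Ls \<omega>) (Suc k) = \<xi>} \<in> events"
      using dep_event[OF dep_conj[OF dep_Y[of k "\<lambda>x. x = y"] dep_Y[of "Suc k" "\<lambda>x. fst ` x = \<xi>"]]] k
      by (simp del: Y.simps)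
  qed
  also have "\<dots> = tr k \<zeta> \<xi>" unfolding tr_def eq ..
  finally show ?thesis .
qed

lemma sum_pr: "k \<le> K \<Longrightarrow> sum (pr k) St = 1"
proof -
  assume k: "k \<le> K"
  have "(\<Sum>\<xi>\<in>St. prob {\<omega> \<in> space M. fst ` Y (Ls \<omega>) k = \<xi> \<and> True}) = prob {\<omega> \<in> space M. fst ` Y (Ls \<omega>) k \<in> St \<and> True}"
    by (rule prob_sum_fibres[OF finite_St, symmetric]) (use event_Y[OF k, of "\<lambda>x. fst ` x = _"] in simp)
  then show ?thesis by (simp add: pr_def[abs_def] Y_state prob_space)
qed

lemma pr_Suc: "k < K \<Longrightarrow> pr (Suc k) \<xi> = (\<Sum>\<zeta>\<in>St. tr k \<zeta> \<xi>)"
proof -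
  assume k: "k < K"
  have "(\<Sum>\<zeta>\<in>St. tr k \<zeta> \<xi>) = prob {\<omega> \<in> space M. fst ` Y (Ls \<omega>) k \<in> St \<and> fst ` Y (Ls \<omega>) (Suc k) = \<xi>}"
    unfolding tr_def
  proof (rule prob_sum_fibres[OF finite_St, symmetric])
    fix \<zeta> show "{\<omega> \<in> space M. fst ` Y (Ls \<omega>) k = \<zeta> \<and> fst ` Y (Ls \<omega>) (Suc k) = \<xi>} \<in> events"
      using dep_event[OF dep_conj[OF dep_Y[of k "\<lambda>x. fst ` x = \<zeta>"] dep_Y[of "Suc k" "\<lambda>x. fst ` x = \<xi>"]]] k
      by (simp del: Y.simps)
  qed
  then show ?thesis by (simp add: pr_def Y_state del: Y.simps)
qed

text \<open>Only the transitions from \<open>\<xi>\<close> itself and from its neighbours in the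
  state graph are kept; all others are dropped as nonnegative. Each of the at most
  \<open>2 * card G\<close> edges loses \<open>C * h\<^sup>2\<close>.\<close>

lemma pr_Suc_ge:
  assumes k: "k < K" and \<xi>: "\<xi> \<in> St"
  shows "pr k \<xi> + h * gen (pr k) \<xi> - 2 * real (card G) * (C * h\<^sup>2) \<le> pr (Suc k) \<xi>"
proof -
  have tr_nn: "0 \<le> tr k \<zeta> \<xi>" for \<zeta> by (simp add: tr_def)
  have pr1: "0 \<le> pr k \<zeta>" "pr k \<zeta> \<le> 1" for \<zeta> by (simp_all add: pr_def)
  have Ch: "0 \<le> C * h\<^sup>2" using C_nonneg by simp
  have cards: "card \<xi> \<le> card G" "card (adm \<xi>) \<le> card G"
    using \<xi> finite_G by (auto simp: St_def adm_def intro!: card_mono)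
  have stay: "pr k \<xi> * (1 - h * real (card \<xi>) - h * sum w (adm \<xi>)) \<le> tr k \<xi> \<xi>"
    by (rule tr_ge[OF k]) (use trans_stay_y[OF k] in auto)
  have birth: "w g * pr k (\<xi> - {g}) * h - C * h\<^sup>2 \<le> tr k (\<xi> - {g}) \<xi>" if "g \<in> \<xi>" for g
  proof -
    have "g \<in> adm (\<xi> - {g})" using that \<xi> by (auto simp: adm_def St_def insert_absorb)
    then have "pr k (\<xi> - {g}) * (w g * h - C * h\<^sup>2) \<le> tr k (\<xi> - {g}) \<xi>"
    proof (intro tr_ge[OF k])
      fix y assume y: "y \<in> Ys k" "fst ` y = \<xi> - {g}"
      then show "prob {\<omega> \<in> space M. Y (Ls \<omega>) k = y} * (w g * h - C * h\<^sup>2) \<le>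
          prob {\<omega> \<in> space M. Y (Ls \<omega>) k = y \<and> fst ` Y (Ls \<omega>) (Suc k) = \<xi>}"
        using trans_birth_y[OF k y(1), of g] \<open>g \<in> adm (\<xi> - {g})\<close> that
        by (simp add: insert_absorb del: Y.simps)
    qed
    moreover have "pr k (\<xi> - {g}) * (C * h\<^sup>2) \<le> 1 * (C * h\<^sup>2)" by (rule mult_right_mono[OF pr1(2) Ch])
    ultimately show ?thesis by (simp add: algebra_simps)
  qed
  have death: "pr k (insert g \<xi>) * h - C * h\<^sup>2 \<le> tr k (insert g \<xi>) \<xi>" if "g \<in> adm \<xi>" for g
  proof -
    have gx: "insert g \<xi> - {g} = \<xi>" using that by (auto simp: adm_def)
    have "pr k (insert g \<xi>) * (h - C * h\<^sup>2) \<le> tr k (insert g \<xi>) \<xi>"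
    proof (rule tr_ge[OF k])
      fix y assume y: "y \<in> Ys k" "fst ` y = insert g \<xi>"
      then show "prob {\<omega> \<in> space M. Y (Ls \<omega>) k = y} * (h - C * h\<^sup>2) \<le>
          prob {\<omega> \<in> space M. Y (Ls \<omega>) k = y \<and> fst ` Y (Ls \<omega>) (Suc k) = \<xi>}"
        using trans_death_y[OF k y(1), of g] gx by (simp del: Y.simps)
    qed
    moreover have "pr k (insert g \<xi>) * (C * h\<^sup>2) \<le> 1 * (C * h\<^sup>2)" by (rule mult_right_mono[OF pr1(2) Ch])
    ultimately show ?thesis by (simp add: algebra_simps)
  qed
  let ?A = "(\<lambda>g. \<xi> - {g}) ` \<xi>" and ?B = "(\<lambda>g. insert g \<xi>) ` adm \<xi>"
  have fin\<xi>: "finite \<xi>" using St_finite[OF \<xi>] .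
  have "sum (\<lambda>\<zeta>. tr k \<zeta> \<xi>) ({\<xi>} \<union> ?A \<union> ?B) \<le> pr (Suc k) \<xi>"
    unfolding pr_Suc[OF k]
    by (rule sum_mono2) (use \<xi> finite_St tr_nn St_subset[OF \<xi>] in \<open>auto simp: adm_def\<close>)
  moreover have "sum (\<lambda>\<zeta>. tr k \<zeta> \<xi>) ({\<xi>} \<union> ?A \<union> ?B) =
      tr k \<xi> \<xi> + (\<Sum>g\<in>\<xi>. tr k (\<xi> - {g}) \<xi>) + (\<Sum>g\<in>adm \<xi>. tr k (insert g \<xi>) \<xi>)"
  proof -
    have "({\<xi>} \<union> ?A) \<inter> ?B = {}" "{\<xi>} \<inter> ?A = {}" by (auto simp: adm_def)
    moreover have "inj_on (\<lambda>g. \<xi> - {g}) \<xi>" by (auto simp: inj_on_def)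
    moreover have "inj_on (\<lambda>g. insert g \<xi>) (adm \<xi>)" by (auto simp: inj_on_def adm_def)
    ultimately show ?thesis
      using fin\<xi> finite_adm by (simp add: sum.union_disjoint sum.reindex)
  qed
  moreover have "(\<Sum>g\<in>\<xi>. w g * pr k (\<xi> - {g}) * h - C * h\<^sup>2) \<le> (\<Sum>g\<in>\<xi>. tr k (\<xi> - {g}) \<xi>)"
    by (rule sum_mono) (rule birth)
  moreover have "(\<Sum>g\<in>adm \<xi>. pr k (insert g \<xi>) * h - C * h\<^sup>2) \<le> (\<Sum>g\<in>adm \<xi>. tr k (insert g \<xi>) \<xi>)"
    by (rule sum_mono) (rule death)
  moreover have "pr k \<xi> * (1 - h * real (card \<xi>) - h * sum w (adm \<xi>))
      + (\<Sum>g\<in>\<xi>. w g * pr k (\<xi> - {g}) * h - C * h\<^sup>2) + (\<Sum>g\<in>adm \<xi>. pr k (insert g \<xi>) * h - C * h\<^sup>2)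
      = pr k \<xi> + h * gen (pr k) \<xi> - (real (card \<xi>) + real (card (adm \<xi>))) * (C * h\<^sup>2)"
    by (simp add: gen_def sum_subtractf sum_distrib_left sum_distrib_right algebra_simps)
  moreover have "(real (card \<xi>) + real (card (adm \<xi>))) * (C * h\<^sup>2) \<le> 2 * real (card G) * (C * h\<^sup>2)"
    using cards Ch by (intro mult_right_mono) auto
  ultimately show ?thesis using stay by linarith
qed

text \<open>A one-sided estimate is enough. If x is at least - e then |x| is at most x + 2 e, and
  the differences x sum to zero because both laws have mass 1 and the generator conserves
  mass.\<close>

lemma one_step_error:
  assumes k: "k < K"
  shows "(\<Sum>\<xi>\<in>St. \<bar>pr (Suc k) \<xi> - (pr k \<xi> + h * gen (pr k) \<xi>)\<bar>) \<le> (4 * real (card St) * real (card G) * C) * h\<^sup>2"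
proof -
  let ?e = "2 * real (card G) * (C * h\<^sup>2)"
  have e0: "0 \<le> ?e" using C_nonneg by simp
  have "(\<Sum>\<xi>\<in>St. \<bar>pr (Suc k) \<xi> - (pr k \<xi> + h * gen (pr k) \<xi>)\<bar>) \<le>
      (\<Sum>\<xi>\<in>St. (pr (Suc k) \<xi> - (pr k \<xi> + h * gen (pr k) \<xi>)) + 2 * ?e)"
  proof (rule sum_mono)
    fix \<xi> assume "\<xi> \<in> St"
    from pr_Suc_ge[OF k this] e0
    show "\<bar>pr (Suc k) \<xi> - (pr k \<xi> + h * gen (pr k) \<xi>)\<bar> \<le>
        (pr (Suc k) \<xi> - (pr k \<xi> + h * gen (pr k) \<xi>)) + 2 * ?e" by linarith
  qed
  also have "\<dots> = 2 * ?e * real (card St)"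
    using sum_pr[of k] sum_pr[of "Suc k"] k
    by (simp add: sum.distrib sum_subtractf sum_distrib_left[symmetric] sum_gen)
  finally show ?thesis by (simp add: mult_ac)
qed

end

section \<open>Coupling with the kept points\<close>

lemma grid_interval:
  fixes a b h :: real
  assumes "a < b" "b \<le> a + real k * h"
  obtains i where "1 \<le> i" "i \<le> k" "a + real i * h - h < b" "b \<le> a + real i * h"
  using assms
proof (induction k arbitrary: thesis)
  case (Suc k)
  show ?case
  proof (cases "b \<le> a + real k * h")
    case True
    then show ?thesis using Suc.IH[of thesis] Suc.prems by (meson le_Suc_eq)
  next
    case False
    then show ?thesis using Suc.prems(1)[of "Suc k"] Suc.prems(2,3) by (simp add: algebra_simps)
  qed
qed simp

text \<open>The locale describes the good event: at most one birth or death per grid interval.\<close>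
locale grid_coupling = hardcore G w incompat
  for G :: "('a \<Rightarrow> 'a) set" and w +
  fixes F :: "(('a \<Rightarrow> 'a) \<times> real \<times> real) set" and a h :: real and K :: nat
    and l :: "('a \<Rightarrow> 'a) \<times> nat \<Rightarrow> nat"
  assumes h_pos: "0 < h" and finite_F: "finite F"
    and F_G: "\<phi> \<in> F \<Longrightarrow> fst \<phi> \<in> G" and F_birth: "\<phi> \<in> F \<Longrightarrow> a < birth \<phi>" "\<phi> \<in> F \<Longrightarrow> birth \<phi> \<le> a + real K * h"
    and no_die: "\<phi> \<in> F \<Longrightarrow> 1 \<le> k \<Longrightarrow> k \<le> K \<Longrightarrow> birth \<phi> \<in> {a + real k * h - h<..a + real k * h} \<Longrightarrow>
      a + real k * h < death \<phi>"
    and one: "1 \<le> k \<Longrightarrow> k \<le> K \<Longrightarrow>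
      \<phi> \<in> {\<theta> \<in> F. birth \<theta> \<in> {a + real k * h - h<..a + real k * h} \<or>
        birth \<theta> \<le> a + real k * h - h \<and> death \<theta> \<in> {a + real k * h - h<..a + real k * h}} \<Longrightarrow>
      \<psi> \<in> {\<theta> \<in> F. birth \<theta> \<in> {a + real k * h - h<..a + real k * h} \<or>
        birth \<theta> \<le> a + real k * h - h \<and> death \<theta> \<in> {a + real k * h - h<..a + real k * h}} \<Longrightarrow> \<phi> = \<psi>"
    and l: "g \<in> G \<Longrightarrow> 1 \<le> i \<Longrightarrow> i \<le> j \<Longrightarrow> j \<le> K \<Longrightarrow> j < i + l (g, i) \<longleftrightarrow>
      (\<exists>\<phi>\<in>F. fst \<phi> = g \<and> birth \<phi> \<in> {a + real i * h - h<..a + real i * h} \<and> a + real j * h < death \<phi>)"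
begin

abbreviation gt :: "nat \<Rightarrow> real" where "gt k \<equiv> a + real k * h"
abbreviation gi :: "nat \<Rightarrow> real set" where "gi k \<equiv> {gt k - h<..gt k}"

lemma gt_mono: "i \<le> k \<Longrightarrow> gt i \<le> gt k"
  using h_pos by simp

lemma gt_Suc: "gt (Suc k) - h = gt k"
  by (simp add: algebra_simps)

text \<open>Counterpart of \<open>Y\<close> read off from the points: the kept ones alive at the
  \<open>k\<close>-th grid time, recorded by type and birth interval.\<close>

definition R :: "nat \<Rightarrow> (('a \<Rightarrow> 'a) \<times> nat) set" where
  "R k = {(fst \<phi>, i) | \<phi> i. \<phi> \<in> kept F \<and> 1 \<le> i \<and> i \<le> k \<and> birth \<phi> \<in> gi i \<and> gt k < death \<phi>}"

text \<open>On the good event the birth of \<open>\<phi>\<close> is the only change in its interval: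
  nothing else is born there and nothing older dies there. Being alive at the instant of birth is
  therefore the same as being alive at the preceding grid time, and the greedy rule becomes a
  condition on \<open>R k\<close>.\<close>

lemma kept_birth_iff:
  assumes k: "Suc k \<le> K" and \<phi>: "\<phi> \<in> F" "birth \<phi> \<in> gi (Suc k)"
  shows "\<phi> \<in> kept F \<longleftrightarrow> (\<forall>c\<in>R k. \<not> incompat (fst \<phi>) (fst c))"
proof -
  have b\<phi>: "gt k < birth \<phi>" "birth \<phi> \<le> gt (Suc k)" using \<phi>(2) gt_Suc[of k] by auto
  have alive: "birth \<psi> < birth \<phi> \<and> birth \<phi> < death \<psi> \<longleftrightarrow>
      (\<exists>i. 1 \<le> i \<and> i \<le> k \<and> birth \<psi> \<in> gi i \<and> gt k < death \<psi>)" if \<psi>: "\<psi> \<in> F" for \<psi>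
  proof
    assume *: "birth \<psi> < birth \<phi> \<and> birth \<phi> < death \<psi>"
    have "birth \<psi> \<le> gt k"
    proof (rule ccontr)
      assume "\<not> birth \<psi> \<le> gt k"
      then have "birth \<psi> \<in> gi (Suc k)" using * b\<phi> gt_Suc[of k] by auto
      then have "\<psi> = \<phi>" using one[of "Suc k" \<psi> \<phi>] k \<phi> \<psi> by auto
      then show False using * by simp
    qed
    then obtain i where "1 \<le> i" "i \<le> k" "birth \<psi> \<in> gi i"
      using grid_interval[OF F_birth(1)[OF \<psi>], of k h] by auto
    then show "\<exists>i. 1 \<le> i \<and> i \<le> k \<and> birth \<psi> \<in> gi i \<and> gt k < death \<psi>" using * b\<phi> by auto
  next
    assume "\<exists>i. 1 \<le> i \<and> i \<le> k \<and> birth \<psi> \<in> gi i \<and> gt k < death \<psi>"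
    then obtain i where i: "1 \<le> i" "i \<le> k" "birth \<psi> \<in> gi i" "gt k < death \<psi>" by blast
    then have b\<psi>: "birth \<psi> \<le> gt k" using gt_mono[OF i(2)] i(3) by (meson greaterThanAtMost_iff order_trans)
    have "gt (Suc k) < death \<psi>"
    proof (rule ccontr)
      assume "\<not> gt (Suc k) < death \<psi>"
      then have "death \<psi> \<in> gi (Suc k)" using i gt_Suc[of k] by auto
      then have "\<psi> = \<phi>" using one[of "Suc k" \<psi> \<phi>] k \<phi> \<psi> b\<psi> gt_Suc[of k] by auto
      then show False using b\<psi> b\<phi> by simp
    qed
    then show "birth \<psi> < birth \<phi> \<and> birth \<phi> < death \<psi>" using b\<psi> b\<phi> by auto
  qed
  have "\<phi> \<in> kept F \<longleftrightarrow> (\<forall>\<psi>\<in>kept F. \<not> (incompat (fst \<psi>) (fst \<phi>) \<and> birth \<psi> < birth \<phi> \<and> birth \<phi> < death \<psi>))"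
    unfolding kept_iff[OF finite_F, of \<phi>] using \<phi>(1) kept_subset[of F] anc1_iff[of _ F \<phi>] by blast
  also have "\<dots> \<longleftrightarrow> (\<forall>\<psi>\<in>kept F. \<not> (incompat (fst \<psi>) (fst \<phi>) \<and> (\<exists>i. 1 \<le> i \<and> i \<le> k \<and> birth \<psi> \<in> gi i \<and> gt k < death \<psi>)))"
    using alive kept_subset[of F] by blast
  also have "\<dots> \<longleftrightarrow> (\<forall>c\<in>R k. \<not> incompat (fst \<phi>) (fst c))"
    unfolding R_def using inc_sym by fastforce
  finally show ?thesis .
qed

text \<open>Survivors and newborns are matched separately. Since an interval contains at most one
  birth, a cell lifetime speaks about a single point (\<open>surv\<close>), and the singleton test
  in the recursion just says that the unique newborn has type \<open>g\<close>
  (\<open>sing\<close>); by \<open>no_die\<close> the newborn is still alive when first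
  observed.\<close>

lemma Y_eq_R: "k \<le> K \<Longrightarrow> Y l k = R k"
proof (induction k)
  case 0
  then show ?case by (simp add: R_def)
next
  case (Suc k)
  then have IH: "Y l k = R k" and k: "Suc k \<le> K" by auto
  have surv: "Suc k < i + l (fst \<phi>, i) \<longleftrightarrow> gt (Suc k) < death \<phi>"
    if "\<phi> \<in> kept F" "1 \<le> i" "i \<le> k" "birth \<phi> \<in> gi i" for \<phi> i
  proof -
    have \<phi>: "\<phi> \<in> F" using that kept_subset by blast
    have "\<psi> = \<phi>" if "\<psi> \<in> F" "birth \<psi> \<in> gi i" for \<psi>
      using one[of i \<psi> \<phi>] that \<phi> \<open>1 \<le> i\<close> \<open>i \<le> k\<close> \<open>birth \<phi> \<in> gi i\<close> k by auto
    then have "(\<exists>\<psi>\<in>F. fst \<psi> = fst \<phi> \<and> birth \<psi> \<in> gi i \<and> gt (Suc k) < death \<psi>) \<longleftrightarrow> gt (Suc k) < death \<phi>"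
      using that(4) \<phi> by metis
    then show ?thesis
      using l[OF F_G[OF \<phi>] that(2) _ k] that(3) by simp
  qed
  have "gt k \<le> gt (Suc k)" using gt_mono[of k "Suc k"] by simp
  then have 1: "{c \<in> R k. Suc k < snd c + l c} =
      {(fst \<phi>, i) | \<phi> i. \<phi> \<in> kept F \<and> 1 \<le> i \<and> i \<le> k \<and> birth \<phi> \<in> gi i \<and> gt (Suc k) < death \<phi>}" (is "?A = ?B")
  proof (intro set_eqI iffI)
    fix c assume "c \<in> ?A"
    then obtain \<phi> i where "c = (fst \<phi>, i)" "\<phi> \<in> kept F" "1 \<le> i" "i \<le> k" "birth \<phi> \<in> gi i" "Suc k < i + l (fst \<phi>, i)"
      by (auto simp: R_def)
    then show "c \<in> ?B" using surv[of \<phi> i] by blast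
  next
    fix c assume "c \<in> ?B"
    then obtain \<phi> i where c: "c = (fst \<phi>, i)" "\<phi> \<in> kept F" "1 \<le> i" "i \<le> k" "birth \<phi> \<in> gi i" "gt (Suc k) < death \<phi>"
      by blast
    then have "Suc k < snd c + l c" using surv[of \<phi> i] by simp
    moreover have "gt k < death \<phi>" using c(6) \<open>gt k \<le> gt (Suc k)\<close> by linarith
    ultimately show "c \<in> ?A" using c unfolding R_def by blast
  qed
  have born: "0 < l (g, Suc k) \<longleftrightarrow> (\<exists>\<phi>\<in>F. fst \<phi> = g \<and> birth \<phi> \<in> gi (Suc k))" if "g \<in> G" for g
    using l[OF that, of "Suc k" "Suc k"] k no_die[of _ "Suc k"] by fastforce
  have uniq: "\<phi> = \<psi>" if "\<phi> \<in> F" "birth \<phi> \<in> gi (Suc k)" "\<psi> \<in> F" "birth \<psi> \<in> gi (Suc k)" for \<phi> \<psi>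
    using one[of "Suc k" \<phi> \<psi>] that k by auto
  have sing: "{g' \<in> G. 0 < l (g', Suc k)} = {g} \<longleftrightarrow> (\<exists>\<phi>\<in>F. fst \<phi> = g \<and> birth \<phi> \<in> gi (Suc k))" for g
  proof
    assume "{g' \<in> G. 0 < l (g', Suc k)} = {g}"
    then have "g \<in> G" "0 < l (g, Suc k)" by auto
    then show "\<exists>\<phi>\<in>F. fst \<phi> = g \<and> birth \<phi> \<in> gi (Suc k)" using born by blast
  next
    assume "\<exists>\<phi>\<in>F. fst \<phi> = g \<and> birth \<phi> \<in> gi (Suc k)"
    then obtain \<phi> where \<phi>: "\<phi> \<in> F" "fst \<phi> = g" "birth \<phi> \<in> gi (Suc k)" by blast
    have "g' = g" if g': "g' \<in> G" "0 < l (g', Suc k)" for g'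
    proof -
      obtain \<psi> where "\<psi> \<in> F" "fst \<psi> = g'" "birth \<psi> \<in> gi (Suc k)" using born[OF g'(1)] g'(2) by blast
      then show ?thesis using uniq[of \<psi> \<phi>] \<phi> by blast
    qed
    moreover have "g \<in> G" using F_G \<phi> by blast
    moreover have "0 < l (g, Suc k)" using born[OF \<open>g \<in> G\<close>] \<phi> by blast
    ultimately show "{g' \<in> G. 0 < l (g', Suc k)} = {g}" by blast
  qed
  have 2: "{(g, Suc k) | g. {g' \<in> G. 0 < l (g', Suc k)} = {g} \<and> (\<forall>c\<in>R k. \<not> incompat g (fst c))} =
      {(fst \<phi>, Suc k) | \<phi>. \<phi> \<in> kept F \<and> birth \<phi> \<in> gi (Suc k) \<and> gt (Suc k) < death \<phi>}" (is "?A = ?B")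
  proof (intro set_eqI iffI)
    fix c assume "c \<in> ?A"
    then obtain \<phi> where \<phi>: "c = (fst \<phi>, Suc k)" "\<phi> \<in> F" "birth \<phi> \<in> gi (Suc k)" "\<forall>c\<in>R k. \<not> incompat (fst \<phi>) (fst c)"
      unfolding sing by blast
    then have "\<phi> \<in> kept F" "gt (Suc k) < death \<phi>"
      using kept_birth_iff[OF k \<phi>(2,3)] no_die[OF \<phi>(2) _ k \<phi>(3)] by simp_all
    then show "c \<in> ?B" using \<phi> by blast
  next
    fix c assume "c \<in> ?B"
    then obtain \<phi> where \<phi>: "c = (fst \<phi>, Suc k)" "\<phi> \<in> kept F" "birth \<phi> \<in> gi (Suc k)" by blast
    then have "\<phi> \<in> F" using kept_subset by blast
    then show "c \<in> ?A" using kept_birth_iff[OF k _ \<phi>(3)] \<phi> unfolding sing by blast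
  qed
  have "R (Suc k) = {(fst \<phi>, i) | \<phi> i. \<phi> \<in> kept F \<and> 1 \<le> i \<and> i \<le> k \<and> birth \<phi> \<in> gi i \<and> gt (Suc k) < death \<phi>} \<union>
      {(fst \<phi>, Suc k) | \<phi>. \<phi> \<in> kept F \<and> birth \<phi> \<in> gi (Suc k) \<and> gt (Suc k) < death \<phi>}" (is "_ = ?A \<union> ?B")
  proof (intro set_eqI iffI)
    fix c assume "c \<in> R (Suc k)"
    then obtain \<phi> i where "c = (fst \<phi>, i)" "\<phi> \<in> kept F" "1 \<le> i" "i \<le> Suc k" "birth \<phi> \<in> gi i" "gt (Suc k) < death \<phi>"
      unfolding R_def by blast
    then show "c \<in> ?A \<union> ?B" by (cases "i = Suc k") (blast, metis (mono_tags, lifting) UnI1 le_SucE mem_Collect_eq)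
  next
    fix c assume "c \<in> ?A \<union> ?B"
    then obtain \<phi> i where "c = (fst \<phi>, i)" "\<phi> \<in> kept F" "1 \<le> i" "i \<le> Suc k" "birth \<phi> \<in> gi i" "gt (Suc k) < death \<phi>"
      by (elim UnE CollectE exE conjE) (simp_all)
    then show "c \<in> R (Suc k)" unfolding R_def by blast
  qed
  then show ?case unfolding Y.simps IH 1 2 by simp
qed

lemma eta_eq: "eta F (gt K) g = (if g \<in> fst ` Y l K then 1 else 0)"
proof -
  let ?S = "{\<phi> \<in> kept F. fst \<phi> = g \<and> birth \<phi> \<le> gt K \<and> gt K < death \<phi>}"
  have cell: "\<exists>i. 1 \<le> i \<and> i \<le> K \<and> birth \<phi> \<in> gi i \<and> (g, i) \<in> Y l K" if "\<phi> \<in> ?S" for \<phi>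
  proof -
    have "\<phi> \<in> F" using that kept_subset by blast
    then obtain i where "1 \<le> i" "i \<le> K" "birth \<phi> \<in> gi i"
      using grid_interval[OF F_birth, of \<phi>] by auto
    then show ?thesis using that unfolding Y_eq_R[OF order_refl] R_def by blast
  qed
  have uniq: "\<phi> = \<psi>" if S: "\<phi> \<in> ?S" "\<psi> \<in> ?S" for \<phi> \<psi>
  proof -
    obtain i where i: "1 \<le> i" "i \<le> K" "birth \<phi> \<in> gi i" "(g, i) \<in> Y l K" using cell[OF S(1)] by blast
    obtain j where j: "birth \<psi> \<in> gi j" "(g, j) \<in> Y l K" using cell[OF S(2)] by blast
    have "i = j" using inj_onD[OF Y_inj[of l K], of "(g, i)" "(g, j)"] i j by simp
    then show ?thesis using one[OF i(1,2), of \<phi> \<psi>] i j S kept_subset[of F] by auto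
  qed
  show ?thesis
  proof (cases "g \<in> fst ` Y l K")
    case True
    then obtain i where "(g, i) \<in> Y l K" by auto
    then obtain \<phi> where \<phi>: "\<phi> \<in> kept F" "fst \<phi> = g" "i \<le> K" "birth \<phi> \<in> gi i" "gt K < death \<phi>"
      unfolding Y_eq_R[OF order_refl] R_def by blast
    have "birth \<phi> \<le> gt K" using \<phi>(4) gt_mono[OF \<phi>(3)] by (meson greaterThanAtMost_iff order_trans)
    then have "\<phi> \<in> ?S" using \<phi> by blast
    then have "?S = {\<phi>}" using uniq by blast
    then show ?thesis using True unfolding eta_def by simp
  next
    case False
    then have S: "?S = {}" using cell by force
    show ?thesis unfolding eta_def S using False by simp
  qed
qed

end

section \<open>The intensity measure\<close>

text \<open>A cycle is determined by its graph on the support, a finite subset of a countable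
  set.\<close>

lemma countable_cycles: "countable (cycles :: (int^'d \<Rightarrow> int^'d) set)"
proof -
  define gr where "gr g = {(x, g x) | x. x \<in> supp g}" for g :: "int^'d \<Rightarrow> int^'d"
  have "inj gr"
  proof (rule injI, rule ext)
    fix f g :: "int^'d \<Rightarrow> int^'d" and x
    assume eq: "gr f = gr g"
    show "f x = g x"
    proof (cases "x \<in> supp f \<union> supp g")
      case True
      then have "(x, f x) \<in> gr f \<or> (x, g x) \<in> gr g" by (auto simp: gr_def)
      then have "(x, f x) \<in> gr g \<or> (x, g x) \<in> gr f" using eq by auto
      then show ?thesis by (auto simp: gr_def)
    qed (auto simp: supp_def)
  qed
  have "finite (gr g)" if "g \<in> cycles" for g
  proof -
    have "gr g = (\<lambda>x. (x, g x)) ` supp g" by (auto simp: gr_def)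
    then show ?thesis using that by (simp add: cycles_def is_cycle_def)
  qed
  then have "gr ` cycles \<subseteq> Collect finite" by auto
  then have "countable (gr ` cycles)" using countable_Collect_finite countable_subset by blast
  then show ?thesis using \<open>inj gr\<close> by (meson countable_image_inj_on inj_on_subset subset_UNIV)
qed

lemma cweight_nonneg: "0 \<le> cweight \<alpha> V g"
  by (simp add: cweight_def Let_def)

text \<open>The factor of \<open>intensity\<close> shared by all cycles: Lebesgue births with
  exponential lifetimes.\<close>

definition life :: "(real \<times> real) measure" where
  "life = density (lborel \<Otimes>\<^sub>M lborel) (\<lambda>(t, s). ennreal (exp (- s)) * indicator {0<..} s)"

lemma sets_lborel2: "sets (lborel \<Otimes>\<^sub>M lborel :: (real \<times> real) measure) = sets (borel \<Otimes>\<^sub>M borel)"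
  by (rule sets_pair_measure_cong) auto

lemma life_density [measurable]:
  "(\<lambda>(t, s). ennreal (exp (- s)) * indicator {0<..} s) \<in> borel_measurable (lborel \<Otimes>\<^sub>M lborel :: (real \<times> real) measure)"
  by measurable

lemma sets_life [measurable_cong]: "sets life = sets (borel \<Otimes>\<^sub>M borel)"
  by (simp add: life_def cong: sets_pair_measure_cong)

lemma sets_intensity: "sets (intensity \<alpha> V) = sets (count_space cycles \<Otimes>\<^sub>M (borel \<Otimes>\<^sub>M borel))"
  unfolding intensity_def sets_density
  by (intro sets_pair_measure_cong) auto

lemma space_intensity: "space (intensity \<alpha> V) = cycles \<times> UNIV"
  by (simp add: intensity_def space_pair_measure)

lemma rect_sets_intensity:
  assumes "G \<subseteq> cycles" "A \<in> sets (borel \<Otimes>\<^sub>M borel)"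
  shows "G \<times> A \<in> sets (intensity \<alpha> V)"
  unfolding sets_intensity using assms by (intro pair_measureI) auto

lemma emeasure_intensity:
  fixes G :: "(int^'d \<Rightarrow> int^'d) set"
  assumes G: "finite G" "G \<subseteq> cycles" and A: "A \<in> sets (borel \<Otimes>\<^sub>M borel)"
  shows "emeasure (intensity \<alpha> V) (G \<times> A) = ennreal (sum (cweight \<alpha> V) G) * emeasure life A"
proof -
  let ?w = "cweight \<alpha> V"
  have sf: "sigma_finite_measure (lborel \<Otimes>\<^sub>M lborel :: (real \<times> real) measure)"
    unfolding lborel_prod by (rule lborel.sigma_finite_measure_axioms)
  have A': "A \<in> sets (lborel \<Otimes>\<^sub>M lborel)" using A by (simp cong: sets_pair_measure_cong)
  have [measurable]: "?w \<in> count_space cycles \<rightarrow>\<^sub>M borel" by simp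
  have [measurable]: "A \<in> sets (borel \<Otimes>\<^sub>M borel)" by fact
  have [measurable]: "(\<lambda>x. x \<in> G) \<in> count_space cycles \<rightarrow>\<^sub>M count_space UNIV" by simp
  let ?f = "\<lambda>(g, t, s). ennreal (?w g * exp (- s)) * indicator {0<..} s"
  have f[measurable]: "?f \<in> borel_measurable (count_space cycles \<Otimes>\<^sub>M (lborel \<Otimes>\<^sub>M lborel))"
    by measurable
  have GA: "G \<times> A \<in> sets (count_space cycles \<Otimes>\<^sub>M (lborel \<Otimes>\<^sub>M lborel))"
    using G A' by (intro pair_measureI) auto
  have "emeasure (intensity \<alpha> V) (G \<times> A) =
      (\<integral>\<^sup>+ x. ?f x * indicator (G \<times> A) x \<partial>(count_space cycles \<Otimes>\<^sub>M (lborel \<Otimes>\<^sub>M lborel)))"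
    unfolding intensity_def by (rule emeasure_density[OF f GA])
  also have "\<dots> = (\<integral>\<^sup>+ g. \<integral>\<^sup>+ p. ?f (g, p) * indicator (G \<times> A) (g, p) \<partial>(lborel \<Otimes>\<^sub>M lborel) \<partial>count_space cycles)"
    by (rule sigma_finite_measure.nn_integral_fst[OF sf, symmetric, where f = "\<lambda>x. ?f x * indicator (G \<times> A) x"])
       (intro borel_measurable_times_ennreal borel_measurable_indicator f GA)
  also have "\<dots> = (\<integral>\<^sup>+ g. ennreal (?w g) * indicator G g * emeasure life A \<partial>count_space cycles)"
  proof (rule nn_integral_cong)
    fix g
    have "(\<integral>\<^sup>+ p. ?f (g, p) * indicator (G \<times> A) (g, p) \<partial>(lborel \<Otimes>\<^sub>M lborel)) =
        (\<integral>\<^sup>+ p. ennreal (?w g) * indicator G g * ((\<lambda>(t, s). ennreal (exp (- s)) * indicator {0<..} s) p * indicator A p) \<partial>(lborel \<Otimes>\<^sub>M lborel))"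
      by (rule nn_integral_cong) (auto simp: ennreal_mult cweight_nonneg indicator_def split: prod.splits)
    also have "\<dots> = ennreal (?w g) * indicator G g * (\<integral>\<^sup>+ p. (\<lambda>(t, s). ennreal (exp (- s)) * indicator {0<..} s) p * indicator A p \<partial>(lborel \<Otimes>\<^sub>M lborel))"
      using A' by (intro nn_integral_cmult) measurable
    also have "(\<integral>\<^sup>+ p. (\<lambda>(t, s). ennreal (exp (- s)) * indicator {0<..} s) p * indicator A p \<partial>(lborel \<Otimes>\<^sub>M lborel)) = emeasure life A"
      unfolding life_def using A' by (intro emeasure_density[symmetric]) measurable
    finally show "(\<integral>\<^sup>+ p. ?f (g, p) * indicator (G \<times> A) (g, p) \<partial>(lborel \<Otimes>\<^sub>M lborel)) =
      ennreal (?w g) * indicator G g * emeasure life A" .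
  qed
  also have "\<dots> = (\<integral>\<^sup>+ g. ennreal (?w g) * indicator G g \<partial>count_space cycles) * emeasure life A"
    by (rule nn_integral_multc) simp
  also have "(\<integral>\<^sup>+ g. ennreal (?w g) * indicator G g \<partial>count_space cycles) = (\<Sum>g\<in>G. ennreal (?w g) * indicator G g)"
    using G by (intro nn_integral_count_space') auto
  also have "\<dots> = ennreal (sum ?w G)"
    by (simp add: cweight_nonneg)
  finally show ?thesis .
qed

section \<open>Masses of regions in the birth-lifetime plane\<close>

lemma planar_set:
  "Measurable.pred (borel \<Otimes>\<^sub>M borel) (\<lambda>p. P (fst p) (snd p)) \<Longrightarrow> {(t, s). P t s} \<in> sets (borel \<Otimes>\<^sub>M borel)"
  for P :: "real \<Rightarrow> real \<Rightarrow> bool"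
  by (drule predE) (simp add: space_pair_measure case_prod_unfold)

text \<open>Integrating the lifetime first, a point born at t outlives u with mass exp (t - u),
  which is then integrated over the births. The exceptional boundary values are null and are moved
  into the closed ranges that the integration rules expect.\<close>

lemma emeasure_life_tail:
  assumes "x \<le> y" "y \<le> u"
  shows "emeasure life {(t, s). x < t \<and> t \<le> y \<and> u < t + s} = ennreal (exp (y - u) - exp (x - u))"
proof -
  let ?A = "{(t, s). x < t \<and> t \<le> y \<and> u < t + s}"
  have A[measurable]: "?A \<in> sets (borel \<Otimes>\<^sub>M borel)" by (rule planar_set) measurable
  have "emeasure life ?A = (\<integral>\<^sup>+ p. (\<lambda>(t, s). ennreal (exp (- s)) * indicator {0<..} s) p * indicator ?A p \<partial>(lborel \<Otimes>\<^sub>M lborel))"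
    unfolding life_def using A by (intro emeasure_density life_density) (simp only: sets_lborel2)
  also have "\<dots> = (\<integral>\<^sup>+ t. \<integral>\<^sup>+ s. (\<lambda>(t, s). ennreal (exp (- s)) * indicator {0<..} s) (t, s) * indicator ?A (t, s) \<partial>lborel \<partial>lborel)"
    by (rule lborel.nn_integral_fst[symmetric]) measurable
  also have "\<dots> = (\<integral>\<^sup>+ t. ennreal (exp (t - u)) * indicator {x..y} t \<partial>lborel)"
  proof (rule nn_integral_cong_AE)
    have inner: "(\<integral>\<^sup>+ s. ennreal (exp (- s)) * indicator {b..} s \<partial>lborel) = ennreal (exp (- b))" for b :: real
    proof -
      have "((\<lambda>s::real. - exp (- s)) \<longlongrightarrow> 0) at_top"
        using tendsto_minus[OF filterlim_compose[OF exp_at_bot filterlim_uminus_at_bot_at_top]] by simp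
      then have "(\<integral>\<^sup>+ s. ennreal (exp (- s)) * indicator {b..} s \<partial>lborel) = ennreal (0 - (- exp (- b)))"
        by (intro nn_integral_FTC_atLeast) (auto intro!: derivative_eq_intros)
      then show ?thesis by simp
    qed
    have "AE t in lborel. t \<noteq> x" by (rule AE_lborel_singleton)
    then show "AE t in lborel. (\<integral>\<^sup>+ s. (\<lambda>(t, s). ennreal (exp (- s)) * indicator {0<..} s) (t, s) * indicator ?A (t, s) \<partial>lborel) =
        ennreal (exp (t - u)) * indicator {x..y} t"
    proof eventually_elim
      case (elim t)
      show ?case
      proof (cases "x < t \<and> t \<le> y")
        case True
        have "(\<integral>\<^sup>+ s. (\<lambda>(t, s). ennreal (exp (- s)) * indicator {0<..} s) (t, s) * indicator ?A (t, s) \<partial>lborel) =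
            (\<integral>\<^sup>+ s. ennreal (exp (- s)) * indicator {u - t..} s \<partial>lborel)"
        proof (rule nn_integral_cong_AE)
          have "AE s in lborel. s \<noteq> u - t" by (rule AE_lborel_singleton)
          then show "AE s in lborel. (\<lambda>(t, s). ennreal (exp (- s)) * indicator {0<..} s) (t, s) * indicator ?A (t, s) =
              ennreal (exp (- s)) * indicator {u - t..} s"
            by eventually_elim (use True assms in \<open>auto simp: indicator_def\<close>)
        qed
        then show ?thesis using inner[of "u - t"] True by simp
      next
        case False
        then show ?thesis using elim by (auto simp: indicator_def)
      qed
    qed
  qed
  also have "\<dots> = ennreal (exp (y - u) - exp (x - u))"
    by (rule nn_integral_FTC_Icc) (use assms in \<open>auto intro!: derivative_eq_intros\<close>)
  finally show ?thesis .
qed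

lemma emeasure_life_births:
  assumes "x \<le> y"
  shows "emeasure life {(t, s). x < t \<and> t \<le> y \<and> 0 < s} = ennreal (y - x)"
proof -
  let ?A = "{(t, s). x < t \<and> t \<le> y \<and> (0::real) < s}"
  have A[measurable]: "?A \<in> sets (borel \<Otimes>\<^sub>M borel)" by (rule planar_set) measurable
  have "emeasure life ?A = (\<integral>\<^sup>+ p. (\<lambda>(t, s). ennreal (exp (- s)) * indicator {0<..} s) p * indicator ?A p \<partial>(lborel \<Otimes>\<^sub>M lborel))"
    unfolding life_def using A by (intro emeasure_density life_density) (simp only: sets_lborel2)
  also have "\<dots> = (\<integral>\<^sup>+ t. \<integral>\<^sup>+ s. (\<lambda>(t, s). ennreal (exp (- s)) * indicator {0<..} s) (t, s) * indicator ?A (t, s) \<partial>lborel \<partial>lborel)"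
    by (rule lborel.nn_integral_fst[symmetric]) measurable
  also have "\<dots> = (\<integral>\<^sup>+ t. indicator {x<..y} t \<partial>lborel)"
  proof (rule nn_integral_cong)
    fix t
    have "((\<lambda>s::real. - exp (- s)) \<longlongrightarrow> 0) at_top"
      using tendsto_minus[OF filterlim_compose[OF exp_at_bot filterlim_uminus_at_bot_at_top]] by simp
    then have "(\<integral>\<^sup>+ s. ennreal (exp (- s)) * indicator {0..} s \<partial>lborel) = ennreal (0 - (- exp (- 0)))"
      by (intro nn_integral_FTC_atLeast) (auto intro!: derivative_eq_intros)
    then have 1: "(\<integral>\<^sup>+ s. ennreal (exp (- s)) * indicator {0::real..} s \<partial>lborel) = 1" by simp
    have "(\<integral>\<^sup>+ s. (\<lambda>(t, s). ennreal (exp (- s)) * indicator {0<..} s) (t, s) * indicator ?A (t, s) \<partial>lborel) =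
        (\<integral>\<^sup>+ s. indicator {x<..y} t * (ennreal (exp (- s)) * indicator {0..} s) \<partial>lborel)"
    proof (rule nn_integral_cong_AE)
      have "AE s in lborel. s \<noteq> (0::real)" by (rule AE_lborel_singleton)
      then show "AE s in lborel. (\<lambda>(t, s). ennreal (exp (- s)) * indicator {0<..} s) (t, s) * indicator ?A (t, s) =
          indicator {x<..y} t * (ennreal (exp (- s)) * indicator {0..} s)"
        by eventually_elim (auto simp: indicator_def)
    qed
    also have "\<dots> = indicator {x<..y} t" by (subst nn_integral_cmult) (simp_all add: 1)
    finally show "(\<integral>\<^sup>+ s. (\<lambda>(t, s). ennreal (exp (- s)) * indicator {0<..} s) (t, s) * indicator ?A (t, s) \<partial>lborel) =
        indicator {x<..y} t" .
  qed
  also have "\<dots> = ennreal (y - x)" using assms by simp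
  finally show ?thesis .
qed

text \<open>All births of the interval minus those alive at its end: h - (1 - exp (- h)), which is
  of second order.\<close>

lemma emeasure_life_die_within:
  assumes "0 \<le> h"
  shows "emeasure life {(t, s). x - h < t \<and> t \<le> x \<and> 0 < s \<and> t + s \<le> x} \<le> ennreal (h\<^sup>2)"
proof -
  let ?B = "{(t, s). x - h < t \<and> t \<le> x \<and> 0 < s}" and ?C = "{(t, s). x - h < t \<and> t \<le> x \<and> x < t + s}"
  have B: "emeasure life ?B = ennreal h" using emeasure_life_births[of "x - h" x] assms by simp
  have C: "emeasure life ?C = ennreal (1 - exp (- h))" using emeasure_life_tail[of "x - h" x x] assms by simp
  have "{(t, s). x - h < t \<and> t \<le> x \<and> 0 < s \<and> t + s \<le> x} = ?B - ?C" by auto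
  moreover have "emeasure life (?B - ?C) = emeasure life ?B - emeasure life ?C"
    using C by (intro emeasure_Diff) (auto simp: sets_life intro!: planar_set)
  ultimately have "emeasure life {(t, s). x - h < t \<and> t \<le> x \<and> 0 < s \<and> t + s \<le> x} = ennreal (h - (1 - exp (- h)))"
    using assms by (simp add: B C ennreal_minus)
  also have "\<dots> \<le> ennreal (h\<^sup>2)"
  proof (rule ennreal_leI)
    show "h - (1 - exp (- h)) \<le> h\<^sup>2" using exp_minus_le_quadratic[OF assms] by simp
  qed
  finally show ?thesis .
qed

text \<open>The difference of two tails factorises as (1 - exp (a - x)) * (1 - exp (- h)), so the
  bound is uniform in the length of the past.\<close>

lemma emeasure_life_die_after:
  assumes "0 \<le> h" "a \<le> x"
  shows "emeasure life {(t, s). a < t \<and> t \<le> x \<and> x < t + s \<and> t + s \<le> x + h} \<le> ennreal h"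
proof -
  let ?B = "{(t, s). a < t \<and> t \<le> x \<and> x < t + s}" and ?C = "{(t, s). a < t \<and> t \<le> x \<and> x + h < t + s}"
  have B: "emeasure life ?B = ennreal (1 - exp (a - x))" using emeasure_life_tail[of a x x] assms by simp
  have C: "emeasure life ?C = ennreal (exp (- h) - exp (a - x - h))"
    using emeasure_life_tail[of a x "x + h"] assms by (simp add: algebra_simps)
  have "{(t, s). a < t \<and> t \<le> x \<and> x < t + s \<and> t + s \<le> x + h} = ?B - ?C" using assms by auto
  moreover have "emeasure life (?B - ?C) = emeasure life ?B - emeasure life ?C"
    using C assms by (intro emeasure_Diff) (auto simp: sets_life intro!: planar_set)
  ultimately have "emeasure life {(t, s). a < t \<and> t \<le> x \<and> x < t + s \<and> t + s \<le> x + h} =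
      ennreal (1 - exp (a - x) - (exp (- h) - exp (a - x - h)))"
    using assms by (simp add: B C ennreal_minus)
  also have "\<dots> \<le> ennreal h"
  proof (rule ennreal_leI)
    have "1 - exp (a - x) - (exp (- h) - exp (a - x - h)) = (1 - exp (a - x)) * (1 - exp (- h))"
      by (simp add: algebra_simps flip: exp_add)
    also have "\<dots> \<le> 1 * (1 - exp (- h))" using assms by (intro mult_right_mono) auto
    also have "\<dots> \<le> h" using exp_ge_add_one_self[of "- h"] by simp
    finally show "1 - exp (a - x) - (exp (- h) - exp (a - x - h)) \<le> h" .
  qed
  finally show ?thesis .
qed

section \<open>Poisson counts of grid cells\<close>

lemma incompat_self: "g \<in> cycles \<Longrightarrow> incompat g g"
  by (simp add: cycles_def is_cycle_def incompat_def)

lemma incompat_commute: "incompat g h \<Longrightarrow> incompat h g"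
  by (auto simp: incompat_def)

locale ppp =
  fixes \<alpha> :: real and V :: "int^'d \<Rightarrow> ereal" and M :: "'w measure"
    and N :: "'w \<Rightarrow> ((int^'d \<Rightarrow> int^'d) \<times> real \<times> real) set"
  assumes is_ppp: "is_PPP M N (intensity \<alpha> V)"
begin

abbreviation w :: "(int^'d \<Rightarrow> int^'d) \<Rightarrow> real" where "w \<equiv> cweight \<alpha> V"
abbreviation \<nu> :: "((int^'d \<Rightarrow> int^'d) \<times> real \<times> real) measure" where "\<nu> \<equiv> intensity \<alpha> V"

sublocale prob_space M
  using is_ppp by (simp add: is_PPP_def)

lemma N_cycles: "\<omega> \<in> space M \<Longrightarrow> \<phi> \<in> N \<omega> \<Longrightarrow> fst \<phi> \<in> cycles"
proof -
  assume "\<omega> \<in> space M" "\<phi> \<in> N \<omega>"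
  then have "\<phi> \<in> space \<nu>" using is_ppp unfolding is_PPP_def by blast
  then show ?thesis by (cases \<phi>) (simp add: space_intensity)
qed

context
  fixes B assumes B: "B \<in> sets \<nu>" "emeasure \<nu> B < \<infinity>"
begin

lemma count_measurable: "(\<lambda>\<omega>. card (N \<omega> \<inter> B)) \<in> measurable M (count_space UNIV)"
  using is_ppp B by (simp add: is_PPP_def)

lemma count_finite: "AE \<omega> in M. finite (N \<omega> \<inter> B)"
  using is_ppp B by (simp add: is_PPP_def)

lemma count_distr:
  "prob {\<omega> \<in> space M. card (N \<omega> \<inter> B) = k} = enn2real (emeasure \<nu> B) ^ k / fact k * exp (- enn2real (emeasure \<nu> B))"
  using is_ppp B by (simp add: is_PPP_def)

lemma count_event: "{\<omega> \<in> space M. P (card (N \<omega> \<inter> B))} \<in> events"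
  using measurable_sets[OF count_measurable, of "Collect P"] by (simp add: vimage_def Int_def conj_commute)

lemma prob_count_ge_1: "prob {\<omega> \<in> space M. 1 \<le> card (N \<omega> \<inter> B)} = 1 - exp (- enn2real (emeasure \<nu> B))"
proof -
  have "{\<omega> \<in> space M. 1 \<le> card (N \<omega> \<inter> B)} = space M - {\<omega> \<in> space M. card (N \<omega> \<inter> B) = 0}" by auto
  then show ?thesis using prob_compl[OF count_event[of "\<lambda>x. x = 0"]] count_distr[of 0] by simp
qed

lemma prob_count_ge_1_le: "prob {\<omega> \<in> space M. 1 \<le> card (N \<omega> \<inter> B)} \<le> enn2real (emeasure \<nu> B)"
  unfolding prob_count_ge_1 using exp_ge_add_one_self[of "- enn2real (emeasure \<nu> B)"] by simp

lemma prob_count_ge_2_le: "prob {\<omega> \<in> space M. 2 \<le> card (N \<omega> \<inter> B)} \<le> (enn2real (emeasure \<nu> B))\<^sup>2"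
proof -
  define m where "m = enn2real (emeasure \<nu> B)"
  have m: "0 \<le> m" by (simp add: m_def)
  have eq: "{\<omega> \<in> space M. 2 \<le> card (N \<omega> \<inter> B)} = {\<omega> \<in> space M. 1 \<le> card (N \<omega> \<inter> B)} - {\<omega> \<in> space M. card (N \<omega> \<inter> B) = 1}"
    by auto
  have "prob {\<omega> \<in> space M. 2 \<le> card (N \<omega> \<inter> B)} = (1 - exp (- m)) - m * exp (- m)"
    unfolding eq using count_event[of "\<lambda>x. 1 \<le> x"] count_event[of "\<lambda>x. x = 1"] prob_count_ge_1 count_distr[of 1]
    by (subst finite_measure_Diff) (auto simp: m_def)
  also have "\<dots> \<le> m\<^sup>2"
  proof -
    have "(1 + m) * (1 - m) \<le> (1 + m) * exp (- m)"
      using m exp_ge_add_one_self[of "- m"] by (intro mult_left_mono) auto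
    then show ?thesis by (simp add: algebra_simps power2_eq_square)
  qed
  finally show ?thesis by (simp add: m_def)
qed

end

section \<open>Cell lifetimes as functions of Poisson counts\<close>

definition cell :: "real \<Rightarrow> real \<Rightarrow> (int^'d \<Rightarrow> int^'d) \<times> nat \<Rightarrow> nat \<Rightarrow> ((int^'d \<Rightarrow> int^'d) \<times> real \<times> real) set" where
  "cell a h c j = {fst c} \<times> {(t, s). a + real (snd c) * h - h < t \<and> t \<le> a + real (snd c) * h \<and> a + real j * h < t + s}"

text \<open>The longest lifetime in a cell, encoded as the number of grid times at which the cell is
  occupied. In this form it is a function of finitely many counts, the only quantities that
  \<open>is_PPP\<close> controls.\<close>

definition lt :: "real \<Rightarrow> real \<Rightarrow> nat \<Rightarrow> (int^'d \<Rightarrow> int^'d) \<times> nat \<Rightarrow> 'w \<Rightarrow> nat" where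
  "lt a h K c \<omega> = card {j \<in> {snd c..K}. 1 \<le> card (N \<omega> \<inter> cell a h c j)}"

lemma cell_sets: "fst c \<in> cycles \<Longrightarrow> cell a h c j \<in> sets \<nu>"
  unfolding cell_def by (intro rect_sets_intensity planar_set) auto

lemma cell_emeasure:
  assumes "fst c \<in> cycles" "0 \<le> h" "snd c \<le> j"
  shows "emeasure \<nu> (cell a h c j) = ennreal (w (fst c) * (1 - exp (- h)) * exp (- (real (j - snd c) * h)))"
proof -
  have le: "a + real (snd c) * h \<le> a + real j * h" using assms by (simp add: mult_right_mono)
  have "emeasure \<nu> (cell a h c j) = ennreal (sum w {fst c}) *
     emeasure life {(t, s). a + real (snd c) * h - h < t \<and> t \<le> a + real (snd c) * h \<and> a + real j * h < t + s}"
    unfolding cell_def using assms(1) by (intro emeasure_intensity planar_set) auto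
  also have "\<dots> = ennreal (w (fst c)) * ennreal (exp (a + real (snd c) * h - (a + real j * h)) - exp (a + real (snd c) * h - h - (a + real j * h)))"
    using assms le by (subst emeasure_life_tail) auto
  also have "exp (a + real (snd c) * h - (a + real j * h)) - exp (a + real (snd c) * h - h - (a + real j * h)) =
      (1 - exp (- h)) * exp (- (real (j - snd c) * h))"
    using assms by (simp add: of_nat_diff algebra_simps flip: exp_add)
  finally show ?thesis using assms(2) by (simp add: ennreal_mult[symmetric] cweight_nonneg mult.assoc)
qed

lemma cell_finite: "fst c \<in> cycles \<Longrightarrow> 0 \<le> h \<Longrightarrow> snd c \<le> j \<Longrightarrow> emeasure \<nu> (cell a h c j) < \<infinity>"
  by (simp add: cell_emeasure)

lemma cell_mono: "0 \<le> h \<Longrightarrow> j \<le> j' \<Longrightarrow> cell a h c j' \<subseteq> cell a h c j"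
proof -
  assume "0 \<le> h" "j \<le> j'"
  then have *: "a + real j * h \<le> a + real j' * h" by (simp add: mult_right_mono)
  have "a + real j * h < x" if "a + real j' * h < x" for x using le_less_trans[OF * that] .
  then show ?thesis unfolding cell_def by (intro Sigma_mono) auto
qed

text \<open>The cells shrink as \<open>j\<close> grows, so the occupied grid times form an initial
  segment of the range and their number locates its end. Finiteness is essential:
  \<open>card\<close> of an infinite set is 0, which would destroy the monotonicity.\<close>

lemma lt_iff:
  assumes fin: "finite (N \<omega> \<inter> cell a h c (snd c))" and h: "0 \<le> h" and j: "snd c \<le> j" "j \<le> K"
  shows "j < snd c + lt a h K c \<omega> \<longleftrightarrow> 1 \<le> card (N \<omega> \<inter> cell a h c j)"
proof -
  let ?S = "{j \<in> {snd c..K}. 1 \<le> card (N \<omega> \<inter> cell a h c j)}"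
  have fin': "finite (N \<omega> \<inter> cell a h c j)" if "snd c \<le> j" for j
    by (rule finite_subset[OF _ fin]) (use cell_mono[OF h that] in blast)
  have down: "j' \<in> ?S" if "j \<in> ?S" "snd c \<le> j'" "j' \<le> j" for j j'
  proof -
    have "card (N \<omega> \<inter> cell a h c j) \<le> card (N \<omega> \<inter> cell a h c j')"
      using cell_mono[OF h that(3), of a c] by (intro card_mono fin'[OF that(2)] Int_mono) auto
    then show ?thesis using that by auto
  qed
  show ?thesis
  proof
    assume "1 \<le> card (N \<omega> \<inter> cell a h c j)"
    then have "j \<in> ?S" using j by auto
    then have "{snd c..j} \<subseteq> ?S" using down by auto
    then have "card {snd c..j} \<le> card ?S" by (intro card_mono) auto
    then show "j < snd c + lt a h K c \<omega>" using j by (simp add: lt_def)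
  next
    assume *: "j < snd c + lt a h K c \<omega>"
    show "1 \<le> card (N \<omega> \<inter> cell a h c j)"
    proof (rule ccontr)
      assume n: "\<not> 1 \<le> card (N \<omega> \<inter> cell a h c j)"
      have "?S \<subseteq> {snd c..<j}"
      proof
        fix j' assume j': "j' \<in> ?S"
        then have "\<not> j \<le> j'" using down[OF j' j(1)] n by auto
        then show "j' \<in> {snd c..<j}" using j' by auto
      qed
      then have "card ?S \<le> card {snd c..<j}" by (intro card_mono) auto
      then show False using * j by (simp add: lt_def)
    qed
  qed
qed

lemma cell_disjoint:
  assumes "0 < h" "c \<noteq> c'" shows "cell a h c j \<inter> cell a h c' j' = {}"
proof (cases "fst c = fst c'")
  case True
  then have ne: "snd c \<noteq> snd c'" using assms(2) by (simp add: prod_eq_iff)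
  have *: "a + real i * h \<le> a + real i' * h - h" if "i < i'" for i i' :: nat
  proof -
    have "(real i + 1) * h \<le> real i' * h" using that assms(1) by (intro mult_right_mono) auto
    then show ?thesis by (simp add: algebra_simps)
  qed
  show ?thesis
  proof (cases "snd c < snd c'")
    case True
    then show ?thesis using *[of "snd c" "snd c'"] by (auto simp: cell_def)
  next
    case False
    then show ?thesis using *[of "snd c'" "snd c"] ne by (auto simp: cell_def)
  qed
qed (auto simp: cell_def)

lemma prob_all_alive:
  assumes J: "finite J" "J \<noteq> {}" "\<And>c. c \<in> J \<Longrightarrow> fst c \<in> cycles" "\<And>c. c \<in> J \<Longrightarrow> snd c \<le> j c" and h: "0 < h"
  shows "prob (\<Inter>c\<in>J. {\<omega> \<in> space M. 1 \<le> card (N \<omega> \<inter> cell a h c (j c))}) =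
    (\<Prod>c\<in>J. prob {\<omega> \<in> space M. 1 \<le> card (N \<omega> \<inter> cell a h c (j c))})"
proof -
  \<comment> \<open>Independence in \<open>is_PPP\<close> is stated for families indexed by natural
    numbers, so the cells are enumerated.\<close>
  obtain e where e: "bij_betw e {0..<card J} J" using ex_bij_betw_nat_finite[OF J(1)] by blast
  define B where "B n = cell a h (e n) (j (e n))" for n
  have eJ: "e n \<in> J" if "n \<in> {0..<card J}" for n using e that by (auto simp: bij_betw_def)
  have "disjoint_family_on B {0..<card J}"
    unfolding disjoint_family_on_def B_def using e cell_disjoint[OF h]
    by (metis bij_betw_imp_inj_on inj_onD)
  moreover have "B n \<in> sets \<nu> \<and> emeasure \<nu> (B n) < \<infinity>" if "n \<in> {0..<card J}" for n
    unfolding B_def using J(3,4)[OF eJ[OF that]] h by (intro conjI cell_sets cell_finite) auto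
  ultimately have ind: "indep_vars (\<lambda>_. count_space UNIV) (\<lambda>n \<omega>. card (N \<omega> \<inter> B n)) {0..<card J}"
    using is_ppp unfolding is_PPP_def by blast
  have ne: "{0..<card J} \<noteq> {}" using J(1,2) by (simp add: card_gt_0_iff)
  have A: "(\<lambda>\<omega>. card (N \<omega> \<inter> B n)) -` {1..} \<inter> space M = {\<omega> \<in> space M. 1 \<le> card (N \<omega> \<inter> B n)}" for n by auto
  have "prob (\<Inter>n\<in>{0..<card J}. (\<lambda>\<omega>. card (N \<omega> \<inter> B n)) -` {1..} \<inter> space M) =
      (\<Prod>n\<in>{0..<card J}. prob ((\<lambda>\<omega>. card (N \<omega> \<inter> B n)) -` {1..} \<inter> space M))"
    by (rule indep_varsD[OF ind ne]) auto
  then have "prob (\<Inter>n\<in>{0..<card J}. {\<omega> \<in> space M. 1 \<le> card (N \<omega> \<inter> cell a h (e n) (j (e n)))}) =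
      (\<Prod>n\<in>{0..<card J}. prob {\<omega> \<in> space M. 1 \<le> card (N \<omega> \<inter> cell a h (e n) (j (e n)))})"
    unfolding A unfolding B_def .
  moreover have "(\<Inter>n\<in>{0..<card J}. {\<omega> \<in> space M. 1 \<le> card (N \<omega> \<inter> cell a h (e n) (j (e n)))}) =
      (\<Inter>c\<in>e ` {0..<card J}. {\<omega> \<in> space M. 1 \<le> card (N \<omega> \<inter> cell a h c (j c))})" by simp
  moreover have "e ` {0..<card J} = J" using e by (simp add: bij_betw_def)
  moreover have "(\<Prod>n\<in>{0..<card J}. prob {\<omega> \<in> space M. 1 \<le> card (N \<omega> \<inter> cell a h (e n) (j (e n)))}) =
      (\<Prod>c\<in>J. prob {\<omega> \<in> space M. 1 \<le> card (N \<omega> \<inter> cell a h c (j c))})"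
    by (rule prod.reindex_bij_betw[OF e])
  ultimately show ?thesis by simp
qed

lemma lt_measurable:
  assumes "fst c \<in> cycles" "0 \<le> h"
  shows "lt a h K c \<in> measurable M (count_space UNIV)"
proof -
  have "lt a h K c = (\<lambda>\<omega>. \<Sum>j\<in>{snd c..K}. if 1 \<le> card (N \<omega> \<inter> cell a h c j) then 1 else 0)"
  proof
    fix \<omega>
    have "lt a h K c \<omega> = sum (\<lambda>_. 1) {j \<in> {snd c..K}. 1 \<le> card (N \<omega> \<inter> cell a h c j)}" by (simp add: lt_def)
    also have "\<dots> = (\<Sum>j\<in>{snd c..K}. if 1 \<le> card (N \<omega> \<inter> cell a h c j) then 1 else 0)"
      by (rule sum.inter_filter) simp
    finally show "lt a h K c \<omega> = (\<Sum>j\<in>{snd c..K}. if 1 \<le> card (N \<omega> \<inter> cell a h c j) then 1 else 0)" .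
  qed
  moreover have "(\<lambda>\<omega>. \<Sum>j\<in>{snd c..K}. if 1 \<le> card (N \<omega> \<inter> cell a h c j) then 1 else (0::nat)) \<in> measurable M (count_space UNIV)"
  proof (rule measurable_sum_nat)
    fix j assume "j \<in> {snd c..K}"
    then have "(\<lambda>\<omega>. card (N \<omega> \<inter> cell a h c j)) \<in> measurable M (count_space UNIV)"
      using assms by (intro count_measurable cell_sets cell_finite) auto
    then show "(\<lambda>\<omega>. if 1 \<le> card (N \<omega> \<inter> cell a h c j) then 1 else (0::nat)) \<in> measurable M (count_space UNIV)"
      by (rule measurable_compose) simp
  qed
  ultimately show ?thesis by simp
qed

section \<open>Independence of the cell lifetimes\<close>

context
  fixes G :: "(int^'d \<Rightarrow> int^'d) set"
  assumes G: "finite G" "G \<subseteq> cycles" and w_pos: "\<forall>g\<in>G. 0 < w g"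
begin

lemma hardcore_G: "hardcore G w incompat"
  using G w_pos incompat_self incompat_commute by unfold_locales auto

context
  fixes a h :: real and K :: nat
  assumes h: "0 < h" "h \<le> 1"
begin

lemma AE_lt_iff:
  "AE \<omega> in M. \<forall>c\<in>G \<times> {1..K}. \<forall>j. snd c \<le> j \<longrightarrow> j \<le> K \<longrightarrow>
     (j < snd c + lt a h K c \<omega> \<longleftrightarrow> 1 \<le> card (N \<omega> \<inter> cell a h c j))"
proof -
  have "AE \<omega> in M. \<forall>c\<in>G \<times> {1..K}. finite (N \<omega> \<inter> cell a h c (snd c))"
    using G h by (subst AE_ball_countable) (auto intro!: count_finite cell_sets cell_finite countable_finite)
  then show ?thesis
    by eventually_elim (use h lt_iff in auto)
qed

text \<open>Off by one: the first counted grid time is \<open>snd c\<close> itself, so the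
  \<open>m\<close>-th is \<open>snd c + m - 1\<close>.\<close>

lemma prob_lt_ge:
  assumes c: "c \<in> G \<times> {1..K}" and m: "1 \<le> m" "m \<le> Suc K - snd c"
  shows "AE \<omega> in M. m \<le> lt a h K c \<omega> \<longleftrightarrow> 1 \<le> card (N \<omega> \<inter> cell a h c (snd c + m - 1))"
  using AE_lt_iff
proof eventually_elim
  case (elim \<omega>)
  have "snd c + m - 1 < snd c + lt a h K c \<omega> \<longleftrightarrow> 1 \<le> card (N \<omega> \<inter> cell a h c (snd c + m - 1))"
    using elim[rule_format, OF c, of "snd c + m - 1"] m c by auto
  moreover have "snd c + m - 1 < snd c + lt a h K c \<omega> \<longleftrightarrow> m \<le> lt a h K c \<omega>" using m by auto
  ultimately show ?case by simp
qed

lemma lt_event: "c \<in> G \<times> {1..K} \<Longrightarrow> {\<omega> \<in> space M. P (lt a h K c \<omega>)} \<in> events"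
  using measurable_sets[OF lt_measurable[of c h a K], of "Collect P"] G h
  by (auto simp: vimage_def Int_def conj_commute)

lemma cell_event:
  "c \<in> G \<times> {1..K} \<Longrightarrow> snd c \<le> j \<Longrightarrow> {\<omega> \<in> space M. P (card (N \<omega> \<inter> cell a h c j))} \<in> events"
  using G h by (intro count_event cell_sets cell_finite) auto

text \<open>Counts of nested cells are dependent, so independence of the raw counts cannot be quoted
  directly. The events \<open>m \<le> lt\<close> are stable under intersection and generate the
  lifetime of a cell; choosing one of them for each \<open>c\<close> selects pairwise disjoint
  cells, for which the probabilities multiply, and the passage to generated sigma-algebras does the
  rest.\<close>

lemma indep_lt: "indep_vars (\<lambda>_. count_space UNIV) (lt a h K) (G \<times> {1..K})"
proof -
  let ?I = "G \<times> {1..K}"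
  define F where "F c = {{\<omega> \<in> space M. m \<le> lt a h K c \<omega>} | m. 1 \<le> m \<and> m \<le> Suc K - snd c}" for c :: "(int^'d \<Rightarrow> int^'d) \<times> nat"
  have "indep_sets F ?I"
  proof (rule indep_setsI)
    show "F c \<subseteq> events" if "c \<in> ?I" for c using lt_event[OF that] by (auto simp: F_def)
    fix A J assume J: "J \<noteq> {}" "J \<subseteq> ?I" "finite J" "\<forall>c\<in>J. A c \<in> F c"
    then have "\<forall>c\<in>J. \<exists>m. A c = {\<omega> \<in> space M. m \<le> lt a h K c \<omega>} \<and> 1 \<le> m \<and> m \<le> Suc K - snd c"
      by (auto simp: F_def)
    from bchoice[OF this] obtain m where m': "\<forall>c\<in>J. A c = {\<omega> \<in> space M. m c \<le> lt a h K c \<omega>} \<and> 1 \<le> m c \<and> m c \<le> Suc K - snd c"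
      by blast
    then have m: "\<And>c. c \<in> J \<Longrightarrow> A c = {\<omega> \<in> space M. m c \<le> lt a h K c \<omega>}"
      "\<And>c. c \<in> J \<Longrightarrow> 1 \<le> m c" "\<And>c. c \<in> J \<Longrightarrow> m c \<le> Suc K - snd c" by blast+
    let ?E = "\<lambda>c. {\<omega> \<in> space M. 1 \<le> card (N \<omega> \<inter> cell a h c (snd c + m c - 1))}"
    have Ev: "A c \<in> events" "?E c \<in> events" if "c \<in> J" for c
    proof -
      have cI: "c \<in> ?I" using that J(2) by blast
      show "A c \<in> events" unfolding m(1)[OF that] by (rule lt_event[OF cI])
      show "?E c \<in> events" by (rule cell_event[OF cI]) (use m(2)[OF that] in simp)
    qed
    have ae: "AE \<omega> in M. \<forall>c\<in>J. m c \<le> lt a h K c \<omega> \<longleftrightarrow> 1 \<le> card (N \<omega> \<inter> cell a h c (snd c + m c - 1))"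
      unfolding AE_ball_countable[OF countable_finite[OF J(3)]]
    proof
      fix c assume c: "c \<in> J"
      show "AE \<omega> in M. m c \<le> lt a h K c \<omega> \<longleftrightarrow> 1 \<le> card (N \<omega> \<inter> cell a h c (snd c + m c - 1))"
        by (rule prob_lt_ge[OF _ m(2,3)[OF c]]) (use c J(2) in blast)
    qed
    have "prob (\<Inter>c\<in>J. A c) = prob (\<Inter>c\<in>J. ?E c)"
    proof (rule finite_measure_eq_AE)
      show "AE \<omega> in M. \<omega> \<in> (\<Inter>c\<in>J. A c) \<longleftrightarrow> \<omega> \<in> (\<Inter>c\<in>J. ?E c)"
        using ae by eventually_elim (use m(1) in auto)
    qed (use Ev J in \<open>auto intro!: sets.finite_INT\<close>)
    also have "\<dots> = (\<Prod>c\<in>J. prob (?E c))"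
      by (rule prob_all_alive[OF J(3,1) _ _ h(1)]) (use J(2) G h in auto, use m(2) in fastforce)
    also have "\<dots> = (\<Prod>c\<in>J. prob (A c))"
    proof (rule prod.cong[OF refl], rule finite_measure_eq_AE)
      fix c assume c: "c \<in> J"
      show "AE \<omega> in M. \<omega> \<in> ?E c \<longleftrightarrow> \<omega> \<in> A c"
        using ae by eventually_elim (use m(1) c in auto)
    qed (use Ev in auto)
    finally show "prob (\<Inter>c\<in>J. A c) = (\<Prod>c\<in>J. prob (A c))" .
  qed
  moreover have "Int_stable (F c)" for c
  proof (rule Int_stableI)
    fix A B assume "A \<in> F c" "B \<in> F c"
    then obtain m m' where "A = {\<omega> \<in> space M. m \<le> lt a h K c \<omega>}" "B = {\<omega> \<in> space M. m' \<le> lt a h K c \<omega>}"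
      "1 \<le> m" "m \<le> Suc K - snd c" "1 \<le> m'" "m' \<le> Suc K - snd c" by (auto simp: F_def)
    then have "A \<inter> B = {\<omega> \<in> space M. max m m' \<le> lt a h K c \<omega>}" "1 \<le> max m m'" "max m m' \<le> Suc K - snd c" by auto
    then show "A \<inter> B \<in> F c" unfolding F_def by blast
  qed
  ultimately have sig: "indep_sets (\<lambda>c. sigma_sets (space M) (F c)) ?I"
    by (intro indep_sets_sigma) auto
  \<comment> \<open>Lifetimes are bounded by \<open>Suc K - snd c\<close>, so every preimage is a
    finite union of differences of tail events; the tails outside the indexed range are the whole
    space or empty.\<close>
  have gen: "lt a h K c -` A \<inter> space M \<in> sigma_sets (space M) (F c)" if c: "c \<in> ?I" for A c
  proof -
    have sp: "F c \<subseteq> Pow (space M)" by (auto simp: F_def)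
    interpret S: sigma_algebra "space M" "sigma_sets (space M) (F c)"
      by (rule sigma_algebra_sigma_sets[OF sp])
    have bound: "lt a h K c \<omega> \<le> Suc K - snd c" for \<omega>
    proof -
      have "lt a h K c \<omega> \<le> card {snd c..K}" unfolding lt_def by (intro card_mono) auto
      then show ?thesis by simp
    qed
    have ge: "{\<omega> \<in> space M. m \<le> lt a h K c \<omega>} \<in> sigma_sets (space M) (F c)" for m
    proof -
      consider "m = 0" | "1 \<le> m \<and> m \<le> Suc K - snd c" | "Suc K - snd c < m" by linarith
      then show ?thesis
      proof cases
        case 1
        then show ?thesis using S.top by simp
      next
        case 2
        then have "{\<omega> \<in> space M. m \<le> lt a h K c \<omega>} \<in> F c" by (auto simp: F_def)
        then show ?thesis by (rule sigma_sets.Basic)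
      next
        case 3
        then have eq: "{\<omega> \<in> space M. m \<le> lt a h K c \<omega>} = {}" using bound by (auto simp: not_le intro: le_less_trans)
        show ?thesis unfolding eq by (rule sigma_sets.Empty)
      qed
    qed
    have "lt a h K c -` A \<inter> space M =
        (\<Union>v\<in>A \<inter> {..Suc K - snd c}. {\<omega> \<in> space M. v \<le> lt a h K c \<omega>} - {\<omega> \<in> space M. Suc v \<le> lt a h K c \<omega>})"
      using bound by (auto simp: not_less_eq_eq)
    also have "\<dots> \<in> sigma_sets (space M) (F c)"
      using ge by (intro S.finite_UN S.Diff) auto
    finally show ?thesis .
  qed
  show ?thesis
    unfolding indep_vars_def2
  proof
    show "\<forall>c\<in>?I. random_variable (count_space UNIV) (lt a h K c)"
      using G h by (auto intro!: lt_measurable)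
    show "indep_sets (\<lambda>c. {lt a h K c -` A \<inter> space M | A. A \<in> sets (count_space UNIV)}) ?I"
      by (rule indep_sets_mono_sets[OF sig]) (use gen in auto)
  qed
qed

lemma grid_lifetimes_lt: "grid_lifetimes G w incompat M (lt a h K) h K"
proof -
  interpret hardcore G w incompat by (rule hardcore_G)
  show ?thesis
  proof unfold_locales
    show "0 < h" "h \<le> 1" by (fact h)+
    show "indep_vars (\<lambda>_. count_space UNIV) (lt a h K) (G \<times> {1..K})" by (rule indep_lt)
    fix g i j assume g: "g \<in> G" and i: "1 \<le> i" "i \<le> j" "j \<le> K"
    have gi: "(g, i) \<in> G \<times> {1..K}" using g i by auto
    have "prob {\<omega> \<in> space M. j < i + lt a h K (g, i) \<omega>} = prob {\<omega> \<in> space M. 1 \<le> card (N \<omega> \<inter> cell a h (g, i) j)}"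
    proof (rule finite_measure_eq_AE)
      show "AE \<omega> in M. \<omega> \<in> {\<omega> \<in> space M. j < i + lt a h K (g, i) \<omega>} \<longleftrightarrow> \<omega> \<in> {\<omega> \<in> space M. 1 \<le> card (N \<omega> \<inter> cell a h (g, i) j)}"
        using AE_lt_iff by eventually_elim (use gi i in force)
      show "{\<omega> \<in> space M. j < i + lt a h K (g, i) \<omega>} \<in> events" by (rule lt_event[OF gi])
      show "{\<omega> \<in> space M. 1 \<le> card (N \<omega> \<inter> cell a h (g, i) j)} \<in> events" by (rule cell_event[OF gi]) (use i in auto)
    qed
    also have "\<dots> = 1 - exp (- (w g * (1 - exp (- h)) * exp (- (real (j - i) * h))))"
    proof -
      have gc: "fst (g, i) \<in> cycles" using g G by auto
      have "0 \<le> w g * (1 - exp (- h)) * exp (- (real (j - i) * h))" using cweight_nonneg[of \<alpha> V g] h by simp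
      then show ?thesis
        using prob_count_ge_1[OF cell_sets[OF gc] cell_finite[OF gc], of h j a] cell_emeasure[OF gc, of h j a] h i by simp
    qed
    finally show "prob {\<omega> \<in> space M. j < i + lt a h K (g, i) \<omega>} = 1 - exp (- (w g * (1 - exp (- h)) * exp (- (real (j - i) * h))))" .
  qed
qed

section \<open>The exceptional event of a grid\<close>

definition births :: "((int^'d \<Rightarrow> int^'d) \<times> real \<times> real) set" where
  "births = G \<times> {(t, s). a < t \<and> t \<le> a + real K * h \<and> 0 < s}"

text \<open>Points that are born in the \<open>k\<close>-th interval, or that were born earlier in
  the window and die in it. The redundant \<open>- h + h\<close> matches the form of
  \<open>emeasure_life_die_after\<close> at the left endpoint of the interval.\<close>

definition jumps :: "nat \<Rightarrow> ((int^'d \<Rightarrow> int^'d) \<times> real \<times> real) set" where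
  "jumps k = G \<times> ({(t, s). a + real k * h - h < t \<and> t \<le> a + real k * h \<and> 0 < s} \<union>
     {(t, s). a < t \<and> t \<le> a + real k * h - h \<and> a + real k * h - h < t + s \<and> t + s \<le> a + real k * h - h + h})"

text \<open>Points invisible at the grid times, since they are born and dead within one
  interval.\<close>

definition ephemeral :: "nat \<Rightarrow> ((int^'d \<Rightarrow> int^'d) \<times> real \<times> real) set" where
  "ephemeral k = G \<times> {(t, s). a + real k * h - h < t \<and> t \<le> a + real k * h \<and> 0 < s \<and> t + s \<le> a + real k * h}"

definition bad :: "'w set" where
  "bad = (\<Union>k\<in>{1..K}. {\<omega> \<in> space M. 2 \<le> card (N \<omega> \<inter> jumps k)} \<union> {\<omega> \<in> space M. 1 \<le> card (N \<omega> \<inter> ephemeral k)})"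

definition W :: real where "W = sum w G"

lemma W_nonneg: "0 \<le> W"
  unfolding W_def by (intro sum_nonneg cweight_nonneg)

lemma births_props: "births \<in> sets \<nu>" "emeasure \<nu> births < \<infinity>"
proof -
  have A: "{(t, s). a < t \<and> t \<le> a + real K * h \<and> (0::real) < s} \<in> sets (borel \<Otimes>\<^sub>M borel)"
    by (rule planar_set) measurable
  show "births \<in> sets \<nu>" unfolding births_def by (rule rect_sets_intensity[OF G(2) A])
  have "emeasure life {(t, s). a < t \<and> t \<le> a + real K * h \<and> 0 < s} = ennreal (a + real K * h - a)"
    using h by (intro emeasure_life_births) simp
  then show "emeasure \<nu> births < \<infinity>"
    unfolding births_def emeasure_intensity[OF G A] by (simp add: ennreal_mult_less_top)
qed

lemma jumps_props:
  assumes "1 \<le> k"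
  shows "jumps k \<in> sets \<nu>" "emeasure \<nu> (jumps k) \<le> ennreal (2 * W * h)"
proof -
  let ?A = "{(t, s). a + real k * h - h < t \<and> t \<le> a + real k * h \<and> (0::real) < s}"
  let ?B = "{(t, s). a < t \<and> t \<le> a + real k * h - h \<and> a + real k * h - h < t + s \<and> t + s \<le> a + real k * h - h + h}"
  have A: "?A \<in> sets (borel \<Otimes>\<^sub>M borel)" by (rule planar_set) measurable
  have B: "?B \<in> sets (borel \<Otimes>\<^sub>M borel)" by (rule planar_set) measurable
  have AB: "?A \<union> ?B \<in> sets (borel \<Otimes>\<^sub>M borel)" using A B by auto
  show "jumps k \<in> sets \<nu>" unfolding jumps_def by (rule rect_sets_intensity[OF G(2) AB])
  have hk: "h \<le> real k * h" using assms h by simp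
  have "emeasure life (?A \<union> ?B) \<le> emeasure life ?A + emeasure life ?B"
    using A B by (intro emeasure_subadditive) (auto simp: sets_life)
  also have "\<dots> \<le> ennreal h + ennreal h"
  proof (rule add_mono)
    show "emeasure life ?A \<le> ennreal h"
      using emeasure_life_births[of "a + real k * h - h" "a + real k * h"] h by simp
    show "emeasure life ?B \<le> ennreal h"
      by (rule emeasure_life_die_after) (use h hk in auto)
  qed
  also have "\<dots> = ennreal (2 * h)" using h by (simp flip: ennreal_plus)
  finally have "ennreal W * emeasure life (?A \<union> ?B) \<le> ennreal W * ennreal (2 * h)" by (rule mult_left_mono) simp
  also have "\<dots> = ennreal (2 * W * h)" using W_nonneg h by (simp add: ennreal_mult[symmetric] mult_ac)
  finally show "emeasure \<nu> (jumps k) \<le> ennreal (2 * W * h)"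
    unfolding jumps_def emeasure_intensity[OF G AB] W_def .
qed

lemma ephemeral_props:
  shows "ephemeral k \<in> sets \<nu>" "emeasure \<nu> (ephemeral k) \<le> ennreal (W * h\<^sup>2)"
proof -
  let ?A = "{(t, s). a + real k * h - h < t \<and> t \<le> a + real k * h \<and> 0 < s \<and> t + s \<le> a + real k * h}"
  have A: "?A \<in> sets (borel \<Otimes>\<^sub>M borel)" by (rule planar_set) measurable
  show "ephemeral k \<in> sets \<nu>" unfolding ephemeral_def by (rule rect_sets_intensity[OF G(2) A])
  have "emeasure life ?A \<le> ennreal (h\<^sup>2)" by (rule emeasure_life_die_within) (use h in auto)
  then have "ennreal W * emeasure life ?A \<le> ennreal W * ennreal (h\<^sup>2)" by (rule mult_left_mono) simp
  also have "\<dots> = ennreal (W * h\<^sup>2)" using W_nonneg by (simp add: ennreal_mult)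
  finally show "emeasure \<nu> (ephemeral k) \<le> ennreal (W * h\<^sup>2)"
    unfolding ephemeral_def emeasure_intensity[OF G A] W_def .
qed

text \<open>Each interval contributes order h^2: two jumps cost the square of a mean of at most 2 W
  h, an ephemeral point costs at most W h^2. With \<open>K * h\<close> fixed the total is of order
  h.\<close>

lemma bad_event: "bad \<in> events"
  and prob_bad: "prob bad \<le> real K * ((4 * W\<^sup>2 + W) * h\<^sup>2)"
proof -
  let ?E = "\<lambda>k. {\<omega> \<in> space M. 2 \<le> card (N \<omega> \<inter> jumps k)} \<union> {\<omega> \<in> space M. 1 \<le> card (N \<omega> \<inter> ephemeral k)}"
  have E: "?E k \<in> events \<and> prob (?E k) \<le> (4 * W\<^sup>2 + W) * h\<^sup>2" if "k \<in> {1..K}" for k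
  proof -
    have k: "1 \<le> k" using that by simp
    note j = jumps_props[OF k] and e = ephemeral_props[of k]
    have jf: "emeasure \<nu> (jumps k) < \<infinity>" and ef: "emeasure \<nu> (ephemeral k) < \<infinity>"
      using j(2) e(2) by (auto intro: le_less_trans)
    have jm: "enn2real (emeasure \<nu> (jumps k)) \<le> 2 * W * h"
      using enn2real_mono[OF j(2)] W_nonneg h by simp
    have em: "enn2real (emeasure \<nu> (ephemeral k)) \<le> W * h\<^sup>2"
      using enn2real_mono[OF e(2)] W_nonneg by simp
    have ev: "{\<omega> \<in> space M. 2 \<le> card (N \<omega> \<inter> jumps k)} \<in> events" "{\<omega> \<in> space M. 1 \<le> card (N \<omega> \<inter> ephemeral k)} \<in> events"
      by (rule count_event[OF j(1) jf], rule count_event[OF e(1) ef])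
    have "prob (?E k) \<le> prob {\<omega> \<in> space M. 2 \<le> card (N \<omega> \<inter> jumps k)} + prob {\<omega> \<in> space M. 1 \<le> card (N \<omega> \<inter> ephemeral k)}"
      using ev by (rule measure_Un_le)
    also have "\<dots> \<le> (2 * W * h)\<^sup>2 + W * h\<^sup>2"
    proof (rule add_mono)
      show "prob {\<omega> \<in> space M. 2 \<le> card (N \<omega> \<inter> jumps k)} \<le> (2 * W * h)\<^sup>2"
        using prob_count_ge_2_le[OF j(1) jf] power_mono[OF jm, of 2] by simp
      show "prob {\<omega> \<in> space M. 1 \<le> card (N \<omega> \<inter> ephemeral k)} \<le> W * h\<^sup>2"
        using prob_count_ge_1_le[OF e(1) ef] em by simp
    qed
    also have "\<dots> = (4 * W\<^sup>2 + W) * h\<^sup>2" by (simp add: algebra_simps power2_eq_square)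
    finally show ?thesis using ev by auto
  qed
  show "bad \<in> events" unfolding bad_def using E by (intro sets.finite_UN) auto
  have "prob bad \<le> (\<Sum>k\<in>{1..K}. prob (?E k))"
    unfolding bad_def using E by (intro finite_measure_subadditive_finite) auto
  also have "\<dots> \<le> real (card {1..K}) * ((4 * W\<^sup>2 + W) * h\<^sup>2)"
    using E by (intro sum_bounded_above) auto
  finally show "prob bad \<le> real K * ((4 * W\<^sup>2 + W) * h\<^sup>2)" by simp
qed

lemma births_finite: "AE \<omega> in M. finite (N \<omega> \<inter> births)"
  by (rule count_finite[OF births_props])

lemma grid_coupling_N:
  assumes \<omega>: "\<omega> \<in> space M" "\<omega> \<notin> bad" and fin: "finite (N \<omega> \<inter> births)"
  shows "grid_coupling G w (N \<omega> \<inter> births) a h K (\<lambda>c. lt a h K c \<omega>)"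
proof -
  interpret hardcore G w incompat by (rule hardcore_G)
  have gt: "a + real k * h \<le> a + real K * h" "a \<le> a + real k * h - h" if "1 \<le> k" "k \<le> K" for k
  proof -
    show "a + real k * h \<le> a + real K * h" using that h by simp
    have "1 * h \<le> real k * h" using that h by (intro mult_right_mono) auto
    then show "a \<le> a + real k * h - h" by simp
  qed
  have aux: "G \<times> ({(t, s). X - h < t \<and> t \<le> X \<and> 0 < s} \<union> {(t, s). a < t \<and> t \<le> X - h \<and> X - h < t + s \<and> t + s \<le> X - h + h})
        \<subseteq> G \<times> {(t, s). a < t \<and> t \<le> b \<and> 0 < s}"
      "G \<times> {(t, s). X - h < t \<and> t \<le> X \<and> 0 < s \<and> t + s \<le> X} \<subseteq> G \<times> {(t, s). a < t \<and> t \<le> b \<and> 0 < s}"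
    if "X \<le> b" "a \<le> X - h" for X b
    using that h by auto
  have jsub: "jumps k \<subseteq> births" and esub: "ephemeral k \<subseteq> births" if "1 \<le> k" "k \<le> K" for k
    unfolding jumps_def ephemeral_def births_def using gt[OF that] by - (rule aux; assumption)+
  show ?thesis
  proof unfold_locales
    show "0 < h" by (rule h)
    show "finite (N \<omega> \<inter> births)" by fact
    show "fst \<phi> \<in> G" "a < birth \<phi>" "birth \<phi> \<le> a + real K * h" if "\<phi> \<in> N \<omega> \<inter> births" for \<phi>
      using that by (auto simp: births_def)
    show "a + real k * h < death \<phi>"
      if \<phi>: "\<phi> \<in> N \<omega> \<inter> births" "1 \<le> k" "k \<le> K" "birth \<phi> \<in> {a + real k * h - h<..a + real k * h}" for \<phi> k
    proof (rule ccontr)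
      assume "\<not> a + real k * h < death \<phi>"
      then have "\<phi> \<in> N \<omega> \<inter> ephemeral k" using \<phi> by (auto simp: births_def ephemeral_def)
      moreover have "finite (N \<omega> \<inter> ephemeral k)" by (rule finite_subset[OF _ fin]) (use esub[OF \<phi>(2,3)] in blast)
      ultimately have "1 \<le> card (N \<omega> \<inter> ephemeral k)" by (metis card_0_eq empty_iff not_less_eq_eq One_nat_def le_0_eq)
      then show False using \<omega> \<phi> by (auto simp: bad_def)
    qed
    show "\<phi> = \<psi>"
      if k: "1 \<le> k" "k \<le> K" and
        \<phi>: "\<phi> \<in> {\<theta> \<in> N \<omega> \<inter> births. birth \<theta> \<in> {a + real k * h - h<..a + real k * h} \<or>
          birth \<theta> \<le> a + real k * h - h \<and> death \<theta> \<in> {a + real k * h - h<..a + real k * h}}" and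
        \<psi>: "\<psi> \<in> {\<theta> \<in> N \<omega> \<inter> births. birth \<theta> \<in> {a + real k * h - h<..a + real k * h} \<or>
          birth \<theta> \<le> a + real k * h - h \<and> death \<theta> \<in> {a + real k * h - h<..a + real k * h}}" for \<phi> \<psi> k
    proof -
      have in_j: "\<phi> \<in> N \<omega> \<inter> jumps k" "\<psi> \<in> N \<omega> \<inter> jumps k"
        using \<phi> \<psi> by (auto simp: births_def jumps_def)
      have "finite (N \<omega> \<inter> jumps k)" by (rule finite_subset[OF _ fin]) (use jsub[OF k] in blast)
      moreover have "card (N \<omega> \<inter> jumps k) \<le> Suc 0" using \<omega> k by (force simp: bad_def not_le numeral_2_eq_2 less_Suc_eq_le)
      ultimately show ?thesis using in_j by (simp add: card_le_Suc0_iff_eq)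
    qed
    fix g i j assume g: "g \<in> G" and i: "1 \<le> i" "i \<le> j" "j \<le> K"
    have ij: "a + real i * h \<le> a + real j * h" using i h by simp
    have iK: "i \<le> K" using i by simp
    have cb: "cell a h (g, i) j' \<subseteq> births" if "i \<le> j'" for j'
    proof -
      have "a + real i * h \<le> a + real j' * h" using that h by simp
      moreover have "{g} \<times> {(t, s). x - h < t \<and> t \<le> x \<and> y < t + s} \<subseteq> G \<times> {(t, s). a < t \<and> t \<le> b \<and> 0 < s}"
        if "x \<le> y" "x \<le> b" "a \<le> x - h" for x y b
        using that g by auto
      ultimately show ?thesis using gt[OF i(1) iK] unfolding cell_def births_def fst_conv snd_conv by blast
    qed
    have "finite (N \<omega> \<inter> cell a h (g, i) i)" by (rule finite_subset[OF _ fin]) (use cb[of i] in blast)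
    then have "j < i + lt a h K (g, i) \<omega> \<longleftrightarrow> 1 \<le> card (N \<omega> \<inter> cell a h (g, i) j)"
      using lt_iff[of \<omega> a h "(g, i)" j K] h i by simp
    also have "\<dots> \<longleftrightarrow> N \<omega> \<inter> cell a h (g, i) j \<noteq> {}"
    proof -
      have "finite (N \<omega> \<inter> cell a h (g, i) j)" by (rule finite_subset[OF _ fin]) (use cb[OF i(2)] in blast)
      then show ?thesis by (simp add: Suc_le_eq card_gt_0_iff)
    qed
    also have "\<dots> \<longleftrightarrow> (\<exists>\<phi>\<in>N \<omega> \<inter> births. fst \<phi> = g \<and> birth \<phi> \<in> {a + real i * h - h<..a + real i * h} \<and> a + real j * h < death \<phi>)"
    proof -
      have "\<phi> \<in> cell a h (g, i) j \<longleftrightarrow> fst \<phi> = g \<and> birth \<phi> \<in> {a + real i * h - h<..a + real i * h} \<and> a + real j * h < death \<phi>" for \<phi>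
        by (cases \<phi>) (auto simp: cell_def)
      then show ?thesis using cb[OF i(2)] by blast
    qed
    finally show "j < i + lt a h K (g, i) \<omega> \<longleftrightarrow>
      (\<exists>\<phi>\<in>N \<omega> \<inter> births. fst \<phi> = g \<and> birth \<phi> \<in> {a + real i * h - h<..a + real i * h} \<and> a + real j * h < death \<phi>)" .
  qed
qed

end

end

end

section \<open>Refining the grid\<close>

text \<open>\<open>B\<close> differs from the limit inferior of the events by a null set, so
  completeness makes it an event; the probabilities converge by dominated convergence of the
  indicators. In this way events about \<open>eta\<close> become measurable although nothing is
  known about \<open>N\<close> beyond its counts.\<close>

lemma (in complete_measure) AE_eventually_event:
  assumes fin: "finite_measure M" and A: "\<And>m :: nat. A m \<in> sets M" and B: "B \<subseteq> space M"
    and ev: "AE \<omega> in M. \<forall>\<^sub>F m in sequentially. \<omega> \<in> A m \<longleftrightarrow> \<omega> \<in> B"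
  shows "B \<in> sets M" "(\<lambda>m. measure M (A m)) \<longlonglongrightarrow> measure M B"
proof -
  interpret finite_measure M by fact
  have "AE \<omega> in M. \<omega> \<in> (\<Union>k. \<Inter>m\<in>{k..}. A m) \<longleftrightarrow> \<omega> \<in> B"
    using ev
  proof eventually_elim
    case (elim \<omega>)
    then obtain k where k: "\<And>m. k \<le> m \<Longrightarrow> \<omega> \<in> A m \<longleftrightarrow> \<omega> \<in> B" by (auto simp: eventually_sequentially)
    show ?case
    proof
      assume "\<omega> \<in> (\<Union>k. \<Inter>m\<in>{k..}. A m)"
      then obtain k' where "\<And>m. k' \<le> m \<Longrightarrow> \<omega> \<in> A m" by auto
      then show "\<omega> \<in> B" using k[of "max k k'"] by auto
    qed (use k in auto)
  qed
  moreover have "(\<Union>k. \<Inter>m\<in>{k..}. A m) \<in> sets M" using A by (intro sets.countable_UN sets.countable_INT) auto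
  ultimately show BM: "B \<in> sets M" using B by (rule in_sets_AE)
  have "(\<lambda>m. \<integral>\<omega>. indicat_real (A m) \<omega> \<partial>M) \<longlonglongrightarrow> (\<integral>\<omega>. indicat_real B \<omega> \<partial>M)"
  proof (rule integral_dominated_convergence[where w = "\<lambda>_. 1"])
    show "AE \<omega> in M. (\<lambda>m. indicat_real (A m) \<omega>) \<longlonglongrightarrow> indicat_real B \<omega>"
      using ev
    proof eventually_elim
      case (elim \<omega>)
      then have "\<forall>\<^sub>F m in sequentially. indicat_real (A m) \<omega> = indicat_real B \<omega>"
        by eventually_elim (simp add: indicator_def)
      then show ?case by (rule tendsto_eventually)
    qed
  qed (use A BM in \<open>auto simp: indicator_def\<close>)
  then show "(\<lambda>m. measure M (A m)) \<longlonglongrightarrow> measure M B"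
    using A BM by simp
qed

lemma clan_props:
  assumes "\<psi> \<in> clan M \<phi>"
  shows "\<psi> \<in> M \<and> 0 < snd (snd \<psi>) \<and> birth \<psi> < birth \<phi>"
proof -
  have "\<psi> \<in> ancn M \<phi> n \<Longrightarrow> \<psi> \<in> M \<and> 0 < snd (snd \<psi>) \<and> birth \<psi> < birth \<phi>" for n
  proof (induction n arbitrary: \<psi>)
    case 0
    then show ?case by (auto simp: anc1_iff)
  next
    case (Suc n)
    then obtain \<theta> where "\<theta> \<in> ancn M \<phi> n" "\<psi> \<in> anc1 M \<theta>" by auto
    then show ?case using Suc.IH[of \<theta>] unfolding anc1_iff by linarith
  qed
  then show ?thesis using assms unfolding clan_def by blast
qed

text \<open>An injective map sends moved points to moved points, so a cycle supported in
  \<open>\<Lambda>\<close> restricts to a map of \<open>\<Lambda>\<close> to itself and is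
  determined by that restriction.\<close>

lemma finite_cycles_in:
  assumes "finite \<Lambda>"
  shows "finite {g :: int^'d \<Rightarrow> int^'d. g \<in> cycles \<and> supp g \<subseteq> \<Lambda>}" (is "finite ?S")
proof -
  have "(\<lambda>g. restrict g \<Lambda>) ` ?S \<subseteq> PiE \<Lambda> (\<lambda>_. \<Lambda>)"
  proof (intro image_subsetI restrict_PiE_iff[THEN iffD2] ballI)
    fix g x assume g: "g \<in> ?S" and x: "x \<in> \<Lambda>"
    show "g x \<in> \<Lambda>"
    proof (cases "g x = x")
      case False
      have "inj g" using g by (simp add: cycles_def is_cycle_def bij_def)
      then have "g (g x) \<noteq> g x" using False by (simp add: inj_eq)
      then show ?thesis using g by (auto simp: supp_def)
    qed (use x in simp)
  qed
  moreover have "finite (PiE \<Lambda> (\<lambda>_. \<Lambda>))" using assms by (intro finite_PiE) auto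
  ultimately have "finite ((\<lambda>g. restrict g \<Lambda>) ` ?S)" by (rule finite_subset)
  moreover have "inj_on (\<lambda>g. restrict g \<Lambda>) ?S"
  proof (rule inj_onI, rule ext)
    fix f g x assume fg: "f \<in> ?S" "g \<in> ?S" "restrict f \<Lambda> = restrict g \<Lambda>"
    show "f x = g x"
    proof (cases "x \<in> \<Lambda>")
      case True
      then show ?thesis using fg(3) by (metis restrict_apply')
    next
      case False
      then have "x \<notin> supp f" "x \<notin> supp g" using fg by auto
      then show ?thesis by (simp add: supp_def)
    qed
  qed
  ultimately show ?thesis by (rule finite_imageD)
qed

section \<open>Null events of the point process\<close>

context ppp
begin

lemma prob_space_completion: "prob_space (completion M)"
  by (rule prob_spaceI) (simp add: emeasure_space_1)

lemma AE_empty: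
  assumes "B \<in> sets \<nu>" "emeasure \<nu> B = 0"
  shows "AE \<omega> in M. N \<omega> \<inter> B = {}"
proof -
  have fin: "emeasure \<nu> B < \<infinity>" using assms by simp
  have "prob {\<omega> \<in> space M. 1 \<le> card (N \<omega> \<inter> B)} = 0"
    using prob_count_ge_1_le[OF assms(1) fin] assms(2) by (simp add: measure_le_0_iff)
  then have "AE \<omega> in M. \<not> 1 \<le> card (N \<omega> \<inter> B)"
    using prob_eq_0[OF count_event[OF assms(1) fin, of "\<lambda>x. 1 \<le> x"]] by (auto elim: eventually_mono)
  with count_finite[OF assms(1) fin] show ?thesis
    by eventually_elim (auto simp: Suc_le_eq card_gt_0_iff)
qed

text \<open>Reconciles two conventions: \<open>eta\<close> counts births up to and including
  \<open>t\<close>, while an ancestor must be born strictly before.\<close>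

lemma AE_no_birth_at: "AE \<omega> in M. \<forall>\<phi>\<in>N \<omega>. 0 < snd (snd \<phi>) \<longrightarrow> birth \<phi> \<noteq> t"
proof -
  let ?A = "{(t', s). t' = t \<and> (0::real) < s}"
  have A: "?A \<in> sets (borel \<Otimes>\<^sub>M borel)" by (rule planar_set) measurable
  \<comment> \<open>The vertical line is covered by strips of arbitrarily small width, whose mass
    equals the width.\<close>
  have eps: "emeasure life ?A \<le> 0 + ennreal e" if "0 < e" for e
  proof -
    have "emeasure life ?A \<le> emeasure life {(t', s). t - e < t' \<and> t' \<le> t \<and> 0 < s}"
      by (rule emeasure_mono) (use that in \<open>auto simp: sets_life intro!: planar_set\<close>)
    also have "\<dots> = 0 + ennreal e" using emeasure_life_births[of "t - e" t] that by simp
    finally show ?thesis .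
  qed
  have "emeasure life ?A \<le> 0" by (rule ennreal_le_epsilon) (rule eps)
  then have null: "emeasure life ?A = 0" by simp
  have "AE \<omega> in M. \<forall>g\<in>cycles. N \<omega> \<inter> {g} \<times> ?A = {}"
    unfolding AE_ball_countable[OF countable_cycles]
  proof
    fix g :: "int^'d \<Rightarrow> int^'d" assume g: "g \<in> cycles"
    then show "AE \<omega> in M. N \<omega> \<inter> {g} \<times> ?A = {}"
      using A null by (intro AE_empty rect_sets_intensity) (auto simp: emeasure_intensity)
  qed
  with AE_space show ?thesis
  proof eventually_elim
    case (elim \<omega>)
    show ?case
    proof (intro ballI impI notI)
      fix \<phi> assume "\<phi> \<in> N \<omega>" "0 < snd (snd \<phi>)" "birth \<phi> = t"
      then have mem: "\<phi> \<in> N \<omega> \<inter> {fst \<phi>} \<times> ?A" and cyc: "fst \<phi> \<in> cycles"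
        using N_cycles elim(1) by (cases \<phi>; auto)+
      from bspec[OF elim(2) cyc] mem show False by (metis empty_iff)
    qed
  qed
qed

lemma AE_positive_weight: "AE \<omega> in M. \<forall>\<phi>\<in>N \<omega>. 0 < w (fst \<phi>)"
proof -
  have "AE \<omega> in M. \<forall>g\<in>{g \<in> cycles. w g = 0}. N \<omega> \<inter> {g} \<times> UNIV = {}"
    unfolding AE_ball_countable[OF countable_subset[OF _ countable_cycles, of "{g \<in> cycles. w g = 0}", OF Collect_subset]]
  proof
    fix g :: "int^'d \<Rightarrow> int^'d" assume g: "g \<in> {g \<in> cycles. w g = 0}"
    have U: "UNIV \<in> sets (borel \<Otimes>\<^sub>M borel :: (real \<times> real) measure)"
      using sets.top[of "borel \<Otimes>\<^sub>M borel :: (real \<times> real) measure"] by (simp add: space_pair_measure)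
    show "AE \<omega> in M. N \<omega> \<inter> {g} \<times> UNIV = {}"
      using g U by (intro AE_empty rect_sets_intensity) (auto simp: emeasure_intensity)
  qed
  with AE_space show ?thesis
  proof eventually_elim
    case (elim \<omega>)
    show ?case
    proof
      fix \<phi> assume \<phi>: "\<phi> \<in> N \<omega>"
      then have cyc: "fst \<phi> \<in> cycles" using N_cycles elim(1) by blast
      have mem: "\<phi> \<in> N \<omega> \<inter> {fst \<phi>} \<times> UNIV" using \<phi> by (simp add: mem_Times_iff)
      have "w (fst \<phi>) \<noteq> 0"
      proof
        assume "w (fst \<phi>) = 0"
        then have "N \<omega> \<inter> {fst \<phi>} \<times> UNIV = {}" using elim(2) cyc by simp
        then show False using mem by simp
      qed
      then show "0 < w (fst \<phi>)" using cweight_nonneg[of \<alpha> V "fst \<phi>"] by simp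
    qed
  qed
qed

section \<open>The process started empty, and its law\<close>

context
  fixes G :: "(int^'d \<Rightarrow> int^'d) set" and t0 :: real
  assumes G: "finite G" "G \<subseteq> cycles" and w_pos: "\<forall>g\<in>G. 0 < w g"
begin

interpretation H: hardcore G w incompat by (rule hardcore_G[OF G w_pos])

definition window :: "nat \<Rightarrow> 'w \<Rightarrow> ((int^'d \<Rightarrow> int^'d) \<times> real \<times> real) set" where
  "window n \<omega> = N \<omega> \<inter> G \<times> {(t, s). t0 - real n < t \<and> t \<le> t0 \<and> 0 < s}"

definition X :: "nat \<Rightarrow> nat \<Rightarrow> 'w \<Rightarrow> (int^'d \<Rightarrow> int^'d) set" where
  "X n m \<omega> = fst ` H.Y (\<lambda>c. lt (t0 - real n) (1 / 2 ^ m) (n * 2 ^ m) c \<omega>) (n * 2 ^ m)"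

lemma grid_end: "t0 - real n + real (n * 2 ^ m) * (1 / 2 ^ m) = t0"
  by simp

text \<open>The window consists of \<open>n * 2 ^ m\<close> intervals, each bad with probability of
  order 4^(-m); the total is summable in \<open>m\<close>, and Borel-Cantelli applies. The agreement
  obtained is exact, and simultaneous for all cycles.\<close>

lemma AE_X_eventually:
  "AE \<omega> in M. \<forall>\<^sub>F m in sequentially. \<forall>g. eta (window n \<omega>) t0 g = (if g \<in> X n m \<omega> then 1 else 0)"
proof -
  define a where "a = t0 - real n"
  define h :: "nat \<Rightarrow> real" where "h m = 1 / 2 ^ m" for m
  define K :: "nat \<Rightarrow> nat" where "K m = n * 2 ^ m" for m
  have h: "0 < h m" "h m \<le> 1" for m by (auto simp: h_def)
  have end': "a + real (K m) * h m = t0" for m unfolding a_def h_def K_def by (rule grid_end)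
  note ctx = G w_pos h
  have birth_eq: "N \<omega> \<inter> births G a (h m) (K m) = window n \<omega>" for m \<omega>
    unfolding births_def[OF ctx] window_def end' unfolding a_def ..
  have "AE \<omega> in M. \<forall>\<^sub>F m in sequentially. \<omega> \<in> space M - bad G a (h m) (K m)"
  proof (rule borel_cantelli_AE1)
    show "bad G a (h m) (K m) \<in> events" for m by (rule bad_event[OF ctx])
    show "emeasure M (bad G a (h m) (K m)) < \<infinity>" for m by (simp add: less_top[symmetric])
    have bnd: "prob (bad G a (h m) (K m)) \<le> real n * (4 * (W G)\<^sup>2 + W G) * (1 / 2) ^ m" for m
    proof -
      have "prob (bad G a (h m) (K m)) \<le> real (K m) * ((4 * (W G)\<^sup>2 + W G) * (h m)\<^sup>2)" by (rule prob_bad[OF ctx])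
      also have "\<dots> = real n * (4 * (W G)\<^sup>2 + W G) * (1 / 2) ^ m"
        by (simp add: K_def h_def power2_eq_square power_divide field_simps)
      finally show ?thesis .
    qed
    show "summable (\<lambda>m. prob (bad G a (h m) (K m)))"
      by (rule summable_comparison_test'[where N = 0 and g = "\<lambda>m. real n * (4 * (W G)\<^sup>2 + W G) * (1 / 2) ^ m"])
         (use bnd in \<open>auto intro!: summable_mult summable_geometric\<close>)
  qed
  moreover have "AE \<omega> in M. finite (window n \<omega>)"
  proof -
    have "AE \<omega> in M. finite (N \<omega> \<inter> births G a (h 0) (K 0))" by (rule births_finite[OF ctx])
    then show ?thesis unfolding birth_eq .
  qed
  ultimately show ?thesis
  proof eventually_elim
    case (elim \<omega>)
    from elim(1) show ?case
    proof eventually_elim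
      case (elim m)
      have "grid_coupling G w (N \<omega> \<inter> births G a (h m) (K m)) a (h m) (K m) (\<lambda>c. lt a (h m) (K m) c \<omega>)"
        by (rule grid_coupling_N[OF ctx]) (use elim \<open>finite (window n \<omega>)\<close> in \<open>auto simp: birth_eq\<close>)
      then interpret C: grid_coupling G w "window n \<omega>" a "h m" "K m" "\<lambda>c. lt a (h m) (K m) c \<omega>" unfolding birth_eq .
      show ?case using C.eta_eq[unfolded end'] unfolding X_def a_def h_def K_def by blast
    qed
  qed
qed

lemma X_event: "{\<omega> \<in> space M. X n m \<omega> = \<xi>} \<in> events"
proof -
  interpret L: grid_lifetimes G w incompat M "lt (t0 - real n) (1 / 2 ^ m) (n * 2 ^ m)" "1 / 2 ^ m" "n * 2 ^ m"
    by (rule grid_lifetimes_lt[OF G w_pos]) auto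
  show ?thesis unfolding X_def using L.event_Y[of "n * 2 ^ m" "\<lambda>y. fst ` y = \<xi>"] by simp
qed

lemma X_distribution:
  "\<exists>l>0. \<exists>C. \<exists>B. \<forall>n. \<forall>\<^sub>F m in sequentially.
     \<forall>\<xi>\<in>H.St. \<bar>prob {\<omega> \<in> space M. X n m \<omega> = \<xi>} - H.gibbs_pi \<xi>\<bar> \<le> C * exp (- l * real n) + B * (1 / 2 ^ m)"
proof -
  obtain l C h0 where l: "0 < l" "0 \<le> C" "0 < h0" and main: "\<forall>h B p K. 0 < h \<and> h \<le> h0 \<and> 0 \<le> B \<and>
     (\<forall>k\<le>K. sum (p k) H.St = 1 \<and> (\<forall>\<xi>\<in>H.St. 0 \<le> p k \<xi>)) \<and>
     (\<forall>k<K. (\<Sum>\<xi>\<in>H.St. \<bar>p (Suc k) \<xi> - (p k \<xi> + h * H.gen (p k) \<xi>)\<bar>) \<le> B * h\<^sup>2) \<longrightarrow>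
     (\<Sum>\<xi>\<in>H.St. \<bar>p K \<xi> - H.gibbs_pi \<xi>\<bar>) \<le> C * exp (- l * (real K * h)) + C * B * h"
    using H.approx_chain_near_gibbs by (elim exE conjE) (rule that)
  \<comment> \<open>The constant of \<open>one_step_error\<close> with \<open>C\<close> and
    \<open>D\<close> unfolded; it involves only \<open>G\<close> and \<open>w\<close>, so it can be
    fixed before the mesh and the window are chosen.\<close>
  define B where "B = 4 * real (card H.St) * real (card G) * ((2 * real (card G) + 1) * (1 + sum w G)\<^sup>2)"
  have B: "0 \<le> B" by (simp add: B_def)
  have "\<forall>\<^sub>F m in sequentially. (1 / 2 ^ m :: real) < h0"
  proof -
    have "(\<lambda>m. (1 / 2 :: real) ^ m) \<longlonglongrightarrow> 0" by (rule LIMSEQ_realpow_zero) auto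
    from order_tendstoD(2)[OF this l(3)] show ?thesis by (simp add: power_one_over)
  qed
  then have ev: "\<forall>\<^sub>F m in sequentially. \<forall>\<xi>\<in>H.St. \<bar>prob {\<omega> \<in> space M. X n m \<omega> = \<xi>} - H.gibbs_pi \<xi>\<bar> \<le> C * exp (- l * real n) + C * B * (1 / 2 ^ m)" for n
  proof eventually_elim
    case (elim m)
    interpret L: grid_lifetimes G w incompat M "lt (t0 - real n) (1 / 2 ^ m) (n * 2 ^ m)" "1 / 2 ^ m" "n * 2 ^ m"
      by (rule grid_lifetimes_lt[OF G w_pos]) auto
    have "(\<Sum>\<xi>\<in>H.St. \<bar>L.pr (n * 2 ^ m) \<xi> - H.gibbs_pi \<xi>\<bar>) \<le> C * exp (- l * (real (n * 2 ^ m) * (1 / 2 ^ m))) + C * B * (1 / 2 ^ m)"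
    proof (rule main[THEN spec[of _ "1 / 2 ^ m"], THEN spec[of _ B], THEN spec[of _ L.pr], THEN spec[of _ "n * 2 ^ m"], THEN mp], intro conjI allI impI)
      show "sum (L.pr k) H.St = 1" "\<forall>\<xi>\<in>H.St. 0 \<le> L.pr k \<xi>" if "k \<le> n * 2 ^ m" for k
        using L.sum_pr[OF that] by (auto simp: L.pr_def)
      show "(\<Sum>\<xi>\<in>H.St. \<bar>L.pr (Suc k) \<xi> - (L.pr k \<xi> + 1 / 2 ^ m * H.gen (L.pr k) \<xi>)\<bar>) \<le> B * (1 / 2 ^ m)\<^sup>2"
        if "k < n * 2 ^ m" for k
        using L.one_step_error[OF that] unfolding B_def L.C_def L.D_def by simp
    qed (use elim B in auto)
    also have "real (n * 2 ^ m) * (1 / 2 ^ m) = real n" by simp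
    finally have s: "(\<Sum>\<xi>\<in>H.St. \<bar>L.pr (n * 2 ^ m) \<xi> - H.gibbs_pi \<xi>\<bar>) \<le> C * exp (- l * real n) + C * B * (1 / 2 ^ m)" .
    show ?case
    proof
      fix \<xi> assume "\<xi> \<in> H.St"
      then have "\<bar>L.pr (n * 2 ^ m) \<xi> - H.gibbs_pi \<xi>\<bar> \<le> (\<Sum>\<xi>\<in>H.St. \<bar>L.pr (n * 2 ^ m) \<xi> - H.gibbs_pi \<xi>\<bar>)"
        by (intro member_le_sum[where f = "\<lambda>\<xi>. \<bar>L.pr (n * 2 ^ m) \<xi> - H.gibbs_pi \<xi>\<bar>"]) (auto simp: H.finite_St)
      then show "\<bar>prob {\<omega> \<in> space M. X n m \<omega> = \<xi>} - H.gibbs_pi \<xi>\<bar> \<le> C * exp (- l * real n) + C * B * (1 / 2 ^ m)"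
        using s unfolding L.pr_def X_def by linarith
    qed
  qed
  show ?thesis using l(1) ev by blast
qed

lemma window_law:
  shows "AE \<omega> in M. \<exists>\<xi>\<in>H.St. \<forall>g. eta (window n \<omega>) t0 g = (if g \<in> \<xi> then 1 else 0)"
    and "{\<omega> \<in> space M. {g. eta (window n \<omega>) t0 g = 1} = \<xi>} \<in> sets (completion M)"
    and "(\<lambda>m. prob {\<omega> \<in> space M. X n m \<omega> = \<xi>}) \<longlonglongrightarrow>
      measure (completion M) {\<omega> \<in> space M. {g. eta (window n \<omega>) t0 g = 1} = \<xi>}"
proof -
  show "AE \<omega> in M. \<exists>\<xi>\<in>H.St. \<forall>g. eta (window n \<omega>) t0 g = (if g \<in> \<xi> then 1 else 0)"
    using AE_X_eventually[of n]
  proof eventually_elim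
    case (elim \<omega>)
    then obtain m where "\<forall>g. eta (window n \<omega>) t0 g = (if g \<in> X n m \<omega> then 1 else 0)"
      by (auto simp: eventually_sequentially)
    moreover have "X n m \<omega> \<in> H.St" unfolding X_def by (rule H.Y_state)
    ultimately show ?case by blast
  qed
  let ?A = "\<lambda>m. {\<omega> \<in> space M. X n m \<omega> = \<xi>}" and ?B = "{\<omega> \<in> space M. {g. eta (window n \<omega>) t0 g = 1} = \<xi>}"
  have ev: "AE \<omega> in completion M. \<forall>\<^sub>F m in sequentially. \<omega> \<in> ?A m \<longleftrightarrow> \<omega> \<in> ?B"
  proof (rule AE_completion)
    show "AE \<omega> in M. \<forall>\<^sub>F m in sequentially. \<omega> \<in> ?A m \<longleftrightarrow> \<omega> \<in> ?B"
      using AE_X_eventually[of n]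
    proof eventually_elim
      case (elim \<omega>)
      then show ?case
      proof eventually_elim
        case (elim m)
        then have "{g. eta (window n \<omega>) t0 g = 1} = X n m \<omega>" by auto
        then show ?case by auto
      qed
    qed
  qed
  interpret PC: prob_space "completion M" by (rule prob_space_completion)
  have A: "?A m \<in> sets (completion M)" for m using X_event by blast
  have B: "?B \<subseteq> space (completion M)" by auto
  show "?B \<in> sets (completion M)"
    by (rule completion.AE_eventually_event(1)[OF PC.finite_measure_axioms A B ev])
  show "(\<lambda>m. prob (?A m)) \<longlonglongrightarrow> measure (completion M) ?B"
    using completion.AE_eventually_event(2)[OF PC.finite_measure_axioms A B ev] X_event by simp
qed

lemma window_law_near_gibbs:
  assumes "\<xi> \<in> H.St"
  shows "(\<lambda>n. measure (completion M) {\<omega> \<in> space M. {g. eta (window n \<omega>) t0 g = 1} = \<xi>}) \<longlonglongrightarrow> H.gibbs_pi \<xi>"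
proof -
  obtain l C B where l: "0 < l" and ev: "\<And>n. \<forall>\<^sub>F m in sequentially.
     \<forall>\<xi>\<in>H.St. \<bar>prob {\<omega> \<in> space M. X n m \<omega> = \<xi>} - H.gibbs_pi \<xi>\<bar> \<le> C * exp (- l * real n) + B * (1 / 2 ^ m)"
    using X_distribution by blast
  let ?q = "\<lambda>n. measure (completion M) {\<omega> \<in> space M. {g. eta (window n \<omega>) t0 g = 1} = \<xi>}"
  have bnd: "\<bar>?q n - H.gibbs_pi \<xi>\<bar> \<le> C * exp (- l * real n)" for n
  proof (rule tendsto_le[OF sequentially_bot])
    show "(\<lambda>m. \<bar>prob {\<omega> \<in> space M. X n m \<omega> = \<xi>} - H.gibbs_pi \<xi>\<bar>) \<longlonglongrightarrow> \<bar>?q n - H.gibbs_pi \<xi>\<bar>"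
      by (intro tendsto_intros window_law)
    have "(\<lambda>m. (1 / 2 :: real) ^ m) \<longlonglongrightarrow> 0" by (rule LIMSEQ_realpow_zero) auto
    then have "(\<lambda>m. C * exp (- l * real n) + B * (1 / 2) ^ m) \<longlonglongrightarrow> C * exp (- l * real n) + B * 0"
      by (intro tendsto_add tendsto_mult tendsto_const)
    then show "(\<lambda>m. C * exp (- l * real n) + B * (1 / 2 ^ m)) \<longlonglongrightarrow> C * exp (- l * real n)"
      by (simp add: power_one_over)
    show "\<forall>\<^sub>F m in sequentially. \<bar>prob {\<omega> \<in> space M. X n m \<omega> = \<xi>} - H.gibbs_pi \<xi>\<bar> \<le> C * exp (- l * real n) + B * (1 / 2 ^ m)"
      using ev[of n] by eventually_elim (use assms in blast)
  qed
  have "(\<lambda>n. exp (- l) ^ n) \<longlonglongrightarrow> 0" using l by (intro LIMSEQ_realpow_zero) auto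
  then have "(\<lambda>n. exp (- l * real n)) \<longlonglongrightarrow> 0" by (simp add: exp_of_nat2_mult[symmetric] mult.commute)
  then have "(\<lambda>n. C * exp (- l * real n)) \<longlonglongrightarrow> 0" by (rule tendsto_mult_right_zero)
  then have "(\<lambda>n. ?q n - H.gibbs_pi \<xi>) \<longlonglongrightarrow> 0"
    by (rule Lim_null_comparison[rotated]) (use bnd in auto)
  then show ?thesis by (rule LIM_zero_cancel)
qed

end

end

section \<open>Infinite volume limit\<close>

text \<open>Dominated convergence works along sequences, whereas volumes form a net. For a countable
  type the initial segments of an enumeration are cofinal: if the net failed to converge, a bad
  finite set chosen above each segment would give a sequence that exhausts the space and violates
  the assumption.\<close>

lemma tendsto_finite_sets_at_top_seqI:
  fixes u :: "'a::countable set \<Rightarrow> real"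
  assumes "\<And>Y :: nat \<Rightarrow> 'a set. filterlim Y finite_sets_at_top sequentially \<Longrightarrow> (\<lambda>n. u (Y n)) \<longlonglongrightarrow> l"
  shows "(u \<longlongrightarrow> l) finite_sets_at_top"
proof (rule tendstoI, rule ccontr)
  fix e :: real assume e: "0 < e" and "\<not> (\<forall>\<^sub>F X in finite_sets_at_top. dist (u X) l < e)"
  then have *: "\<exists>Y. finite Y \<and> X \<subseteq> Y \<and> \<not> dist (u Y) l < e" if "finite X" for X
    using that unfolding eventually_finite_subsets_at_top by auto
  have fin: "finite {x :: 'a. to_nat x < n}" for n
    by (rule finite_imageD[of to_nat]) (auto intro: finite_subset[of _ "{..<n}"] inj_on_subset[OF inj_to_nat])
  have "\<forall>n. \<exists>Y. finite Y \<and> {x :: 'a. to_nat x < n} \<subseteq> Y \<and> \<not> dist (u Y) l < e"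
    using *[OF fin] by blast
  from choice[OF this] obtain Y where Y: "\<And>n. finite (Y n)" "\<And>n. {x :: 'a. to_nat x < n} \<subseteq> Y n" "\<And>n. \<not> dist (u (Y n)) l < e"
    by blast
  have "filterlim Y finite_sets_at_top sequentially"
    unfolding filterlim_finite_subsets_at_top
  proof (intro allI impI)
    fix X :: "'a set" assume X: "finite X \<and> X \<subseteq> UNIV"
    define m where "m = Suc (Max (insert 0 (to_nat ` X)))"
    have "to_nat x < m" if "x \<in> X" for x
      unfolding m_def less_Suc_eq_le using X that by (intro Max_ge) auto
    then have "X \<subseteq> Y n" if "m \<le> n" for n
      using Y(2)[of n] that by (auto intro: less_le_trans)
    then show "\<forall>\<^sub>F n in sequentially. finite (Y n) \<and> X \<subseteq> Y n \<and> Y n \<subseteq> UNIV"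
      using Y(1) by (auto simp: eventually_sequentially)
  qed
  from tendstoD[OF assms[OF this] e] Y(3) show False by (auto simp: eventually_sequentially)
qed

text \<open>Without such a sequence the preceding criterion would hold vacuously and make the
  constant 0 converge to 1.\<close>

lemma exists_filterlim_finite_sets_at_top:
  "\<exists>Y :: nat \<Rightarrow> 'a::countable set. filterlim Y finite_sets_at_top sequentially"
proof (rule ccontr)
  assume "\<nexists>Y :: nat \<Rightarrow> 'a set. filterlim Y finite_sets_at_top sequentially"
  then have lim: "((\<lambda>_ :: 'a set. 0 :: real) \<longlongrightarrow> 1) finite_sets_at_top"
    by (intro tendsto_finite_sets_at_top_seqI) blast
  have "((\<lambda>_ :: 'a set. 0 :: real) \<longlongrightarrow> 0) finite_sets_at_top" by simp
  from tendsto_unique[OF _ lim this] show False by simp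
qed

lemma product_discrete_continuous_tendsto:
  assumes f: "continuous_map (product_topology (\<lambda>_. discrete_topology UNIV) I) euclideanreal f"
    and ev: "\<And>i. i \<in> I \<Longrightarrow> \<forall>\<^sub>F n in F. xs n i = x i"
    and xs: "\<And>n. xs n \<in> extensional I" and x: "x \<in> extensional I"
  shows "((\<lambda>n. f (xs n)) \<longlongrightarrow> f x) F"
proof -
  have "limitin (product_topology (\<lambda>_. discrete_topology UNIV) I) xs x F"
    unfolding limitin_componentwise
  proof (intro conjI ballI)
    show "\<forall>\<^sub>F n in F. xs n \<in> topspace (product_topology (\<lambda>_. discrete_topology UNIV) I)"
      using xs by (auto simp: PiE_def)
    fix i assume "i \<in> I"
    from ev[OF this] show "limitin (discrete_topology UNIV) (\<lambda>c. xs c i) (x i) F"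
      unfolding limitin_def by (auto elim: eventually_mono)
  qed (rule x)
  from continuous_map_limit[OF f this] show ?thesis by (simp add: o_def)
qed

text \<open>Replacing all coordinates outside a growing finite set by 0 gives points converging in
  the product topology, so \<open>f\<close> is a pointwise limit of functions of finitely many
  integers, each of which is measurable.\<close>

lemma product_discrete_continuous_measurable:
  fixes f :: "('i \<Rightarrow> nat) \<Rightarrow> real"
  assumes I: "countable I"
    and f: "continuous_map (product_topology (\<lambda>_. discrete_topology UNIV) I) euclideanreal f"
  shows "f \<in> borel_measurable (PiM I (\<lambda>_. count_space UNIV))"
proof -
  define S where "S n = {i \<in> I. to_nat_on I i < n}" for n
  have SI: "S n \<subseteq> I" for n by (auto simp: S_def)
  have finS: "finite (S n)" for n
    by (rule finite_imageD[of "to_nat_on I"])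
       (auto simp: S_def intro: finite_subset[of _ "{..<n}"] inj_on_subset[OF inj_on_to_nat_on[OF I]])
  define pr where "pr n x = (\<lambda>i\<in>I. if i \<in> S n then x i else 0)" for n and x :: "'i \<Rightarrow> nat"
  show ?thesis
  proof (rule borel_measurable_LIMSEQ_real)
    fix x :: "'i \<Rightarrow> nat" assume "x \<in> space (PiM I (\<lambda>_. count_space UNIV))"
    then have x: "x \<in> extensional I" by (simp add: space_PiM PiE_def)
    show "(\<lambda>n. f (pr n x)) \<longlonglongrightarrow> f x"
    proof (rule product_discrete_continuous_tendsto[OF f _ _ x])
      fix i assume "i \<in> I"
      then show "\<forall>\<^sub>F n in sequentially. pr n x i = x i"
        unfolding eventually_sequentially by (intro exI[of _ "Suc (to_nat_on I i)"]) (auto simp: pr_def S_def)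
    qed (simp add: pr_def)
  next
    fix n
    have eq: "f (pr n x) = f (pr n (restrict x (S n)))" for x
    proof -
      have "pr n x = pr n (restrict x (S n))" unfolding pr_def by (intro restrict_ext) auto
      then show ?thesis by simp
    qed
    have cs: "PiM (S n) (\<lambda>_. count_space (UNIV :: nat set)) = count_space (PiE (S n) (\<lambda>_. UNIV))"
      by (rule count_space_PiM_finite[OF finS]) auto
    have "(\<lambda>y. f (pr n y)) \<in> borel_measurable (PiM (S n) (\<lambda>_. count_space UNIV))"
      unfolding cs by simp
    then have "(\<lambda>x. f (pr n (restrict x (S n)))) \<in> borel_measurable (PiM I (\<lambda>_. count_space UNIV))"
      by (rule measurable_compose[OF measurable_restrict_subset[OF SI]])
    then show "(\<lambda>x. f (pr n x)) \<in> borel_measurable (PiM I (\<lambda>_. count_space UNIV))"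
      by (subst eq)
  qed
qed

section \<open>Finite-volume Gibbs measures in terms of states\<close>

definition cfg :: "(int^'d \<Rightarrow> int^'d) set \<Rightarrow> (int^'d \<Rightarrow> int^'d) \<Rightarrow> nat" where
  "cfg \<xi> = (\<lambda>g\<in>cycles. if g \<in> \<xi> then 1 else 0)"

definition pos_cycles :: "real \<Rightarrow> (int^'d \<Rightarrow> ereal) \<Rightarrow> (int^'d) set \<Rightarrow> (int^'d \<Rightarrow> int^'d) set" where
  "pos_cycles \<alpha> V \<Lambda> = {g \<in> cycles. supp g \<subseteq> \<Lambda> \<and> 0 < cweight \<alpha> V g}"

lemma pos_cycles_props:
  assumes "finite \<Lambda>"
  shows "finite (pos_cycles \<alpha> V \<Lambda>)" "pos_cycles \<alpha> V \<Lambda> \<subseteq> cycles" "\<forall>g\<in>pos_cycles \<alpha> V \<Lambda>. 0 < cweight \<alpha> V g"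
proof -
  show "finite (pos_cycles \<alpha> V \<Lambda>)"
    by (rule finite_subset[OF _ finite_cycles_in[OF assms]]) (auto simp: pos_cycles_def)
qed (auto simp: pos_cycles_def)

lemma hardcore_pos_cycles: "finite \<Lambda> \<Longrightarrow> hardcore (pos_cycles \<alpha> V \<Lambda>) (cweight \<alpha> V) incompat"
  using pos_cycles_props[of \<Lambda> \<alpha> V] incompat_self incompat_commute by unfold_locales auto

text \<open>A configuration containing a cycle of weight zero has weight zero. The remaining
  configurations correspond bijectively, through \<open>cfg\<close>, to the states built from cycles
  of positive weight.\<close>

lemma gibbs_integral:
  fixes V :: "int^'d \<Rightarrow> ereal" and f :: "((int^'d \<Rightarrow> int^'d) \<Rightarrow> nat) \<Rightarrow> real"
  assumes \<Lambda>: "finite \<Lambda>"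
  shows "(\<integral>\<eta>. f \<eta> \<partial>gibbs \<alpha> V \<Lambda>) =
    (\<Sum>\<xi>\<in>hardcore.St (pos_cycles \<alpha> V \<Lambda>) incompat. f (cfg \<xi>) * hardcore.gibbs_pi (pos_cycles \<alpha> V \<Lambda>) (cweight \<alpha> V) incompat \<xi>)"
proof -
  let ?G = "pos_cycles \<alpha> V \<Lambda>" and ?w = "cweight \<alpha> V"
  interpret H: hardcore ?G ?w incompat by (rule hardcore_pos_cycles[OF \<Lambda>])
  have St_sub: "\<xi> \<subseteq> ?G" and St_disj: "\<And>g h. g \<in> \<xi> \<Longrightarrow> h \<in> \<xi> \<Longrightarrow> g \<noteq> h \<Longrightarrow> supp g \<inter> supp h = {}"
    if "\<xi> \<in> H.St" for \<xi> using that unfolding H.St_def incompat_def by blast+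
  have St_cyc: "\<xi> \<subseteq> cycles" if "\<xi> \<in> H.St" for \<xi> using St_sub[OF that] by (auto simp: pos_cycles_def)
  have ones: "{g \<in> cycles. cfg \<xi> g = 1} = \<xi>" if "\<xi> \<subseteq> cycles" for \<xi> :: "(int^'d \<Rightarrow> int^'d) set"
    using that by (auto simp: cfg_def split: if_splits)
  have cfg_weight: "cfg_weight \<alpha> V (cfg \<xi>) = H.wt \<xi>" if "\<xi> \<in> H.St" for \<xi>
    unfolding cfg_weight_def ones[OF St_cyc[OF that]] H.wt_def ..
  have cfg_in: "cfg \<xi> \<in> configs \<Lambda>" if "\<xi> \<in> H.St" for \<xi>
  proof -
    have "\<forall>g\<in>\<xi>. supp g \<subseteq> \<Lambda>" using St_sub[OF that] by (auto simp: pos_cycles_def)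
    then show ?thesis using St_disj[OF that] by (auto simp: configs_def cfg_def split: if_splits)
  qed
  have inj: "inj_on cfg H.St"
  proof (rule inj_onI)
    fix \<xi> \<zeta> assume "\<xi> \<in> H.St" "\<zeta> \<in> H.St" "cfg \<xi> = cfg \<zeta>"
    then show "\<xi> = \<zeta>" using ones[OF St_cyc, of \<xi>] ones[OF St_cyc, of \<zeta>] by simp
  qed
  have cfg_ones: "\<eta> = cfg {g \<in> cycles. \<eta> g = 1}" if "\<eta> \<in> configs \<Lambda>" for \<eta>
  proof
    fix g show "\<eta> g = cfg {g \<in> cycles. \<eta> g = 1} g"
      using that by (cases "g \<in> cycles") (auto simp: configs_def cfg_def PiE_def extensional_def Pi_iff)
  qed
  have fin: "finite (configs \<Lambda>)"
  proof (rule finite_subset)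
    show "configs \<Lambda> \<subseteq> cfg ` Pow {g. g \<in> cycles \<and> supp g \<subseteq> \<Lambda>}"
    proof
      fix \<eta> assume \<eta>: "\<eta> \<in> configs \<Lambda>"
      then have "{g \<in> cycles. \<eta> g = 1} \<in> Pow {g. g \<in> cycles \<and> supp g \<subseteq> \<Lambda>}" by (auto simp: configs_def)
      from imageI[OF this, of cfg] show "\<eta> \<in> cfg ` Pow {g. g \<in> cycles \<and> supp g \<subseteq> \<Lambda>}"
        using cfg_ones[OF \<eta>] by simp
    qed
  qed (use finite_cycles_in[OF \<Lambda>] in auto)
  have zero: "cfg_weight \<alpha> V \<eta> = 0" if \<eta>: "\<eta> \<in> configs \<Lambda> - cfg ` H.St" for \<eta>
  proof -
    let ?\<xi> = "{g \<in> cycles. \<eta> g = 1}"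
    have "?\<xi> \<notin> H.St" using \<eta> cfg_ones[of \<eta>] by blast
    moreover have "\<not> incompat g h" if "g \<in> ?\<xi>" "h \<in> ?\<xi>" "g \<noteq> h" for g h
      using \<eta> that unfolding configs_def incompat_def by blast
    ultimately have "\<not> ?\<xi> \<subseteq> ?G" unfolding H.St_def by blast
    then obtain g where "g \<in> ?\<xi>" "\<not> 0 < ?w g"
      using \<eta> by (auto simp: configs_def pos_cycles_def)
    moreover have "finite ?\<xi>"
      by (rule finite_subset[OF _ finite_cycles_in[OF \<Lambda>]]) (use \<eta> in \<open>auto simp: configs_def\<close>)
    moreover have "?w g = 0" using \<open>\<not> 0 < ?w g\<close> cweight_nonneg[of \<alpha> V g] by simp
    ultimately show ?thesis unfolding cfg_weight_def by (metis (no_types, lifting) prod_zero)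
  qed
  have sums: "(\<Sum>\<eta>\<in>configs \<Lambda>. cfg_weight \<alpha> V \<eta> * F \<eta>) = (\<Sum>\<xi>\<in>H.St. H.wt \<xi> * F (cfg \<xi>))" for F :: "_ \<Rightarrow> real"
  proof -
    have "(\<Sum>\<eta>\<in>configs \<Lambda>. cfg_weight \<alpha> V \<eta> * F \<eta>) = (\<Sum>\<eta>\<in>cfg ` H.St. cfg_weight \<alpha> V \<eta> * F \<eta>)"
      by (rule sum.mono_neutral_right[OF fin]) (use cfg_in zero in auto)
    also have "\<dots> = (\<Sum>\<xi>\<in>H.St. cfg_weight \<alpha> V (cfg \<xi>) * F (cfg \<xi>))"
      by (simp add: sum.reindex[OF inj])
    also have "\<dots> = (\<Sum>\<xi>\<in>H.St. H.wt \<xi> * F (cfg \<xi>))" using cfg_weight by simp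
    finally show ?thesis .
  qed
  let ?Z = "\<Sum>\<eta>'\<in>configs \<Lambda>. cfg_weight \<alpha> V \<eta>'"
  have Z: "?Z = sum H.wt H.St" using sums[of "\<lambda>_. 1"] by simp
  let ?d = "\<lambda>\<eta>. indicator (configs \<Lambda>) \<eta> * cfg_weight \<alpha> V \<eta> / ?Z"
  have wn: "0 \<le> cfg_weight \<alpha> V \<eta>" for \<eta> unfolding cfg_weight_def by (intro prod_nonneg ballI cweight_nonneg)
  have dn: "0 \<le> ?d \<eta>" for \<eta> using wn by (intro divide_nonneg_nonneg mult_nonneg_nonneg sum_nonneg) auto
  have "(\<integral>\<eta>. f \<eta> \<partial>gibbs \<alpha> V \<Lambda>) = (\<integral>\<eta>. ?d \<eta> *\<^sub>R f \<eta> \<partial>count_space UNIV)"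
    unfolding gibbs_def by (rule integral_density) (use dn in auto)
  also have "\<dots> = (\<Sum>\<eta> | \<eta> \<in> UNIV \<and> ?d \<eta> *\<^sub>R f \<eta> \<noteq> 0. ?d \<eta> *\<^sub>R f \<eta>)"
    by (rule lebesgue_integral_count_space_finite_support, rule finite_subset[OF _ fin]) (auto simp: indicator_def)
  also have "\<dots> = (\<Sum>\<eta>\<in>configs \<Lambda>. ?d \<eta> *\<^sub>R f \<eta>)"
    by (rule sum.mono_neutral_left[OF fin]) (auto simp: indicator_def)
  also have "\<dots> = (\<Sum>\<eta>\<in>configs \<Lambda>. cfg_weight \<alpha> V \<eta> * (f \<eta> / ?Z))"
    by (intro sum.cong) auto
  also have "\<dots> = (\<Sum>\<xi>\<in>H.St. H.wt \<xi> * (f (cfg \<xi>) / ?Z))" by (rule sums)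
  also have "\<dots> = (\<Sum>\<xi>\<in>H.St. f (cfg \<xi>) * H.gibbs_pi \<xi>)"
    unfolding Z H.gibbs_pi_def by (simp add: mult.commute)
  finally show ?thesis .
qed

text \<open>The fictitious point \<open>(g, t, 1)\<close> has every point of type \<open>g\<close>
  alive at \<open>t\<close> as a first-order ancestor, because \<open>g\<close> is incompatible with
  itself. Its single finite clan therefore contains these points and their clans, and any volume
  containing the supports in it leaves \<open>eta\<close> unchanged. The lifetime 1 is an arbitrary
  positive choice.\<close>

lemma finite_clan_eta_eventually:
  assumes cyc: "g \<in> cycles" and fin: "finite (clan M (g, t, 1))"
    and nb: "\<And>\<phi>. \<phi> \<in> M \<Longrightarrow> 0 < snd (snd \<phi>) \<Longrightarrow> birth \<phi> \<noteq> t"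
    and supp: "\<And>\<phi>. \<phi> \<in> M \<Longrightarrow> fst \<phi> \<in> cycles"
  shows "\<forall>\<^sub>F \<Lambda> in finite_sets_at_top. eta (restr M \<Lambda>) t g = eta M t g"
proof -
  have anc: "\<phi> \<in> anc1 M (g, t, 1)" if "\<phi> \<in> M" "fst \<phi> = g" "birth \<phi> \<le> t" "t < death \<phi>" for \<phi>
  proof -
    have "birth \<phi> \<noteq> t" using nb[OF that(1)] that by auto
    then show ?thesis using that incompat_self[OF cyc] by (auto simp: anc1_iff)
  qed
  define X where "X = (\<Union>\<phi>\<in>clan M (g, t, 1). supp (fst \<phi>))"
  have "finite X" unfolding X_def
    using fin supp clan_props[of _ M "(g, t, 1)"] by (auto simp: cycles_def is_cycle_def)
  moreover have "eta (restr M \<Lambda>) t g = eta M t g" if "X \<subseteq> \<Lambda>" for \<Lambda>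
  proof (rule eta_cong)
    show "restr M \<Lambda> \<subseteq> M" by (auto simp: restr_def)
    have sub: "clan M (g, t, 1) \<subseteq> restr M \<Lambda>"
      using that clan_props[of _ M "(g, t, 1)"] by (auto simp: restr_def X_def)
    fix \<phi> assume "\<phi> \<in> M" "fst \<phi> = g" "birth \<phi> \<le> t" "t < death \<phi>"
    from anc[OF this] show "\<phi> \<in> restr M \<Lambda> \<and> clan M \<phi> \<subseteq> restr M \<Lambda>"
      using sub clan_anc1_subset[of \<phi> M "(g, t, 1)"] anc1_subset_clan[of M "(g, t, 1)"] by blast
  qed
  ultimately show ?thesis unfolding eventually_finite_subsets_at_top by blast
qed

section \<open>Passage to the whole lattice\<close>

context ppp
begin

context
  assumes clans: "AE \<omega> in M. \<forall>g\<in>cycles. \<forall>t s. 0 < s \<longrightarrow> finite (clan (N \<omega>) (g, t, s))"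
begin

lemma AE_eta_eventually:
  "AE \<omega> in M. \<forall>g\<in>cycles. \<forall>\<^sub>F \<Lambda> in finite_sets_at_top. eta (restr (N \<omega>) \<Lambda>) t g = eta (N \<omega>) t g"
  using clans AE_no_birth_at[of t] AE_space
  by eventually_elim (use N_cycles in \<open>auto intro!: finite_clan_eta_eventually\<close>)

context
  fixes \<Lambda> :: "(int^'d) set" and t :: real
  assumes \<Lambda>: "finite \<Lambda>"
begin

lemmas pcp = pos_cycles_props[OF \<Lambda>, of \<alpha> V]

interpretation H: hardcore "pos_cycles \<alpha> V \<Lambda>" w incompat by (rule hardcore_pos_cycles[OF \<Lambda>])

text \<open>A finite volume carries finitely many cycles, so the points alive at \<open>t\<close>
  lie in finitely many finite clans. Together with their own clans they form the finite set
  \<open>T\<close>, which a sufficiently long window contains; this settles all \<open>g\<close> at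
  once. Dropping cycles of weight zero removes no point, almost surely.\<close>

lemma AE_window_eventually:
  "AE \<omega> in M. \<forall>\<^sub>F n in sequentially. \<forall>g. eta (window (pos_cycles \<alpha> V \<Lambda>) t n \<omega>) t g = eta (restr (N \<omega>) \<Lambda>) t g"
  using clans AE_no_birth_at[of t] AE_positive_weight AE_space
proof eventually_elim
  case (elim \<omega>)
  let ?M = "restr (N \<omega>) \<Lambda>" and ?C = "{g. g \<in> cycles \<and> supp g \<subseteq> \<Lambda>}"
  define Al where "Al = {\<phi> \<in> ?M. birth \<phi> \<le> t \<and> t < death \<phi>}"
  have sub: "?M \<subseteq> N \<omega>" by (auto simp: restr_def)
  have M_C: "fst \<phi> \<in> ?C" if "\<phi> \<in> ?M" for \<phi> using that N_cycles[OF elim(4)] by (auto simp: restr_def)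
  have fin: "finite (clan ?M \<phi>)" if "fst \<phi> \<in> cycles" "0 < snd (snd \<phi>)" for \<phi>
  proof -
    have "finite (clan (N \<omega>) (fst \<phi>, birth \<phi>, snd (snd \<phi>)))" using elim(1) that by blast
    then show ?thesis using clan_mono[OF sub, of \<phi>] by (simp add: finite_subset)
  qed
  have "Al \<subseteq> (\<Union>g\<in>?C. clan ?M (g, t, 1))"
  proof
    fix \<phi> assume \<phi>: "\<phi> \<in> Al"
    then have "birth \<phi> \<noteq> t" using elim(2) sub by (auto simp: Al_def)
    then have "\<phi> \<in> anc1 ?M (fst \<phi>, t, 1)"
      using \<phi> M_C[of \<phi>] incompat_self[of "fst \<phi>"] by (auto simp: Al_def anc1_iff)
    then have "\<phi> \<in> clan ?M (fst \<phi>, t, 1)" by (rule subsetD[OF anc1_subset_clan])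
    moreover have "fst \<phi> \<in> ?C" using M_C \<phi> by (simp add: Al_def)
    ultimately show "\<phi> \<in> (\<Union>g\<in>?C. clan ?M (g, t, 1))" by (rule UN_I[rotated])
  qed
  then have finAl: "finite Al"
    by (rule finite_subset) (use finite_cycles_in[OF \<Lambda>] fin in auto)
  define T where "T = Al \<union> (\<Union>\<phi>\<in>Al. clan ?M \<phi>)"
  have finT: "finite T"
    unfolding T_def using finAl fin M_C by (auto simp: Al_def)
  have T: "\<psi> \<in> ?M \<and> 0 < snd (snd \<psi>) \<and> birth \<psi> \<le> t" if \<psi>: "\<psi> \<in> T" for \<psi>
  proof -
    consider "\<psi> \<in> Al" | \<phi> where "\<phi> \<in> Al" "\<psi> \<in> clan ?M \<phi>" using \<psi> unfolding T_def by blast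
    then show ?thesis
    proof cases
      case 1
      then show ?thesis by (auto simp: Al_def)
    next
      case 2
      then show ?thesis using clan_props[OF 2(2)] by (auto simp: Al_def)
    qed
  qed
  have "\<forall>\<psi>\<in>T. \<forall>\<^sub>F n in sequentially. t - birth \<psi> < real n"
    using filterlim_real_sequentially by (auto simp: filterlim_at_top_dense)
  then have "\<forall>\<^sub>F n in sequentially. \<forall>\<psi>\<in>T. t - birth \<psi> < real n"
    using finT by (simp add: eventually_ball_finite)
  then show ?case
  proof eventually_elim
    case (elim n)
    let ?F = "window (pos_cycles \<alpha> V \<Lambda>) t n \<omega>"
    note wd = window_def[OF pcp, of t n \<omega>]
    have F: "\<psi> \<in> ?F \<longleftrightarrow> \<psi> \<in> N \<omega> \<and> fst \<psi> \<in> pos_cycles \<alpha> V \<Lambda> \<and> t - real n < birth \<psi> \<and> birth \<psi> \<le> t \<and> 0 < snd (snd \<psi>)" for \<psi>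
      unfolding wd by (cases \<psi>) auto
    have "\<psi> \<in> ?F" if "\<psi> \<in> T" for \<psi>
      unfolding F using T[OF that] elim that sub M_C[of \<psi>] \<open>\<forall>\<phi>\<in>N \<omega>. 0 < w (fst \<phi>)\<close>
      by (auto simp: pos_cycles_def)
    then have TF: "T \<subseteq> ?F" by blast
    have FM: "?F \<subseteq> ?M" using F by (auto simp: restr_def pos_cycles_def)
    show ?case
    proof (intro allI eta_cong[OF FM])
      fix g \<phi> assume "\<phi> \<in> ?M" "birth \<phi> \<le> t" "t < death \<phi>"
      then have "\<phi> \<in> Al" by (auto simp: Al_def)
      then show "\<phi> \<in> ?F \<and> clan ?M \<phi> \<subseteq> ?F" using TF unfolding T_def by blast
    qed
  qed
qed

lemma AE_eta_restr_state:
  "AE \<omega> in M. \<exists>\<xi>\<in>H.St. \<forall>g. eta (restr (N \<omega>) \<Lambda>) t g = (if g \<in> \<xi> then 1 else 0)"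
proof -
  have "AE \<omega> in M. \<forall>n. \<exists>\<xi>\<in>H.St. \<forall>g. eta (window (pos_cycles \<alpha> V \<Lambda>) t n \<omega>) t g = (if g \<in> \<xi> then 1 else 0)"
    unfolding AE_all_countable using window_law(1)[OF pcp] by blast
  with AE_window_eventually show ?thesis
  proof eventually_elim
    case (elim \<omega>)
    then obtain n where "\<forall>g. eta (window (pos_cycles \<alpha> V \<Lambda>) t n \<omega>) t g = eta (restr (N \<omega>) \<Lambda>) t g"
      by (auto simp: eventually_sequentially)
    then show ?case using elim(2) by metis
  qed
qed

definition state :: "'w \<Rightarrow> (int^'d \<Rightarrow> int^'d) set" where
  "state \<omega> = {g. eta (restr (N \<omega>) \<Lambda>) t g = 1}"

lemma state_law:
  shows "{\<omega> \<in> space M. state \<omega> = \<xi>} \<in> sets (completion M)"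
    and "\<xi> \<in> H.St \<Longrightarrow> measure (completion M) {\<omega> \<in> space M. state \<omega> = \<xi>} = H.gibbs_pi \<xi>"
proof -
  interpret PC: prob_space "completion M" by (rule prob_space_completion)
  let ?A = "\<lambda>n. {\<omega> \<in> space M. {g. eta (window (pos_cycles \<alpha> V \<Lambda>) t n \<omega>) t g = 1} = \<xi>}"
  let ?B = "{\<omega> \<in> space M. state \<omega> = \<xi>}"
  have A: "?A n \<in> sets (completion M)" for n by (rule window_law(2)[OF pcp])
  have B: "?B \<subseteq> space (completion M)" by auto
  have ev: "AE \<omega> in completion M. \<forall>\<^sub>F n in sequentially. \<omega> \<in> ?A n \<longleftrightarrow> \<omega> \<in> ?B"
  proof (rule AE_completion)
    show "AE \<omega> in M. \<forall>\<^sub>F n in sequentially. \<omega> \<in> ?A n \<longleftrightarrow> \<omega> \<in> ?B"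
      using AE_window_eventually
    proof eventually_elim
      case (elim \<omega>)
      then show ?case by eventually_elim (simp add: state_def)
    qed
  qed
  note lim = completion.AE_eventually_event[OF PC.finite_measure_axioms A B ev]
  show "?B \<in> sets (completion M)" by (rule lim(1))
  show "measure (completion M) ?B = H.gibbs_pi \<xi>" if "\<xi> \<in> H.St"
    using LIMSEQ_unique[OF lim(2) window_law_near_gibbs[OF pcp that]] .
qed

lemma AE_state: "AE \<omega> in M. state \<omega> \<in> H.St \<and> (\<forall>g. eta (restr (N \<omega>) \<Lambda>) t g = (if g \<in> state \<omega> then 1 else 0))"
  using AE_eta_restr_state
proof eventually_elim
  case (elim \<omega>)
  then obtain \<xi> where "\<xi> \<in> H.St" "\<forall>g. eta (restr (N \<omega>) \<Lambda>) t g = (if g \<in> \<xi> then 1 else 0)" by blast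
  moreover from this(2) have "state \<omega> = \<xi>" by (auto simp: state_def)
  ultimately show ?case by simp
qed

lemma eta_restr_event: "{\<omega> \<in> space M. eta (restr (N \<omega>) \<Lambda>) t g = v} \<in> sets (completion M)"
proof (rule completion.in_sets_AE)
  let ?\<Xi> = "{\<xi> \<in> H.St. (if g \<in> \<xi> then 1 else 0) = v}"
  let ?A = "\<Union>\<xi>\<in>?\<Xi>. {\<omega> \<in> space M. state \<omega> = \<xi>}"
  show "?A \<in> sets (completion M)" using H.finite_St state_law(1) by (intro sets.finite_UN) auto
  show "AE \<omega> in completion M. \<omega> \<in> ?A \<longleftrightarrow> \<omega> \<in> {\<omega> \<in> space M. eta (restr (N \<omega>) \<Lambda>) t g = v}"
    by (rule AE_completion, rule AE_mp[OF AE_state]) auto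
qed auto

text \<open>\<open>\<Phi>\<close> is a version of \<open>f\<close> evaluated at the finite-volume
  configuration. Written as a finite sum over states it is measurable and integrable for arbitrary
  \<open>f\<close>, and it realises the Gibbs integral on the common probability space.\<close>

lemma gibbs_integral_state:
  fixes f :: "((int^'d \<Rightarrow> int^'d) \<Rightarrow> nat) \<Rightarrow> real"
  defines "\<Phi> \<equiv> \<lambda>\<omega>. \<Sum>\<xi>\<in>H.St. f (cfg \<xi>) * indicator {\<omega> \<in> space M. state \<omega> = \<xi>} \<omega>"
  shows "\<Phi> \<in> borel_measurable (completion M)"
    and "(\<integral>\<omega>. \<Phi> \<omega> \<partial>completion M) = (\<integral>\<eta>. f \<eta> \<partial>gibbs \<alpha> V \<Lambda>)"
    and "AE \<omega> in completion M. \<Phi> \<omega> = f (restrict (eta (restr (N \<omega>) \<Lambda>) t) cycles)"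
proof -
  interpret PC: prob_space "completion M" by (rule prob_space_completion)
  show "\<Phi> \<in> borel_measurable (completion M)"
    unfolding \<Phi>_def using state_law(1) by (intro borel_measurable_sum borel_measurable_times borel_measurable_indicator) auto
  have "(\<integral>\<omega>. \<Phi> \<omega> \<partial>completion M) = (\<Sum>\<xi>\<in>H.St. \<integral>\<omega>. f (cfg \<xi>) * indicator {\<omega> \<in> space M. state \<omega> = \<xi>} \<omega> \<partial>completion M)"
    unfolding \<Phi>_def using state_law(1)
    by (intro Bochner_Integration.integral_sum integrable_mult_right PC.integrable_const_bound[where B = 1]
        borel_measurable_indicator) (auto simp: indicator_def)
  also have "\<dots> = (\<Sum>\<xi>\<in>H.St. f (cfg \<xi>) * H.gibbs_pi \<xi>)"
  proof (rule sum.cong[OF refl])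
    fix \<xi> assume "\<xi> \<in> H.St"
    moreover have "{\<omega> \<in> space M. state \<omega> = \<xi>} \<inter> space M = {\<omega> \<in> space M. state \<omega> = \<xi>}" by auto
    ultimately show "(\<integral>\<omega>. f (cfg \<xi>) * indicator {\<omega> \<in> space M. state \<omega> = \<xi>} \<omega> \<partial>completion M) = f (cfg \<xi>) * H.gibbs_pi \<xi>"
      using state_law by simp
  qed
  also have "\<dots> = (\<integral>\<eta>. f \<eta> \<partial>gibbs \<alpha> V \<Lambda>)" by (rule gibbs_integral[OF \<Lambda>, symmetric])
  finally show "(\<integral>\<omega>. \<Phi> \<omega> \<partial>completion M) = (\<integral>\<eta>. f \<eta> \<partial>gibbs \<alpha> V \<Lambda>)" .
  have "AE \<omega> in M. \<Phi> \<omega> = f (restrict (eta (restr (N \<omega>) \<Lambda>) t) cycles)"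
    using AE_state AE_space
  proof eventually_elim
    case (elim \<omega>)
    have "\<Phi> \<omega> = (\<Sum>\<xi>\<in>H.St. if \<xi> = state \<omega> then f (cfg \<xi>) else 0)"
      unfolding \<Phi>_def using elim(2) by (intro sum.cong) (auto simp: indicator_def)
    also have "\<dots> = f (cfg (state \<omega>))" using elim(1) H.finite_St by simp
    also have "cfg (state \<omega>) = restrict (eta (restr (N \<omega>) \<Lambda>) t) cycles"
      unfolding cfg_def using elim(1) by (intro restrict_ext) simp
    finally show ?case .
  qed
  then show "AE \<omega> in completion M. \<Phi> \<omega> = f (restrict (eta (restr (N \<omega>) \<Lambda>) t) cycles)" by (rule AE_completion)
qed

end

lemma eta_measurable:
  assumes "g \<in> cycles"
  shows "(\<lambda>\<omega>. eta (N \<omega>) t g) \<in> measurable (completion M) (count_space UNIV)"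
  unfolding measurable_count_space_eq2_countable
proof safe
  interpret PC: prob_space "completion M" by (rule prob_space_completion)
  fix v
  obtain Y :: "nat \<Rightarrow> (int^'d) set" where Y: "filterlim Y finite_sets_at_top sequentially"
    using exists_filterlim_finite_sets_at_top by blast
  \<comment> \<open>Convergence along the net makes the members finite only eventually; the others
    are replaced by the empty set so that the finite-volume results apply to every index.\<close>
  define Y' where "Y' n = (if finite (Y n) then Y n else {})" for n
  have "\<forall>\<^sub>F n in sequentially. finite (Y n)"
    using Y unfolding filterlim_finite_subsets_at_top by (auto elim!: allE[of _ "{}"] elim: eventually_mono)
  then have "\<forall>\<^sub>F n in sequentially. Y n = Y' n" by eventually_elim (simp add: Y'_def)
  then have Y': "filterlim Y' finite_sets_at_top sequentially" using Y filterlim_cong by fast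
  let ?A = "\<lambda>n. {\<omega> \<in> space M. eta (restr (N \<omega>) (Y' n)) t g = v}" and ?B = "{\<omega> \<in> space M. eta (N \<omega>) t g = v}"
  have "?B \<in> sets (completion M)"
  proof (rule completion.AE_eventually_event(1)[OF PC.finite_measure_axioms])
    show "?A n \<in> sets (completion M)" for n by (rule eta_restr_event) (simp add: Y'_def)
    show "AE \<omega> in completion M. \<forall>\<^sub>F n in sequentially. \<omega> \<in> ?A n \<longleftrightarrow> \<omega> \<in> ?B"
    proof (rule AE_completion)
      show "AE \<omega> in M. \<forall>\<^sub>F n in sequentially. \<omega> \<in> ?A n \<longleftrightarrow> \<omega> \<in> ?B"
        using AE_eta_eventually[of t]
      proof eventually_elim
        case (elim \<omega>)
        then have "\<forall>\<^sub>F \<Lambda> in finite_sets_at_top. eta (restr (N \<omega>) \<Lambda>) t g = eta (N \<omega>) t g" using assms by blast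
        from eventually_compose_filterlim[OF this Y'] show ?case by eventually_elim auto
      qed
    qed
  qed auto
  moreover have "(\<lambda>\<omega>. eta (N \<omega>) t g) -` {v} \<inter> space (completion M) = ?B" by auto
  ultimately show "(\<lambda>\<omega>. eta (N \<omega>) t g) -` {v} \<inter> space (completion M) \<in> sets (completion M)" by simp
qed auto

text \<open>Gibbs integrals are expectations of \<open>f\<close> of the finite-volume
  configurations, all built from the same \<open>N\<close>. Almost surely each coordinate is
  eventually constant along an exhausting sequence, which is convergence in the product of discrete
  spaces, and boundedness of \<open>f\<close> permits dominated convergence. As
  \<open>gibbs \<alpha> V\<close> does not involve \<open>t\<close>, the limiting integrals are the
  same for all times.\<close>

lemma gibbs_weak_conv:
  "weak_conv_net (gibbs \<alpha> V)
     (distr (completion M) (PiM cycles (\<lambda>_. count_space UNIV)) (\<lambda>\<omega>. restrict (eta (N \<omega>) t) cycles))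
     (product_topology (\<lambda>_. discrete_topology UNIV) cycles) finite_sets_at_top"
  unfolding weak_conv_net_def
proof (intro allI impI, elim conjE exE)
  fix f :: "((int^'d \<Rightarrow> int^'d) \<Rightarrow> nat) \<Rightarrow> real" and C
  assume cont: "continuous_map (product_topology (\<lambda>_. discrete_topology UNIV) cycles) euclideanreal f"
    and bnd: "\<forall>x\<in>topspace (product_topology (\<lambda>_. discrete_topology UNIV) cycles). \<bar>f x\<bar> \<le> C"
  interpret PC: prob_space "completion M" by (rule prob_space_completion)
  let ?R = "\<lambda>\<omega>. restrict (eta (N \<omega>) t) cycles"
  have fm: "f \<in> borel_measurable (PiM cycles (\<lambda>_. count_space UNIV))"
    by (rule product_discrete_continuous_measurable[OF countable_cycles cont])
  have Rm: "?R \<in> measurable (completion M) (PiM cycles (\<lambda>_. count_space UNIV))"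
    by (rule measurable_restrict) (rule eta_measurable)
  have fR: "(\<lambda>\<omega>. f (?R \<omega>)) \<in> borel_measurable (completion M)"
    by (rule measurable_compose[OF Rm fm])
  have bR: "\<bar>f (restrict x cycles)\<bar> \<le> C" for x using bnd by auto
  have "((\<lambda>\<Lambda>. \<integral>\<eta>. f \<eta> \<partial>gibbs \<alpha> V \<Lambda>) \<longlongrightarrow> (\<integral>\<omega>. f (?R \<omega>) \<partial>completion M)) finite_sets_at_top"
  proof (rule tendsto_finite_sets_at_top_seqI)
    fix Y :: "nat \<Rightarrow> (int^'d) set" assume Y: "filterlim Y finite_sets_at_top sequentially"
    define Y' where "Y' n = (if finite (Y n) then Y n else {})" for n
    have "\<forall>\<^sub>F n in sequentially. finite (Y n)"
      using Y unfolding filterlim_finite_subsets_at_top by (auto elim!: allE[of _ "{}"] elim: eventually_mono)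
    then have YY': "\<forall>\<^sub>F n in sequentially. Y n = Y' n" by eventually_elim (simp add: Y'_def)
    then have Y': "filterlim Y' finite_sets_at_top sequentially" using Y filterlim_cong by fast
    have finY: "finite (Y' n)" for n by (simp add: Y'_def)
    define \<Phi> where "\<Phi> n \<omega> = (\<Sum>\<xi>\<in>hardcore.St (pos_cycles \<alpha> V (Y' n)) incompat.
        f (cfg \<xi>) * indicator {\<omega> \<in> space M. state (Y' n) t \<omega> = \<xi>} \<omega>)" for n \<omega>
    note \<Phi> = gibbs_integral_state[OF finY, where f = f and t = t, folded \<Phi>_def]
    have ae: "AE \<omega> in completion M. \<forall>n. \<Phi> n \<omega> = f (restrict (eta (restr (N \<omega>) (Y' n)) t) cycles)"
      unfolding AE_all_countable using \<Phi>(3) by blast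
    have "(\<lambda>n. \<integral>\<omega>. \<Phi> n \<omega> \<partial>completion M) \<longlonglongrightarrow> (\<integral>\<omega>. f (?R \<omega>) \<partial>completion M)"
    proof (rule integral_dominated_convergence[where w = "\<lambda>_. C"])
      show "AE \<omega> in completion M. (\<lambda>n. \<Phi> n \<omega>) \<longlonglongrightarrow> f (?R \<omega>)"
        using ae AE_completion[OF AE_eta_eventually[of t]]
      proof eventually_elim
        case (elim \<omega>)
        have "(\<lambda>n. f (restrict (eta (restr (N \<omega>) (Y' n)) t) cycles)) \<longlonglongrightarrow> f (?R \<omega>)"
        proof (rule product_discrete_continuous_tendsto[OF cont])
          fix g :: "int^'d \<Rightarrow> int^'d" assume g: "g \<in> cycles"
          then have "\<forall>\<^sub>F \<Lambda> in finite_sets_at_top. eta (restr (N \<omega>) \<Lambda>) t g = eta (N \<omega>) t g" using elim(2) by blast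
          from eventually_compose_filterlim[OF this Y']
          show "\<forall>\<^sub>F n in sequentially. restrict (eta (restr (N \<omega>) (Y' n)) t) cycles g = restrict (eta (N \<omega>) t) cycles g"
            by eventually_elim (simp add: g)
        qed auto
        then show ?case using elim(1) by simp
      qed
      show "AE \<omega> in completion M. norm (\<Phi> n \<omega>) \<le> C" for n
        using ae by eventually_elim (use bR in simp)
    qed (use fR \<Phi>(1) in auto)
    then have "(\<lambda>n. \<integral>\<eta>. f \<eta> \<partial>gibbs \<alpha> V (Y' n)) \<longlonglongrightarrow> (\<integral>\<omega>. f (?R \<omega>) \<partial>completion M)"
      unfolding \<Phi>(2) .
    moreover have "\<forall>\<^sub>F n in sequentially. (\<integral>\<eta>. f \<eta> \<partial>gibbs \<alpha> V (Y' n)) = (\<integral>\<eta>. f \<eta> \<partial>gibbs \<alpha> V (Y n))"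
      using YY' by eventually_elim simp
    ultimately show "(\<lambda>n. \<integral>\<eta>. f \<eta> \<partial>gibbs \<alpha> V (Y n)) \<longlonglongrightarrow> (\<integral>\<omega>. f (?R \<omega>) \<partial>completion M)"
      by (rule Lim_transform_eventually)
  qed
  also have "(\<integral>\<omega>. f (?R \<omega>) \<partial>completion M) = (\<integral>x. f x \<partial>distr (completion M) (PiM cycles (\<lambda>_. count_space UNIV)) ?R)"
    by (rule integral_distr[OF Rm fm, symmetric])
  finally show "((\<lambda>\<Lambda>. \<integral>x. f x \<partial>gibbs \<alpha> V \<Lambda>) \<longlongrightarrow>
    (\<integral>x. f x \<partial>distr (completion M) (PiM cycles (\<lambda>_. count_space UNIV)) ?R)) finite_sets_at_top" .
qed

end

end

theorem theorem3p3:
  fixes \<alpha> :: real and V :: "int^'d \<Rightarrow> ereal" and M :: "'w measure"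
    and N :: "'w \<Rightarrow> ((int^'d \<Rightarrow> int^'d) \<times> real \<times> real) set"
  assumes "\<alpha> > 0" and "\<forall>x. V x \<ge> 0" and "V 0 = 0" and "strictly_convex_pot V"
    and "is_PPP M N (intensity \<alpha> V)"
    and "AE \<omega> in M. \<forall>g\<in>cycles. \<forall>t s. 0 < s \<longrightarrow> finite (clan (N \<omega>) (g, t, s))"
  shows "(\<forall>t. \<forall>g\<in>cycles. AE \<omega> in M.
            ((\<lambda>\<Lambda>. eta (restr (N \<omega>) \<Lambda>) t g) \<longlongrightarrow> eta (N \<omega>) t g) finite_sets_at_top)
       \<and> (\<forall>t. weak_conv_net (gibbs \<alpha> V)
              (distr (completion M) (PiM cycles (\<lambda>_. count_space UNIV))
                 (\<lambda>\<omega>. restrict (eta (N \<omega>) t) cycles))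
              (product_topology (\<lambda>_. discrete_topology UNIV) cycles) finite_sets_at_top)"
proof -
  interpret ppp \<alpha> V M N by (rule ppp.intro) fact
  show ?thesis
  proof (intro conjI allI ballI)
    fix t and g :: "int^'d \<Rightarrow> int^'d" assume g: "g \<in> cycles"
    show "AE \<omega> in M. ((\<lambda>\<Lambda>. eta (restr (N \<omega>) \<Lambda>) t g) \<longlongrightarrow> eta (N \<omega>) t g) finite_sets_at_top"
      using AE_eta_eventually[OF assms(6), of t]
      by eventually_elim (use g in \<open>auto intro: tendsto_eventually\<close>)
  next
    fix t
    show "weak_conv_net (gibbs \<alpha> V)
        (distr (completion M) (PiM cycles (\<lambda>_. count_space UNIV)) (\<lambda>\<omega>. restrict (eta (N \<omega>) t) cycles))
        (product_topology (\<lambda>_. discrete_topology UNIV) cycles) finite_sets_at_top"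
      by (rule gibbs_weak_conv[OF assms(6)])
  qed
qed

end
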